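(* Let $G$ be a compact second countable group, let $A$ be a discrete $G$-module, and let $(A_m)_m$ be a direct system (directed by inclusion) of $G$-submodules of $A$ such that $\bigcup_m A_m=A$. Then for every $p\ge 0$ the direct limit of the maps on cohomology induced by the inclusions $A_m\subseteq A$, $$\lim_{m\to}\mathrm{H}^p_{\mathrm{m}}(G,A_m)\longrightarrow\mathrm{H}^p_{\mathrm{m}}(G,A),$$ is an isomorphism.
   Context: A Polish $G$-module is a Polish Abelian group $A$ with a continuous action $T:G\curvearrowright A$ by continuous automorphisms; all modules are Polish (so a discrete module is countable). For $p\ge 1$, $\mathcal{C}^p(G,A)$ is the group of Haar-a.e. equivalence classes of Borel maps $G^p\to A$; $\mathcal{C}^0(G,A)=A$, and $\mathcal{C}^{p}(G,A)=(0)$ for $p<0$. The coboundary $d:\mathcal{C}^p(G,A)\to\mathcal{C}^{p+1}(G,A)$ is $$d\phi(g_1,\dots,g_{p+1}) = T^{g_1}\phi(g_2,\dots,g_{p+1})+\sum_{i=1}^p(-1)^i\phi(g_1,\dots,g_ig_{i+1},\dots,g_{p+1})+(-1)^{p+1}\phi(g_1,\dots,g_p)$$ (a.e.). Put $\mathcal{Z}^p(G,A)=\ker d|_{\mathcal{C}^p(G,A)}$, $\mathcal{B}^p(G,A)=d(\mathcal{C}^{p-1}(G,A))$ and $\mathrm{H}^p_{\mathrm{m}}(G,A)=\mathcal{Z}^p(G,A)/\mathcal{B}^p(G,A)$. *)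

theory Defs
  imports "HOL-Analysis.Analysis" "HOL-Algebra.Coset"
begin

text \<open>
  The acting group is a type of class \<^class>\<open>topological_group_add\<close>. As usual for
  \<^class>\<open>group_add\<close>, it is written additively but is not assumed commutative: \<open>g + h\<close> is the
  product and \<open>0\<close> the identity. A module is an abelian group carried by \<open>topspace Y\<close>,
  a subset of a type of class \<^class>\<open>ab_group_add\<close>, and topologized by \<open>Y\<close>. The derived
  groups (cochains, cohomology, direct limits) are HOL-Algebra groups, written multiplicatively.
\<close>

text \<open>On a second countable group, finiteness on compact sets makes regularity automatic.\<close>

definition haar_measure :: "'g::topological_group_add measure \<Rightarrow> bool" where
  "haar_measure \<mu> \<longleftrightarrow>
     sets \<mu> = sets borel \<and>
     emeasure \<mu> UNIV \<noteq> 0 \<and>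
     (\<forall>K. compact K \<longrightarrow> emeasure \<mu> K < \<infinity>) \<and>
     (\<forall>g. \<forall>S\<in>sets borel. emeasure \<mu> ((\<lambda>x. g + x) ` S) = emeasure \<mu> S)"

text \<open>Each \<open>T g\<close> is an automorphism because it is a homomorphism with inverse \<open>T (- g)\<close>.\<close>

definition polish_module ::
  "('g::topological_group_add \<Rightarrow> 'a::ab_group_add \<Rightarrow> 'a) \<Rightarrow> 'a topology \<Rightarrow> bool" where
  "polish_module T Y \<longleftrightarrow>
     completely_metrizable_space Y \<and> second_countable Y \<and>
     0 \<in> topspace Y \<and>
     continuous_map (prod_topology Y Y) Y (\<lambda>(a, b). a + b) \<and>
     continuous_map Y Y (\<lambda>a. - a) \<and>
     continuous_map (prod_topology euclidean Y) Y (\<lambda>(g, a). T g a) \<and>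
     (\<forall>g. \<forall>a\<in>topspace Y. \<forall>b\<in>topspace Y. T g (a + b) = T g a + T g b) \<and>
     (\<forall>a\<in>topspace Y. T 0 a = a) \<and>
     (\<forall>g h. \<forall>a\<in>topspace Y. T (g + h) a = T g (T h a))"

definition submodule ::
  "('g::topological_group_add \<Rightarrow> 'a::ab_group_add \<Rightarrow> 'a) \<Rightarrow> 'a topology \<Rightarrow> 'a set \<Rightarrow> bool" where
  "submodule T Y M \<longleftrightarrow> M \<subseteq> topspace Y \<and> polish_module T (subtopology Y M)"

definition borel_of :: "'a topology \<Rightarrow> 'a measure" where
  "borel_of Y = sigma (topspace Y) {U. openin Y U}"

text \<open>
  A point \<open>(g\<^sub>1, \<dots>, g\<^sub>p)\<close> of \<open>G\<^sup>p\<close> is a function \<open>x\<close> extensional on \<open>{1..p}\<close>. The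
  product \<open>\<sigma>\<close>-algebra is the Borel \<open>\<sigma>\<close>-algebra of \<open>G\<^sup>p\<close> since \<open>G\<close> is second countable.
  \<open>G\<^sup>0\<close> is a single point of mass 1, so that degree 0 cochains are elements of the module.
\<close>

definition haar_power :: "'g measure \<Rightarrow> nat \<Rightarrow> (nat \<Rightarrow> 'g) measure" where
  "haar_power \<mu> p = Pi\<^sub>M {1..p} (\<lambda>_. \<mu>)"

definition borel_maps ::
  "'g measure \<Rightarrow> 'a::ab_group_add topology \<Rightarrow> nat \<Rightarrow> ((nat \<Rightarrow> 'g) \<Rightarrow> 'a) monoid" where
  "borel_maps \<mu> Y p =
     \<lparr>carrier = measurable (haar_power \<mu> p) (borel_of Y),
      mult = (\<lambda>\<phi> \<psi> x. \<phi> x + \<psi> x),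
      one = (\<lambda>_. 0)\<rparr>"

definition null_maps ::
  "'g measure \<Rightarrow> 'a::ab_group_add topology \<Rightarrow> nat \<Rightarrow> ((nat \<Rightarrow> 'g) \<Rightarrow> 'a) set" where
  "null_maps \<mu> Y p =
     {\<phi> \<in> carrier (borel_maps \<mu> Y p). AE x in haar_power \<mu> p. \<phi> x = 0}"

text \<open>
  A coset of the null maps is an a.e. equivalence class. Values outside the space of
  \<open>haar_power \<mu> p\<close> are unconstrained in \<^const>\<open>borel_maps\<close> and are identified here as well.
\<close>

definition cochains ::
  "'g measure \<Rightarrow> 'a::ab_group_add topology \<Rightarrow> nat \<Rightarrow> ((nat \<Rightarrow> 'g) \<Rightarrow> 'a) set monoid" where
  "cochains \<mu> Y p = borel_maps \<mu> Y p Mod null_maps \<mu> Y p"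

text \<open>
  For a homomorphism \<open>f\<close> from \<open>G\<close> to \<open>H\<close> mapping \<open>M\<close> into \<open>N\<close>, the following is the
  induced map from \<open>G Mod M\<close> to \<open>H Mod N\<close>; the union is over equal sets.
\<close>

definition induced_map ::
  "('c, 'm) monoid_scheme \<Rightarrow> 'c set \<Rightarrow> ('b \<Rightarrow> 'c) \<Rightarrow> 'b set \<Rightarrow> 'c set" where
  "induced_map H N f C = (\<Union>x\<in>C. N #>\<^bsub>H\<^esub> f x)"

definition alternating :: "nat \<Rightarrow> 'a::ab_group_add \<Rightarrow> 'a" where
  "alternating i a = (if even i then a else - a)"

definition coboundary_map ::
  "('g::group_add \<Rightarrow> 'a::ab_group_add \<Rightarrow> 'a) \<Rightarrow> nat \<Rightarrow>
   ((nat \<Rightarrow> 'g) \<Rightarrow> 'a) \<Rightarrow> ((nat \<Rightarrow> 'g) \<Rightarrow> 'a)" where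
  "coboundary_map T p \<phi> x =
     T (x 1) (\<phi> (\<lambda>j\<in>{1..p}. x (j + 1))) +
     (\<Sum>i\<in>{1..p}. alternating i
        (\<phi> (\<lambda>j\<in>{1..p}. if j < i then x j else if j = i then x i + x (i + 1) else x (j + 1)))) +
     alternating (p + 1) (\<phi> (\<lambda>j\<in>{1..p}. x j))"

definition coboundary ::
  "'g::group_add measure \<Rightarrow> ('g \<Rightarrow> 'a::ab_group_add \<Rightarrow> 'a) \<Rightarrow> 'a topology \<Rightarrow> nat \<Rightarrow>
   ((nat \<Rightarrow> 'g) \<Rightarrow> 'a) set \<Rightarrow> ((nat \<Rightarrow> 'g) \<Rightarrow> 'a) set" where
  "coboundary \<mu> T Y p =
     induced_map (borel_maps \<mu> Y (p + 1)) (null_maps \<mu> Y (p + 1)) (coboundary_map T p)"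

definition cocycles ::
  "'g::group_add measure \<Rightarrow> ('g \<Rightarrow> 'a::ab_group_add \<Rightarrow> 'a) \<Rightarrow> 'a topology \<Rightarrow> nat \<Rightarrow>
   ((nat \<Rightarrow> 'g) \<Rightarrow> 'a) set set" where
  "cocycles \<mu> T Y p = kernel (cochains \<mu> Y p) (cochains \<mu> Y (p + 1)) (coboundary \<mu> T Y p)"

fun coboundaries ::
  "'g::group_add measure \<Rightarrow> ('g \<Rightarrow> 'a::ab_group_add \<Rightarrow> 'a) \<Rightarrow> 'a topology \<Rightarrow> nat \<Rightarrow>
   ((nat \<Rightarrow> 'g) \<Rightarrow> 'a) set set" where
  "coboundaries \<mu> T Y 0 = {\<one>\<^bsub>cochains \<mu> Y 0\<^esub>}"
| "coboundaries \<mu> T Y (Suc p) = coboundary \<mu> T Y p ` carrier (cochains \<mu> Y p)"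

definition cohomology ::
  "'g::group_add measure \<Rightarrow> ('g \<Rightarrow> 'a::ab_group_add \<Rightarrow> 'a) \<Rightarrow> 'a topology \<Rightarrow> nat \<Rightarrow>
   ((nat \<Rightarrow> 'g) \<Rightarrow> 'a) set set monoid" where
  "cohomology \<mu> T Y p = (cochains \<mu> Y p)\<lparr>carrier := cocycles \<mu> T Y p\<rparr> Mod coboundaries \<mu> T Y p"

text \<open>
  The maps induced by the inclusion of a module into a larger module with topology \<open>Y\<close>. A map
  into the smaller module is itself a map into the larger one, and only the
  equivalence classes change.
\<close>

definition cochain_inclusion ::
  "'g measure \<Rightarrow> 'a::ab_group_add topology \<Rightarrow> nat \<Rightarrow>
   ((nat \<Rightarrow> 'g) \<Rightarrow> 'a) set \<Rightarrow> ((nat \<Rightarrow> 'g) \<Rightarrow> 'a) set" where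
  "cochain_inclusion \<mu> Y p = induced_map (borel_maps \<mu> Y p) (null_maps \<mu> Y p) (\<lambda>\<phi>. \<phi>)"

definition cohomology_inclusion ::
  "'g::group_add measure \<Rightarrow> ('g \<Rightarrow> 'a::ab_group_add \<Rightarrow> 'a) \<Rightarrow> 'a topology \<Rightarrow> nat \<Rightarrow>
   ((nat \<Rightarrow> 'g) \<Rightarrow> 'a) set set \<Rightarrow> ((nat \<Rightarrow> 'g) \<Rightarrow> 'a) set set" where
  "cohomology_inclusion \<mu> T Y p =
     induced_map (cochains \<mu> Y p) (coboundaries \<mu> T Y p) (cochain_inclusion \<mu> Y p)"

text \<open>
  Direct limit of groups \<open>G i\<close>, \<open>i \<in> I\<close>, with transition maps \<open>f i j\<close> for \<open>leq i j\<close>: the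
  disjoint union modulo eventual equality. For a directed system, the unions in the
  group operations are over equal sets.
\<close>

definition direct_limit_rel ::
  "'i set \<Rightarrow> ('i \<Rightarrow> 'i \<Rightarrow> bool) \<Rightarrow> ('i \<Rightarrow> ('b, 'm) monoid_scheme) \<Rightarrow> ('i \<Rightarrow> 'i \<Rightarrow> 'b \<Rightarrow> 'b) \<Rightarrow>
   (('i \<times> 'b) \<times> ('i \<times> 'b)) set" where
  "direct_limit_rel I leq G f =
     {((i, x), (j, y)). i \<in> I \<and> x \<in> carrier (G i) \<and> j \<in> I \<and> y \<in> carrier (G j) \<and>
        (\<exists>k\<in>I. leq i k \<and> leq j k \<and> f i k x = f j k y)}"

definition direct_limit ::
  "'i set \<Rightarrow> ('i \<Rightarrow> 'i \<Rightarrow> bool) \<Rightarrow> ('i \<Rightarrow> ('b, 'm) monoid_scheme) \<Rightarrow> ('i \<Rightarrow> 'i \<Rightarrow> 'b \<Rightarrow> 'b) \<Rightarrow>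
   ('i \<times> 'b) set monoid" where
  "direct_limit I leq G f =
     \<lparr>carrier = (SIGMA i:I. carrier (G i)) // direct_limit_rel I leq G f,
      mult = (\<lambda>P Q. \<Union>(i, x)\<in>P. \<Union>(j, y)\<in>Q. \<Union>k\<in>{k \<in> I. leq i k \<and> leq j k}.
                direct_limit_rel I leq G f `` {(k, f i k x \<otimes>\<^bsub>G k\<^esub> f j k y)}),
      one = (\<Union>i\<in>I. direct_limit_rel I leq G f `` {(i, \<one>\<^bsub>G i\<^esub>)})\<rparr>"

text \<open>The map out of the direct limit determined by maps \<open>h i\<close> compatible with the transitions.\<close>

definition direct_limit_map :: "('i \<Rightarrow> 'b \<Rightarrow> 'c) \<Rightarrow> ('i \<times> 'b) set \<Rightarrow> 'c" where
  "direct_limit_map h P = the_elem ((\<lambda>(i, x). h i x) ` P)"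

end

theory Submission
  imports Defs "HOL-Probability.Infinite_Product_Measure"
begin

text \<open>
  Injectivity and surjectivity are two instances of one relative statement, \<open>relative_cochain\<close>:
  if \<open>\<phi>\<close> is an \<open>A\<close>-valued \<open>p\<close>-cochain whose coboundary is \<open>A\<^sub>m\<close>-valued almost everywhere, then
  for some \<open>n\<close> with \<open>A\<^sub>m \<subseteq> A\<^sub>n\<close> it differs from an \<open>A\<^sub>n\<close>-valued cochain by a coboundary of \<open>A\<close>-valued
  cochains. For a cocycle \<open>\<phi>\<close> this says that its class comes from \<open>A\<^sub>n\<close>. If an \<open>A\<^sub>m\<close>-valued cocycle
  is \<open>d\<kappa>\<close> with \<open>\<kappa>\<close> valued in \<open>A\<close>, the statement in the degree of \<open>\<kappa>\<close> replaces \<open>\<kappa>\<close> by an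
  \<open>A\<^sub>n\<close>-valued cochain with the same coboundary.

  Since \<open>A\<close> is countable, \<open>\<phi>\<close> has values in a finite subset of \<open>A\<close>, and hence in a single \<open>A\<^sub>n\<close>, outside a
  set of measure at most a given \<open>\<epsilon>\<close>. What remains is a rigidity statement, \<open>almost_stable_cocycle\<close>:
  there is \<open>\<epsilon> > 0\<close>, depending only on \<open>p\<close>, such that for every submodule \<open>B\<close> a cochain that is a
  cocycle modulo \<open>B\<close> and has values in \<open>B\<close> outside a set of measure \<open>\<epsilon>\<close> is a coboundary modulo \<open>B\<close>.

  For the rigidity statement take homogeneous cochains, that is equivariant functions
  \<open>f(x\<^sub>0, \<dots>, x\<^sub>p)\<close>. Consider the condition \<open>P\<^sub>k\<close> that for almost all \<open>x\<^sub>0, \<dots>, x\<^sub>k\<^sub>-\<^sub>1\<close> the remaining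
  vertices with \<open>f(x\<^sub>0, \<dots>, x\<^sub>p) \<notin> B\<close> have small measure. Invariance of the measure under translation
  gives \<open>P\<^sub>1\<close>. To pass from \<open>P\<^sub>k\<close> to \<open>P\<^sub>k\<^sub>+\<^sub>1\<close> subtract from \<open>f\<close> the coboundary of
  \<open>\<kappa>(x\<^sub>0, \<dots>, x\<^sub>p\<^sub>-\<^sub>1) = \<plusminus> f(x\<^sub>0, \<dots>, x\<^sub>p\<^sub>-\<^sub>1, v)\<close>, where the cone vertex \<open>v\<close> depends on
  \<open>x\<^sub>0, \<dots>, x\<^sub>k\<close> and is typical for them. By the cocycle identity for the vertices
  \<open>x\<^sub>0, \<dots>, x\<^sub>p, v\<close>, the terms that omit a vertex \<open>x\<^sub>j\<close> with \<open>j > k\<close> cancel, because omitting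
  \<open>x\<^sub>j\<close> does not change \<open>v\<close>. The terms with \<open>j \<le> k\<close> are values of \<open>f\<close> at simplices in which only
  \<open>k\<close> of the vertices \<open>x\<^sub>0, \<dots>, x\<^sub>k\<close> survive, and by \<open>P\<^sub>k\<close> these values are mostly in \<open>B\<close>
  (\<open>cone_defect\<close>, \<open>concentration_step\<close>). Each step costs only a factor that depends on \<open>k\<close>.
  Once \<open>P\<^sub>p\<close> holds, the cocycle identity with a typical last vertex writes \<open>f\<close> as a sum of values in \<open>B\<close> (\<open>concentrated_top\<close>).

  The cone vertex has to be a measurable equivariant function of \<open>x\<^sub>0, \<dots>, x\<^sub>k\<close>. Typical vertices have
  measure at least \<open>1/2\<close> by Markov's inequality, so a random sequence \<open>t\<close> in \<open>G\<close> almost surely contains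
  some \<open>t i\<close> with \<open>x\<^sub>0 t i\<close> typical; by Fubini one sequence serves almost all \<open>x\<close>, and \<open>v\<close> is
  \<open>x\<^sub>0 t i\<close> for the first such \<open>i\<close> (\<open>good_vertex_selection\<close>).

  Homogeneous cochains of all degrees live on the single probability space of infinite sequences in
  \<open>G\<close>, a \<open>p\<close>-cochain being a function of the coordinates \<open>0, \<dots>, p\<close>. Faces, translations, replacement of one
  vertex, and concatenation of sequences then all preserve the same measure.
\<close>

section \<open>The probability space of vertex sequences\<close>

lemma borel_measurable_group_uminus [measurable (raw)]:
  fixes f :: "'b \<Rightarrow> 'g::{topological_group_add, second_countable_topology}"
  assumes "f \<in> borel_measurable M"
  shows "(\<lambda>x. - f x) \<in> borel_measurable M"
  by (rule borel_measurable_continuous_on[OF _ assms]) (intro continuous_intros)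

definition face :: "nat \<Rightarrow> (nat \<Rightarrow> 'g) \<Rightarrow> nat \<Rightarrow> 'g" where
  "face j \<omega> i = (if i < j then \<omega> i else \<omega> (Suc i))"

lemma face_face: "i \<le> j \<Longrightarrow> face j (face i \<omega>) = face i (face (Suc j) \<omega>)"
  by (auto simp: face_def fun_eq_iff)

lemma comb_seq_comb_seq:
  "comb_seq (k + n) (comb_seq k \<omega> \<omega>') \<omega>'' = comb_seq k \<omega> (comb_seq n \<omega>' \<omega>'')"
  by (auto simp: comb_seq_def fun_eq_iff)

lemma comb_seq_Suc_comb_seq:
  "comb_seq (Suc k) (comb_seq k \<omega> \<omega>') \<omega>'' = comb_seq k \<omega> (comb_seq (Suc 0) \<omega>' \<omega>'')"
  using comb_seq_comb_seq[of k "Suc 0" \<omega> \<omega>' \<omega>''] by simp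

lemma face_comb_seq: "j \<le> k \<Longrightarrow> face j (comb_seq (Suc k) \<omega> \<omega>') = comb_seq k (face j \<omega>) \<omega>'"
  by (auto simp: comb_seq_def face_def fun_eq_iff)

text \<open>
  An update at a position behind the first \<open>k\<close> vertices only affects the random tail.
\<close>

lemma comb_seq_update: "k \<le> r \<Longrightarrow> (comb_seq k \<omega> \<omega>')(r := w) = comb_seq k \<omega> (\<omega>'(r - k := w))"
  by (auto simp: comb_seq_def fun_eq_iff)

text \<open>
  The Haar measure of a compact group after normalization. The product measure on infinite sequences
  of vertices is called \<open>S\<close>.
\<close>

locale haar_prob =
  fixes \<mu> :: "'g::{topological_group_add, second_countable_topology} measure"
  assumes prob: "prob_space \<mu>"
    and sets_mu [measurable_cong]: "sets \<mu> = sets borel"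
    and translate: "distr \<mu> \<mu> (\<lambda>x. g + x) = \<mu>"

sublocale haar_prob \<subseteq> sequence_space \<mu>
proof -
  interpret prob_space \<mu> by (rule prob)
  show "sequence_space \<mu>" by unfold_locales
qed

context haar_prob
begin

lemma space_mu [simp]: "space \<mu> = UNIV"
  using sets_eq_imp_space_eq[OF sets_mu] by simp

lemma space_S [simp]: "space S = UNIV"
  by (simp add: space_PiM)

lemma emeasure_S_UNIV [simp]: "emeasure S UNIV = 1"
  using P.emeasure_space_1 by simp

sublocale SS: pair_prob_space S S
  by unfold_locales

sublocale MS: pair_prob_space \<mu> S
  by unfold_locales

lemma measurable_face [measurable]: "face j \<in> measurable S S"
proof (rule measurable_PiM_single')
  show "(\<lambda>\<omega>. face j \<omega> i) \<in> measurable S \<mu>" for i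
    by (cases "i < j") (simp_all add: face_def)
qed (auto simp: face_def)

lemma distr_face: "distr S S (face j) = S"
proof -
  let ?f = "\<lambda>i. if i < j then i else Suc i"
  have "distr S S (\<lambda>\<omega>. \<lambda>n\<in>UNIV. \<omega> (?f n)) = S"
    by (rule distr_PiM_reindex) (auto simp: prob inj_on_def split: if_splits)
  moreover have "(\<lambda>\<omega> :: nat \<Rightarrow> 'g. \<lambda>n\<in>UNIV. \<omega> (?f n)) = face j"
    by (auto simp: face_def fun_eq_iff)
  ultimately show ?thesis by simp
qed

lemma distr_update: "distr (\<mu> \<Otimes>\<^sub>M S) S (\<lambda>(w, \<omega>). (\<omega>)(r := w)) = S"
  using distr_pair_PiM_eq_PiM[of "UNIV :: nat set" "\<lambda>_. \<mu>" r] by (simp add: prob)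

definition shift :: "'g \<Rightarrow> (nat \<Rightarrow> 'g) \<Rightarrow> nat \<Rightarrow> 'g" where
  "shift c \<omega> i = c + \<omega> i"

lemma measurable_shift [measurable]: "shift c \<in> measurable S S"
  by (rule measurable_PiM_single') (auto simp: shift_def)

lemma distr_shift: "distr S S (shift c) = S"
proof (rule PiM_eq)
  fix J E assume J: "finite J" "J \<subseteq> (UNIV::nat set)" "\<And>j. j \<in> J \<Longrightarrow> E j \<in> sets \<mu>"
  have E: "(\<lambda>x. c + x) -` E j \<in> sets \<mu>" if "j \<in> J" for j
    using measurable_sets[of "\<lambda>x. c + x" \<mu> \<mu> "E j"] J(3)[OF that] by simp
  have *: "emeasure \<mu> ((\<lambda>x. c + x) -` E j) = emeasure \<mu> (E j)" if "j \<in> J" for j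
    using emeasure_distr[of "\<lambda>x. c + x" \<mu> \<mu> "E j"] J(3)[OF that] by (simp add: translate)
  have "emeasure (distr S S (shift c)) (emb UNIV J (Pi\<^sub>E J E))
      = emeasure S (shift c -` emb UNIV J (Pi\<^sub>E J E))"
    using J by (subst emeasure_distr) (auto intro!: sets_PiM_I)
  also have "shift c -` emb UNIV J (Pi\<^sub>E J E) = emb UNIV J (\<Pi>\<^sub>E j\<in>J. (\<lambda>x. c + x) -` E j)"
    by (auto simp: prod_emb_def shift_def PiE_iff)
  also have "emeasure S \<dots> = (\<Prod>j\<in>J. emeasure \<mu> ((\<lambda>x. c + x) -` E j))"
    using J E by (intro emeasure_PiM_emb) auto
  finally show "emeasure (distr S S (shift c)) (emb UNIV J (Pi\<^sub>E J E)) = (\<Prod>j\<in>J. emeasure \<mu> (E j))"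
    using * by simp
qed simp

text \<open>
  The conditional probability of \<open>N\<close> given the first \<open>k\<close> vertices. Defining it by an explicit random
  tail gives a version for which all identities below hold at every point.
\<close>

definition tail_prob :: "nat \<Rightarrow> (nat \<Rightarrow> 'g) set \<Rightarrow> (nat \<Rightarrow> 'g) \<Rightarrow> ennreal" where
  "tail_prob k N \<omega> = emeasure S {\<omega>'. comb_seq k \<omega> \<omega>' \<in> N}"

lemma measurable_tail_prob [measurable]:
  assumes [measurable]: "N \<in> sets S"
  shows "tail_prob k N \<in> borel_measurable S"
  unfolding tail_prob_def
proof (rule P.measurable_emeasure)
  have "Measurable.pred (S \<Otimes>\<^sub>M S) (\<lambda>x. comb_seq k (fst x) (snd x) \<in> N)" by measurable
  then show "{x \<in> space (S \<Otimes>\<^sub>M S). snd x \<in> {\<omega>'. comb_seq k (fst x) \<omega>' \<in> N}} \<in> sets (S \<Otimes>\<^sub>M S)"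
    by (simp add: pred_def)
qed auto

lemma sets_tail [measurable]:
  assumes [measurable]: "N \<in> sets S"
  shows "{\<omega>'. comb_seq k \<omega> \<omega>' \<in> N} \<in> sets S"
proof -
  have "Measurable.pred S (\<lambda>\<omega>'. comb_seq k \<omega> \<omega>' \<in> N)" by measurable
  then show ?thesis by (simp add: pred_def)
qed

lemma tail_prob_cong: "(\<And>i. i < k \<Longrightarrow> \<omega> i = \<omega>' i) \<Longrightarrow> tail_prob k N \<omega> = tail_prob k N \<omega>'"
proof -
  assume "\<And>i. i < k \<Longrightarrow> \<omega> i = \<omega>' i"
  then have "comb_seq k \<omega> = comb_seq k \<omega>'" by (auto simp: comb_seq_def fun_eq_iff)
  then show ?thesis by (simp add: tail_prob_def)
qed

lemma nn_integral_emeasure_comb_seq: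
  assumes [measurable]: "N \<in> sets S"
  shows "(\<integral>\<^sup>+\<omega>. emeasure S {\<omega>'. comb_seq k \<omega> \<omega>' \<in> N} \<partial>S) = emeasure S N"
proof -
  have "emeasure S N = emeasure (distr (S \<Otimes>\<^sub>M S) S (\<lambda>(\<omega>, \<omega>'). comb_seq k \<omega> \<omega>')) N"
    by (simp add: PiM_comb_seq)
  also have "\<dots> = emeasure (S \<Otimes>\<^sub>M S) ((\<lambda>(\<omega>, \<omega>'). comb_seq k \<omega> \<omega>') -` N \<inter> space (S \<Otimes>\<^sub>M S))"
    by (subst emeasure_distr) auto
  also have "\<dots> = (\<integral>\<^sup>+\<omega>. emeasure S (Pair \<omega> -` ((\<lambda>(\<omega>, \<omega>'). comb_seq k \<omega> \<omega>') -` N \<inter> space (S \<Otimes>\<^sub>M S))) \<partial>S)"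
    by (rule P.emeasure_pair_measure_alt) measurable
  finally show ?thesis
    by (simp add: space_pair_measure vimage_def)
qed

lemma nn_integral_tail_prob: "N \<in> sets S \<Longrightarrow> (\<integral>\<^sup>+\<omega>. tail_prob k N \<omega> \<partial>S) = emeasure S N"
  unfolding tail_prob_def by (rule nn_integral_emeasure_comb_seq)

text \<open>
  The tower property: averaging over vertex \<open>k\<close> forgets it. The tail \<open>\<omega>'\<close> supplies that vertex as its
  first entry.
\<close>

lemma nn_integral_tail_prob_Suc:
  assumes [measurable]: "N \<in> sets S"
  shows "(\<integral>\<^sup>+\<omega>'. tail_prob (Suc k) N (comb_seq k \<omega> \<omega>') \<partial>S) = tail_prob k N \<omega>"
  using nn_integral_emeasure_comb_seq[OF sets_tail[OF assms, of k \<omega>], of "Suc 0"]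
  by (simp add: tail_prob_def comb_seq_Suc_comb_seq del: comb_seq_Suc_0)

lemma tail_prob_null:
  assumes "AE \<omega> in S. \<omega> \<notin> N" and [measurable]: "N \<in> sets S"
  shows "AE \<omega> in S. tail_prob k N \<omega> = 0"
proof -
  have "emeasure S N = 0" using assms by (simp add: AE_iff_null_sets[symmetric] null_setsD1)
  then have "(\<integral>\<^sup>+\<omega>. tail_prob k N \<omega> \<partial>S) = 0" by (simp add: nn_integral_tail_prob)
  then show ?thesis by (simp add: nn_integral_0_iff_AE)
qed

lemma AE_face:
  assumes "AE \<omega> in S. P \<omega>"
  shows "AE \<omega> in S. P (face j \<omega>)"
  by (rule AE_distrD[of "face j" S S, unfolded distr_face, OF measurable_face assms])

lemma tail_prob_face: "j \<le> k \<Longrightarrow> tail_prob (Suc k) (face j -` N) \<omega> = tail_prob k N (face j \<omega>)"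
  by (simp add: tail_prob_def face_comb_seq)

lemma comb_seq_shift: "comb_seq k (shift c \<omega>) (shift c \<omega>') = shift c (comb_seq k \<omega> \<omega>')"
  by (auto simp: comb_seq_def shift_def fun_eq_iff)

text \<open>
  Events defined by equivariant functions with respect to a submodule are of this kind.
\<close>

definition invariant :: "(nat \<Rightarrow> 'g) set \<Rightarrow> bool" where
  "invariant N \<longleftrightarrow> (\<forall>c \<omega>. shift c \<omega> \<in> N \<longleftrightarrow> \<omega> \<in> N)"

lemma emeasure_shift:
  assumes "N \<in> sets S"
  shows "emeasure S {\<omega>. shift c \<omega> \<in> N} = emeasure S N"
  using emeasure_distr[of "shift c" S S N] assms by (simp add: distr_shift vimage_def)

text \<open>
  The conditional probability of \<open>N\<close> given the first \<open>k\<close> vertices and the value \<open>w\<close> of vertex \<open>r\<close>.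
\<close>

definition update_prob :: "nat \<Rightarrow> nat \<Rightarrow> (nat \<Rightarrow> 'g) set \<Rightarrow> (nat \<Rightarrow> 'g) \<Rightarrow> 'g \<Rightarrow> ennreal" where
  "update_prob k r N \<omega> w = tail_prob k {\<eta>. \<eta>(r := w) \<in> N} \<omega>"

lemma measurable_update [measurable (raw)]:
  assumes [measurable]: "f \<in> measurable M S" "g \<in> measurable M \<mu>"
  shows "(\<lambda>x. (f x)(r := g x)) \<in> measurable M S"
  by (rule measurable_fun_upd[where J=UNIV]) auto

lemma measurable_update_prob [measurable]:
  assumes [measurable]: "N \<in> sets S"
  shows "(\<lambda>(\<omega>, w). update_prob k r N \<omega> w) \<in> borel_measurable (S \<Otimes>\<^sub>M \<mu>)"
  unfolding update_prob_def tail_prob_def split_beta'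
proof (rule P.measurable_emeasure)
  have "Measurable.pred ((S \<Otimes>\<^sub>M \<mu>) \<Otimes>\<^sub>M S)
          (\<lambda>x. (comb_seq k (fst (fst x)) (snd x))(r := snd (fst x)) \<in> N)" by measurable
  then show "{x \<in> space ((S \<Otimes>\<^sub>M \<mu>) \<Otimes>\<^sub>M S). snd x \<in> {\<omega>'. comb_seq k (fst (fst x)) \<omega>' \<in> {\<eta>. \<eta>(r := snd (fst x)) \<in> N}}}
      \<in> sets ((S \<Otimes>\<^sub>M \<mu>) \<Otimes>\<^sub>M S)"
    by (simp add: pred_def)
qed auto

lemma nn_integral_update_prob:
  assumes [measurable]: "N \<in> sets S" and "k \<le> r"
  shows "(\<integral>\<^sup>+w. update_prob k r N \<omega> w \<partial>\<mu>) = tail_prob k N \<omega>"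
proof -
  let ?N = "{\<omega>'. comb_seq k \<omega> \<omega>' \<in> N}"
  have "tail_prob k N \<omega> = emeasure (distr (\<mu> \<Otimes>\<^sub>M S) S (\<lambda>(w, \<omega>). (\<omega>)(r - k := w))) ?N"
    by (simp add: tail_prob_def distr_update)
  also have "\<dots> = emeasure (\<mu> \<Otimes>\<^sub>M S) ((\<lambda>(w, \<omega>). (\<omega>)(r - k := w)) -` ?N \<inter> space (\<mu> \<Otimes>\<^sub>M S))"
    by (subst emeasure_distr) auto
  also have "\<dots> = (\<integral>\<^sup>+w. emeasure S (Pair w -` ((\<lambda>(w, \<omega>). (\<omega>)(r - k := w)) -` ?N \<inter> space (\<mu> \<Otimes>\<^sub>M S))) \<partial>\<mu>)"
    by (rule P.emeasure_pair_measure_alt) measurable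
  finally show ?thesis
    using \<open>k \<le> r\<close> by (simp add: space_pair_measure vimage_def update_prob_def tail_prob_def comb_seq_update)
qed

lemma update_prob_shift:
  assumes [measurable]: "N \<in> sets S" and "invariant N"
  shows "update_prob k r N (shift c \<omega>) (c + w) = update_prob k r N \<omega> w"
proof -
  have upd: "(shift c \<eta>)(r := c + w) = shift c (\<eta>(r := w))" for \<eta>
    by (auto simp: shift_def fun_eq_iff)
  have meas: "{\<omega>'. (comb_seq k (shift c \<omega>) \<omega>')(r := c + w) \<in> N} \<in> sets S"
  proof -
    have "Measurable.pred S (\<lambda>\<omega>'. (comb_seq k (shift c \<omega>) \<omega>')(r := c + w) \<in> N)" by measurable
    then show ?thesis by (simp add: pred_def)
  qed
  have "update_prob k r N (shift c \<omega>) (c + w)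
      = emeasure S {\<omega>'. (comb_seq k (shift c \<omega>) (shift c \<omega>'))(r := c + w) \<in> N}"
    using emeasure_shift[OF meas, of c] by (simp add: update_prob_def tail_prob_def)
  also have "\<dots> = update_prob k r N \<omega> w"
    using \<open>invariant N\<close> by (simp add: comb_seq_shift upd invariant_def update_prob_def tail_prob_def)
  finally show ?thesis .
qed

lemma tail_prob_shift:
  assumes [measurable]: "N \<in> sets S" and "invariant N"
  shows "tail_prob k N (shift c \<omega>) = tail_prob k N \<omega>"
proof -
  have "tail_prob k N (shift c \<omega>) = emeasure S {\<omega>'. comb_seq k (shift c \<omega>) (shift c \<omega>') \<in> N}"
    using emeasure_shift[of "{\<omega>'. comb_seq k (shift c \<omega>) \<omega>' \<in> N}" c]
    by (simp add: tail_prob_def)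
  also have "\<dots> = tail_prob k N \<omega>"
    using \<open>invariant N\<close> by (simp add: comb_seq_shift invariant_def tail_prob_def)
  finally show ?thesis .
qed

text \<open>
  Conditioning on the first vertex alone has no effect: translations act transitively on it, so the
  conditional probability is constant. This is what turns smallness on average into smallness for
  every first vertex.
\<close>

lemma tail_prob_one:
  assumes [measurable]: "N \<in> sets S" and "invariant N"
  shows "tail_prob 1 N \<omega> = emeasure S N"
proof -
  have const: "tail_prob 1 N \<eta> = tail_prob 1 N \<omega>" for \<eta>
  proof -
    have "tail_prob 1 N \<eta> = tail_prob 1 N (shift (\<omega> 0 + - \<eta> 0) \<eta>)"
      using assms by (simp add: tail_prob_shift)
    also have "\<dots> = tail_prob 1 N \<omega>"
      by (rule tail_prob_cong) (simp add: shift_def add.assoc)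
    finally show ?thesis .
  qed
  have "emeasure S N = (\<integral>\<^sup>+\<eta>. tail_prob 1 N \<eta> \<partial>S)" by (simp add: nn_integral_tail_prob)
  also have "\<dots> = tail_prob 1 N \<omega>" by (subst const) (simp add: P.emeasure_space_1)
  finally show ?thesis by simp
qed

text \<open>
  The value \<open>w\<close> for vertex \<open>r\<close> is good for the first \<open>k\<close> vertices when prescribing it does not raise
  the conditional probability of \<open>N\<close> by more than the factor 4. As the bound is relative, a conditional
  probability zero stays zero.
\<close>

definition good_vertex ::
  "nat \<Rightarrow> nat \<times> (nat \<Rightarrow> 'g) set \<Rightarrow> (nat \<Rightarrow> 'g) \<Rightarrow> 'g \<Rightarrow> bool" where
  "good_vertex k = (\<lambda>(r, N) \<omega> w. update_prob k r N \<omega> w \<le> 4 * tail_prob k N \<omega>)"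

text \<open>
  Markov's inequality, as \<open>update_prob\<close> has mean \<open>tail_prob\<close>. If the mean is zero, then almost every value
  is good, so the relative bound holds in this case as well.
\<close>

lemma emeasure_bad_vertex:
  assumes [measurable]: "N \<in> sets S" and "k \<le> r"
  shows "4 * emeasure \<mu> {w. \<not> good_vertex k (r, N) \<omega> w} \<le> 1"
proof -
  let ?e = "tail_prob k N \<omega>"
  have [measurable]: "update_prob k r N \<omega> \<in> borel_measurable \<mu>"
    using measurable_compose_Pair1[OF _ measurable_update_prob[OF assms(1)], of \<omega> k r] by simp
  have int: "(\<integral>\<^sup>+w. update_prob k r N \<omega> w \<partial>\<mu>) = ?e"
    using assms by (rule nn_integral_update_prob)
  have fin: "?e < \<infinity>"
    by (simp add: tail_prob_def less_top[symmetric])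
  have bad: "{w. \<not> good_vertex k (r, N) \<omega> w} = {w. 4 * ?e < update_prob k r N \<omega> w}"
    by (auto simp: good_vertex_def not_le)
  show ?thesis
  proof (cases "?e = 0")
    case True
    then have "AE w in \<mu>. update_prob k r N \<omega> w = 0"
      using int by (simp add: nn_integral_0_iff_AE)
    then have "AE w in \<mu>. \<not> 4 * ?e < update_prob k r N \<omega> w" by eventually_elim simp
    then have "emeasure \<mu> {w. 4 * ?e < update_prob k r N \<omega> w} = 0"
      by (subst (asm) AE_iff_measurable[OF _ refl]) simp_all
    then show ?thesis by (simp add: bad)
  next
    case False
    have "4 * ?e * emeasure \<mu> {w. 4 * ?e < update_prob k r N \<omega> w}
        = (\<integral>\<^sup>+w. 4 * ?e * indicator {w. 4 * ?e < update_prob k r N \<omega> w} w \<partial>\<mu>)"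
      by (subst nn_integral_cmult_indicator) simp_all
    also have "\<dots> \<le> (\<integral>\<^sup>+w. update_prob k r N \<omega> w \<partial>\<mu>)"
      by (rule nn_integral_mono) (auto simp: indicator_def)
    also have "\<dots> = ?e" by (rule int)
    finally have "?e * (4 * emeasure \<mu> {w. 4 * ?e < update_prob k r N \<omega> w}) \<le> ?e * 1"
      by (simp add: ac_simps)
    then show ?thesis
      unfolding bad using False fin by (subst (asm) ennreal_mult_le_mult_iff) auto
  qed
qed

text \<open>
  Splitting off the first entry shows that the measure \<open>a\<close> of these sequences satisfies
  \<open>a = \<mu>(X) a\<close> with \<open>\<mu>(X) \<le> 1/2\<close>.
\<close>

lemma emeasure_sequences_in:
  assumes [measurable]: "X \<in> sets \<mu>" and small: "2 * emeasure \<mu> X \<le> 1"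
  shows "emeasure S {t. \<forall>i. t i \<in> X} = 0"
proof -
  let ?X = "{t. \<forall>i. t i \<in> X}"
  have meas [measurable]: "?X \<in> sets S"
  proof -
    have "Measurable.pred S (\<lambda>t. \<forall>i. t i \<in> X)" by measurable
    then show ?thesis by (simp add: pred_def)
  qed
  have "emeasure S ?X = emeasure (distr (\<mu> \<Otimes>\<^sub>M S) S (\<lambda>(s, t). case_nat s t)) ?X"
    by (simp add: PiM_iter)
  also have "\<dots> = emeasure (\<mu> \<Otimes>\<^sub>M S) ((\<lambda>(s, t). case_nat s t) -` ?X \<inter> space (\<mu> \<Otimes>\<^sub>M S))"
    by (subst emeasure_distr) auto
  also have "(\<lambda>(s, t). case_nat s t) -` ?X \<inter> space (\<mu> \<Otimes>\<^sub>M S) = X \<times> ?X"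
  proof -
    have "(\<forall>i. case_nat s t i \<in> X) \<longleftrightarrow> s \<in> X \<and> (\<forall>i. t i \<in> X)" for s t
      by (auto split: nat.split elim: allE[of _ "0::nat"] allE[of _ "Suc _"])
    then show ?thesis by (auto simp: space_pair_measure)
  qed
  also have "emeasure (\<mu> \<Otimes>\<^sub>M S) (X \<times> ?X) = emeasure \<mu> X * emeasure S ?X"
    by (rule P.emeasure_pair_measure_Times) auto
  finally have eq: "emeasure S ?X = emeasure \<mu> X * emeasure S ?X" .
  have "2 * emeasure S ?X = (2 * emeasure \<mu> X) * emeasure S ?X"
    by (subst eq) (simp add: ac_simps)
  also have "\<dots> \<le> 1 * emeasure S ?X"
    by (rule mult_right_mono[OF small]) simp
  finally have "ennreal (2 * measure S ?X) \<le> ennreal (measure S ?X)"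
    by (simp add: P.emeasure_eq_measure ennreal_mult)
  then have "measure S ?X = 0"
    by (simp add: measure_le_0_iff)
  then show ?thesis by (simp add: P.emeasure_eq_measure)
qed

text \<open>
  This plays the part of measurable selection: for each \<open>\<omega>\<close> almost every random sequence meets the
  good set, and Fubini exchanges the order of the two quantifiers.
\<close>

lemma generic_sequence:
  assumes Q [measurable]: "Measurable.pred (S \<Otimes>\<^sub>M \<mu>) (\<lambda>x. Q (fst x) (snd x))"
    and half: "\<And>\<omega>. 2 * emeasure \<mu> {w. \<not> Q \<omega> w} \<le> 1"
  shows "\<exists>t. AE \<omega> in S. \<exists>i::nat. Q \<omega> (t i)"
proof -
  have "AE t in S. \<exists>i. Q \<omega> (t i)" for \<omega>
  proof -
    have [measurable]: "Measurable.pred \<mu> (Q \<omega>)"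
      using measurable_compose[OF measurable_Pair1' Q, of \<omega>] by simp
    have "Measurable.pred \<mu> (\<lambda>w. \<not> Q \<omega> w)" by measurable
    then have X: "{w. \<not> Q \<omega> w} \<in> sets \<mu>" by (simp add: pred_def)
    have "emeasure S {t. \<forall>i. t i \<in> {w. \<not> Q \<omega> w}} = 0"
      by (rule emeasure_sequences_in[OF X half])
    moreover have "Measurable.pred S (\<lambda>t. \<forall>i. \<not> Q \<omega> (t i))" by measurable
    ultimately show ?thesis
      by (subst AE_iff_measurable[OF _ refl]) (auto simp: pred_def)
  qed
  then have "AE \<omega> in S. AE t in S. \<exists>i. Q \<omega> (t i)" by simp
  moreover have "Measurable.pred (S \<Otimes>\<^sub>M S) (\<lambda>x. \<exists>i. Q (fst x) (snd x i))"
  proof (rule pred_intros_countable)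
    have "(\<lambda>x. (fst x, snd x i)) \<in> measurable (S \<Otimes>\<^sub>M S) (S \<Otimes>\<^sub>M \<mu>)" for i :: nat by simp
    from measurable_compose[OF this Q]
    show "Measurable.pred (S \<Otimes>\<^sub>M S) (\<lambda>x. Q (fst x) (snd x i))" for i by simp
  qed
  ultimately have "AE t in S. AE \<omega> in S. \<exists>i. Q \<omega> (t i)"
    by (subst SS.AE_commute[symmetric]) (simp_all add: pred_def)
  then show ?thesis
    by (rule eventually_happens'[OF P.ae_filter_bot])
qed

end


section \<open>Homogeneous cochains and cones\<close>

lemma alternating_add: "alternating i (a + b) = alternating i a + alternating i b"
  by (simp add: alternating_def)

lemma alternating_minus: "alternating i (- a) = - alternating i a"
  by (simp add: alternating_def)

lemma alternating_diff: "alternating i (a - b) = alternating i a - alternating i b"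
  by (simp add: alternating_def)

lemma alternating_zero [simp]: "alternating i 0 = 0"
  by (simp add: alternating_def)

lemma alternating_Suc: "alternating (Suc i) a = - alternating i a"
  by (simp add: alternating_def)

lemma alternating_alternating: "alternating i (alternating j a) = alternating (i + j) a"
  by (simp add: alternating_def)

lemma alternating_self [simp]: "alternating i (alternating i a) = a"
  by (simp add: alternating_def)

lemma alternating_sum: "alternating i (sum h J) = (\<Sum>j\<in>J. alternating i (h j))"
  by (simp add: alternating_def sum_negf)

definition homogeneous_coboundary ::
  "nat \<Rightarrow> ((nat \<Rightarrow> 'g) \<Rightarrow> 'a::ab_group_add) \<Rightarrow> (nat \<Rightarrow> 'g) \<Rightarrow> 'a" where
  "homogeneous_coboundary p f \<omega> = (\<Sum>j\<le>Suc p. alternating j (f (face j \<omega>)))"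

text \<open>
  The terms of the double sum cancel in pairs: by \<open>face_face\<close>, omitting first \<open>i\<close> and then \<open>j \<ge> i\<close> is
  the same as omitting first \<open>j + 1\<close> and then \<open>i\<close>, with the opposite sign.
\<close>

lemma homogeneous_coboundary_square:
  "homogeneous_coboundary (Suc p) (homogeneous_coboundary p f) \<omega> = 0"
proof -
  define a where "a = (\<lambda>(i, j). alternating (i + j) (f (face j (face i \<omega>))))"
  let ?U = "{(i, j). i \<le> j \<and> j \<le> Suc p}" and ?V = "{(i, j). j < i \<and> i \<le> Suc (Suc p)}"
  have fin: "finite ?U" "finite ?V"
    by (rule finite_subset[of _ "{..Suc (Suc p)} \<times> {..Suc (Suc p)}"]; force)+
  have split: "{..Suc (Suc p)} \<times> {..Suc p} = ?U \<union> ?V" by auto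
  have "homogeneous_coboundary (Suc p) (homogeneous_coboundary p f) \<omega>
      = (\<Sum>x\<in>{..Suc (Suc p)} \<times> {..Suc p}. a x)"
    unfolding homogeneous_coboundary_def alternating_sum
    by (simp add: sum.cartesian_product a_def alternating_alternating del: sum.atMost_Suc)
  also have "\<dots> = sum a ?U + sum a ?V"
    unfolding split using fin by (intro sum.union_disjoint) auto
  also have "sum a ?V = (\<Sum>x\<in>?U. - a x)"
  proof (rule sum.reindex_bij_witness[of _ "\<lambda>(i, j). (Suc j, i)" "\<lambda>(i, j). (j, i - 1)"])
    show "- a (case x of (i, j) \<Rightarrow> (j, i - 1)) = a x" if "x \<in> ?V" for x
    proof -
      have "x = (Suc (fst x - 1), snd x)" "snd x \<le> fst x - 1"
        using that by (auto simp: prod_eq_iff)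
      then obtain i j where x: "x = (Suc i, j)" and "j \<le> i" by blast
      then show ?thesis
        using face_face[of j i \<omega>] by (simp add: a_def alternating_Suc add.commute)
    qed
  qed auto
  finally show ?thesis by (simp add: sum_negf)
qed

locale discrete_action = haar_prob \<mu>
  for \<mu> :: "'g::{topological_group_add, second_countable_topology} measure" +
  fixes T :: "'g \<Rightarrow> 'a::ab_group_add \<Rightarrow> 'a" and A :: "'a set"
  assumes countable_A: "countable A"
    and zero_closed: "0 \<in> A"
    and add_closed: "a \<in> A \<Longrightarrow> b \<in> A \<Longrightarrow> a + b \<in> A"
    and minus_closed: "a \<in> A \<Longrightarrow> - a \<in> A"
    and T_closed: "a \<in> A \<Longrightarrow> T g a \<in> A"
    and T_add: "a \<in> A \<Longrightarrow> b \<in> A \<Longrightarrow> T g (a + b) = T g a + T g b"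
    and T_zero: "a \<in> A \<Longrightarrow> T 0 a = a"
    and T_T: "a \<in> A \<Longrightarrow> T (g + h) a = T g (T h a)"
    and T_measurable: "a \<in> A \<Longrightarrow> (\<lambda>g. T g a) \<in> measurable \<mu> (count_space A)"
begin

text \<open>
  The submodules of \<open>A\<close>, without a topology. Working modulo a stable \<open>B\<close> by membership avoids
  quotient modules.
\<close>

definition stable :: "'a set \<Rightarrow> bool" where
  "stable B \<longleftrightarrow> B \<subseteq> A \<and> 0 \<in> B \<and> (\<forall>a\<in>B. \<forall>b\<in>B. a + b \<in> B) \<and> (\<forall>a\<in>B. - a \<in> B) \<and> (\<forall>g. \<forall>a\<in>B. T g a \<in> B)"

lemma stableD:
  assumes "stable B"
  shows "B \<subseteq> A" "0 \<in> B" "a \<in> B \<Longrightarrow> b \<in> B \<Longrightarrow> a + b \<in> B" "a \<in> B \<Longrightarrow> - a \<in> B" "a \<in> B \<Longrightarrow> T g a \<in> B"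
    "a \<in> B \<Longrightarrow> b \<in> B \<Longrightarrow> a - b \<in> B"
  using assms unfolding stable_def diff_conv_add_uminus by blast+

lemma stable_A: "stable A"
  unfolding stable_def by (auto intro: zero_closed add_closed minus_closed T_closed)

lemma stable_alternating: "stable B \<Longrightarrow> alternating i a \<in> B \<longleftrightarrow> a \<in> B"
  using stableD(4)[of B a] stableD(4)[of B "- a"] by (auto simp: alternating_def)

lemma stable_sum: "stable B \<Longrightarrow> (\<And>j. j \<in> J \<Longrightarrow> h j \<in> B) \<Longrightarrow> sum h J \<in> B"
  by (induction J rule: infinite_finite_induct) (auto intro: stableD)

lemma T_minus: "a \<in> A \<Longrightarrow> T g (- a) = - T g a"
proof -
  assume a: "a \<in> A"
  have "T g 0 + T g 0 = T g 0" using T_add[OF zero_closed zero_closed, of g] by simp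
  then have "T g 0 = 0" by simp
  then have "T g a + T g (- a) = 0" using T_add[OF a minus_closed[OF a], of g] by simp
  then show ?thesis by (simp add: add_eq_0_iff)
qed

lemma T_0: "T g 0 = 0"
  using T_add[OF zero_closed zero_closed, of g] by simp

lemma T_alternating: "a \<in> A \<Longrightarrow> T g (alternating i a) = alternating i (T g a)"
  by (simp add: alternating_def T_minus)

lemma T_sum: "(\<And>j. j \<in> J \<Longrightarrow> h j \<in> A) \<Longrightarrow> T g (sum h J) = (\<Sum>j\<in>J. T g (h j))"
proof (induction J rule: infinite_finite_induct)
  case (insert x F)
  then show ?case using stable_sum[OF stable_A, of F h] by (simp add: T_add)
qed (auto simp: T_0)

lemma stable_T_iff: "stable B \<Longrightarrow> a \<in> A \<Longrightarrow> T g a \<in> B \<longleftrightarrow> a \<in> B"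
  using stableD(5)[of B "T g a" "- g"] stableD(5)[of B a g] T_T[of a "- g" g] T_zero[of a] by auto

lemma measurable_add_A:
  assumes f: "f \<in> measurable M (count_space A)" and g: "g \<in> measurable M (count_space A)"
  shows "(\<lambda>x. f x + g x) \<in> measurable M (count_space A)"
proof (rule measurable_compose_countable'[OF _ f countable_A])
  show "(\<lambda>x. a + g x) \<in> measurable M (count_space A)" if "a \<in> A" for a
    by (rule measurable_compose[OF g]) (use that add_closed in auto)
qed

lemma measurable_minus_A:
  "f \<in> measurable M (count_space A) \<Longrightarrow> (\<lambda>x. - f x) \<in> measurable M (count_space A)"
  by (rule measurable_compose) (auto intro: minus_closed)

lemma measurable_alternating_A:
  "f \<in> measurable M (count_space A) \<Longrightarrow> (\<lambda>x. alternating i (f x)) \<in> measurable M (count_space A)"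
  by (rule measurable_compose) (auto simp: stable_alternating[OF stable_A])

lemma measurable_sum_A:
  "(\<And>j. j \<in> J \<Longrightarrow> f j \<in> measurable M (count_space A)) \<Longrightarrow> (\<lambda>x. \<Sum>j\<in>J. f j x) \<in> measurable M (count_space A)"
  by (induction J rule: infinite_finite_induct) (simp_all add: measurable_add_A zero_closed)

lemma measurable_T_A:
  assumes f: "f \<in> measurable M (count_space A)" and g: "g \<in> measurable M \<mu>"
  shows "(\<lambda>x. T (g x) (f x)) \<in> measurable M (count_space A)"
proof (rule measurable_compose_countable'[OF _ f countable_A])
  show "(\<lambda>x. T (g x) a) \<in> measurable M (count_space A)" if "a \<in> A" for a
    by (rule measurable_compose[OF g]) (rule T_measurable[OF that])
qed

text \<open>
  The last condition makes \<open>f\<close> a function of \<open>(x\<^sub>0, \<dots>, x\<^sub>p)\<close>. Equivariance is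
  required at every point, not only almost everywhere; \<open>homogenize_cochain\<close> below shows that
  this loses nothing.
\<close>

definition homogeneous_cochains :: "nat \<Rightarrow> ((nat \<Rightarrow> 'g) \<Rightarrow> 'a) set" where
  "homogeneous_cochains p =
     {f \<in> measurable S (count_space A).
       (\<forall>c \<omega>. f (shift c \<omega>) = T c (f \<omega>)) \<and> (\<forall>\<omega> \<omega>'. (\<forall>i\<le>p. \<omega> i = \<omega>' i) \<longrightarrow> f \<omega> = f \<omega>')}"

lemma cochain_measurable: "f \<in> homogeneous_cochains p \<Longrightarrow> f \<in> measurable S (count_space A)"
  by (simp add: homogeneous_cochains_def)

lemma cochain_in: "f \<in> homogeneous_cochains p \<Longrightarrow> f \<omega> \<in> A"
  using measurable_space[of f S "count_space A" \<omega>] by (simp add: homogeneous_cochains_def)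

lemma cochain_shift: "f \<in> homogeneous_cochains p \<Longrightarrow> f (shift c \<omega>) = T c (f \<omega>)"
  by (simp add: homogeneous_cochains_def)

lemma cochain_cong: "f \<in> homogeneous_cochains p \<Longrightarrow> (\<And>i. i \<le> p \<Longrightarrow> \<omega> i = \<omega>' i) \<Longrightarrow> f \<omega> = f \<omega>'"
  unfolding homogeneous_cochains_def by blast

lemma cochainI:
  assumes "f \<in> measurable S (count_space A)" "\<And>c \<omega>. f (shift c \<omega>) = T c (f \<omega>)"
    "\<And>\<omega> \<omega>'. (\<And>i. i \<le> p \<Longrightarrow> \<omega> i = \<omega>' i) \<Longrightarrow> f \<omega> = f \<omega>'"
  shows "f \<in> homogeneous_cochains p"
  using assms unfolding homogeneous_cochains_def by blast

lemma cochain_add: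
  assumes "f \<in> homogeneous_cochains p" "g \<in> homogeneous_cochains p"
  shows "(\<lambda>\<omega>. f \<omega> + g \<omega>) \<in> homogeneous_cochains p"
proof (rule cochainI)
  show "f \<omega> + g \<omega> = f \<omega>' + g \<omega>'" if "\<And>i. i \<le> p \<Longrightarrow> \<omega> i = \<omega>' i" for \<omega> \<omega>'
    using assms[THEN cochain_cong, OF that] by simp
  show "(\<lambda>\<omega>. f \<omega> + g \<omega>) \<in> measurable S (count_space A)"
    by (rule measurable_add_A[OF assms[THEN cochain_measurable]])
qed (simp add: T_add
    cochain_shift[OF assms(1)] cochain_shift[OF assms(2)] cochain_in[OF assms(1)] cochain_in[OF assms(2)])

lemma cochain_minus:
  assumes "f \<in> homogeneous_cochains p"
  shows "(\<lambda>\<omega>. - f \<omega>) \<in> homogeneous_cochains p"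
proof (rule cochainI)
  show "- f \<omega> = - f \<omega>'" if "\<And>i. i \<le> p \<Longrightarrow> \<omega> i = \<omega>' i" for \<omega> \<omega>'
    using cochain_cong[OF assms that] by simp
  show "(\<lambda>\<omega>. - f \<omega>) \<in> measurable S (count_space A)"
    by (rule measurable_minus_A[OF cochain_measurable[OF assms]])
qed (simp add: cochain_shift[OF assms] T_minus cochain_in[OF assms])

lemma cochain_diff:
  "f \<in> homogeneous_cochains p \<Longrightarrow> g \<in> homogeneous_cochains p \<Longrightarrow> (\<lambda>\<omega>. f \<omega> - g \<omega>) \<in> homogeneous_cochains p"
  using cochain_add[OF _ cochain_minus, of f p g] by simp

lemma face_shift: "face j (shift c \<omega>) = shift c (face j \<omega>)"
  by (auto simp: face_def shift_def fun_eq_iff)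

lemma homogeneous_coboundary_cochain:
  assumes f: "f \<in> homogeneous_cochains p"
  shows "homogeneous_coboundary p f \<in> homogeneous_cochains (Suc p)"
proof (rule cochainI)
  show "homogeneous_coboundary p f \<in> measurable S (count_space A)"
    unfolding homogeneous_coboundary_def[abs_def]
    by (intro measurable_sum_A measurable_alternating_A measurable_compose[OF measurable_face cochain_measurable[OF f]])
  show "homogeneous_coboundary p f (shift c \<omega>) = T c (homogeneous_coboundary p f \<omega>)" for c \<omega>
    unfolding homogeneous_coboundary_def
    by (subst T_sum) (auto simp: face_shift cochain_shift[OF f] T_alternating cochain_in[OF f]
        stable_alternating[OF stable_A] simp del: sum.atMost_Suc)
  show "homogeneous_coboundary p f \<omega> = homogeneous_coboundary p f \<omega>'" if "\<And>i. i \<le> Suc p \<Longrightarrow> \<omega> i = \<omega>' i" for \<omega> \<omega>'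
    unfolding homogeneous_coboundary_def
    by (intro sum.cong refl arg_cong[where f="alternating _"] cochain_cong[OF f]) (use that in \<open>auto simp: face_def\<close>)
qed

lemma homogeneous_coboundary_diff:
  "homogeneous_coboundary p (\<lambda>\<omega>. f \<omega> - g \<omega>) \<omega> = homogeneous_coboundary p f \<omega> - homogeneous_coboundary p g \<omega>"
  by (simp only: homogeneous_coboundary_def alternating_diff sum_subtractf)

lemma homogeneous_coboundary_add:
  "homogeneous_coboundary p (\<lambda>\<omega>. f \<omega> + g \<omega>) \<omega> = homogeneous_coboundary p f \<omega> + homogeneous_coboundary p g \<omega>"
  by (simp only: homogeneous_coboundary_def alternating_add sum.distrib)

lemma face_update: "j \<le> p \<Longrightarrow> face j (\<eta>(Suc p := w)) = (face j \<eta>)(p := w)"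
  by (auto simp: face_def fun_eq_iff)

lemma homogeneous_coboundary_update:
  assumes f: "f \<in> homogeneous_cochains p"
  shows "homogeneous_coboundary p f (\<eta>(Suc p := w)) =
    (\<Sum>j\<le>p. alternating j (f ((face j \<eta>)(p := w)))) - alternating p (f \<eta>)"
proof -
  have "f (face (Suc p) (\<eta>(Suc p := w))) = f \<eta>"
    by (rule cochain_cong[OF f]) (auto simp: face_def)
  then show ?thesis
    by (simp add: homogeneous_coboundary_def alternating_Suc face_update)
qed

text \<open>
  Let \<open>\<kappa>\<close> be the cone over \<open>f\<close> with vertex \<open>v\<close>, up to sign. Modulo \<open>B\<close>, the cocycle identity at
  \<open>\<eta>\<^sub>0, \<dots>, \<eta>\<^sub>p, v \<eta>\<close>, where \<open>p = q + 1\<close>, writes \<open>f \<eta>\<close> as an alternating sum \<open>\<Sum>\<^sub>j g\<^sub>j\<close> over the omitted vertex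
  \<open>\<eta>\<^sub>j\<close>, and \<open>d\<kappa>\<close> is a sum \<open>\<Sum>\<^sub>j h\<^sub>j\<close> of the same shape whose cone vertex is that of the face
  instead of that of \<open>\<eta>\<close>. For \<open>j > k\<close> the two vertices agree and \<open>g\<^sub>j = h\<^sub>j\<close>. For \<open>j \<le> k\<close> both
  terms have to be in \<open>B\<close> on their own.
\<close>

lemma cone_defect:
  assumes f: "f \<in> homogeneous_cochains (Suc q)" and B: "stable B" and "k \<le> q"
    and v: "\<And>\<omega> \<omega>'. (\<And>i. i \<le> k \<Longrightarrow> \<omega> i = \<omega>' i) \<Longrightarrow> v \<omega> = v \<omega>'"
    and d: "homogeneous_coboundary (Suc q) f (\<eta>(Suc (Suc q) := v \<eta>)) \<in> B"
    and near: "\<And>j. j \<le> k \<Longrightarrow> f (face j (\<eta>(Suc (Suc q) := v \<eta>))) \<in> B"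
    and near': "\<And>j. j \<le> k \<Longrightarrow> f ((face j \<eta>)(Suc q := v (face j \<eta>))) \<in> B"
  shows "f \<eta> - homogeneous_coboundary q (\<lambda>\<omega>. alternating (Suc q) (f ((\<omega>)(Suc q := v \<omega>)))) \<eta> \<in> B"
proof -
  let ?p = "Suc q"
  let ?g = "\<lambda>j. alternating (?p + j) (f ((face j \<eta>)(?p := v \<eta>)))"
  let ?h = "\<lambda>j. alternating (?p + j) (f ((face j \<eta>)(?p := v (face j \<eta>))))"
  have g: "alternating ?p (homogeneous_coboundary ?p f (\<eta>(Suc ?p := v \<eta>))) = (\<Sum>j\<le>?p. ?g j) - f \<eta>"
    unfolding homogeneous_coboundary_update[OF f]
    by (simp add: diff_conv_add_uminus alternating_add alternating_minus alternating_sum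
        alternating_alternating del: add_uminus_conv_diff sum.atMost_Suc)
  have h: "homogeneous_coboundary q (\<lambda>\<omega>. alternating ?p (f ((\<omega>)(?p := v \<omega>)))) \<eta> = (\<Sum>j\<le>?p. ?h j)"
    unfolding homogeneous_coboundary_def alternating_alternating by (simp only: add.commute)
  have "(\<Sum>j\<le>?p. ?g j) - (\<Sum>j\<le>?p. ?h j) = (\<Sum>j\<le>?p. ?g j - ?h j)"
    by (simp only: sum_subtractf)
  also have "\<dots> \<in> B"
  proof (rule stable_sum[OF B])
    fix j assume "j \<in> {..?p}"
    show "?g j - ?h j \<in> B"
    proof (cases "j \<le> k")
      case True
      then have "?g j \<in> B" "?h j \<in> B"
        using near[of j] near'[of j] \<open>k \<le> q\<close> B by (auto simp: stable_alternating face_update)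
      then show ?thesis by (rule stableD(6)[OF B])
    next
      case False
      then have "v (face j \<eta>) = v \<eta>" by (intro v) (auto simp: face_def)
      then show ?thesis using stableD(2)[OF B] by simp
    qed
  qed
  finally have diff: "(\<Sum>j\<le>?p. ?g j) - (\<Sum>j\<le>?p. ?h j) \<in> B" .
  have "f \<eta> - (\<Sum>j\<le>?p. ?h j) =
      ((\<Sum>j\<le>?p. ?g j) - (\<Sum>j\<le>?p. ?h j)) - alternating ?p (homogeneous_coboundary ?p f (\<eta>(Suc ?p := v \<eta>)))"
    unfolding g by (simp del: sum.atMost_Suc)
  then show ?thesis
    unfolding h using stableD(6)[OF B diff] d by (simp only: stable_alternating[OF B])
qed

end


section \<open>Cochains that are almost everywhere close to a submodule\<close>

context discrete_action
begin

lemma sets_not_in: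
  assumes "f \<in> measurable M (count_space A)" "B \<subseteq> A"
  shows "{x \<in> space M. f x \<notin> B} \<in> sets M"
proof -
  have "f -` (A - B) \<inter> space M \<in> sets M" by (rule measurable_sets[OF assms(1)]) auto
  also have "f -` (A - B) \<inter> space M = {x \<in> space M. f x \<notin> B}"
    using measurable_space[OF assms(1)] by auto
  finally show ?thesis .
qed

lemma sets_cochain_not_in:
  "f \<in> homogeneous_cochains p \<Longrightarrow> stable B \<Longrightarrow> {\<omega>. f \<omega> \<notin> B} \<in> sets S"
  using sets_not_in[OF cochain_measurable stableD(1)] by simp

lemma invariant_cochain_not_in:
  "f \<in> homogeneous_cochains p \<Longrightarrow> stable B \<Longrightarrow> invariant {\<omega>. f \<omega> \<notin> B}"
  by (simp add: invariant_def cochain_shift stable_T_iff cochain_in)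

lemma invariant_Un: "invariant N \<Longrightarrow> invariant N' \<Longrightarrow> invariant (N \<union> N')"
  unfolding invariant_def by blast

lemma invariant_faces: "invariant N \<Longrightarrow> invariant (\<Union>j\<in>J. face j -` N)"
  unfolding invariant_def vimage_def UN_iff mem_Collect_eq face_shift by blast

text \<open>
  This is the condition \<open>P\<^sub>k\<close> with tolerance \<open>e\<close>.
\<close>

definition concentrated :: "nat \<Rightarrow> 'a set \<Rightarrow> ennreal \<Rightarrow> ((nat \<Rightarrow> 'g) \<Rightarrow> 'a) \<Rightarrow> bool" where
  "concentrated k B e f \<longleftrightarrow> (AE \<omega> in S. tail_prob k {\<omega>. f \<omega> \<notin> B} \<omega> \<le> e)"

lemma tail_prob_mono:
  assumes "N \<subseteq> N'" "N' \<in> sets S"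
  shows "tail_prob k N \<omega> \<le> tail_prob k N' \<omega>"
  unfolding tail_prob_def by (rule emeasure_mono) (use assms in auto)

lemma tail_prob_union:
  assumes [measurable]: "N \<in> sets S" "N' \<in> sets S"
  shows "tail_prob k (N \<union> N') \<omega> \<le> tail_prob k N \<omega> + tail_prob k N' \<omega>"
proof -
  have "{\<omega>'. comb_seq k \<omega> \<omega>' \<in> N \<union> N'} = {\<omega>'. comb_seq k \<omega> \<omega>' \<in> N} \<union> {\<omega>'. comb_seq k \<omega> \<omega>' \<in> N'}"
    by auto
  then show ?thesis
    unfolding tail_prob_def by (simp add: emeasure_subadditive)
qed

lemma tail_prob_UN:
  assumes "finite J" and [measurable]: "\<And>j. j \<in> J \<Longrightarrow> N j \<in> sets S"
  shows "tail_prob k (\<Union>j\<in>J. N j) \<omega> \<le> (\<Sum>j\<in>J. tail_prob k (N j) \<omega>)"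
proof -
  have "{\<omega>'. comb_seq k \<omega> \<omega>' \<in> (\<Union>j\<in>J. N j)} = (\<Union>j\<in>J. {\<omega>'. comb_seq k \<omega> \<omega>' \<in> N j})" by auto
  then show ?thesis
    unfolding tail_prob_def using assms by (simp add: emeasure_subadditive_finite image_subset_iff)
qed

text \<open>
  Omitting a vertex among the first \<open>k + 1\<close> leaves \<open>k\<close> of them, which is where the bound for \<open>N\<close>
  applies. As each face map preserves the measure, it applies to almost all faces.
\<close>

lemma tail_prob_faces:
  assumes N [measurable]: "N \<in> sets S" and small: "AE \<omega> in S. tail_prob k N \<omega> \<le> e"
  shows "AE \<omega> in S. tail_prob (Suc k) (\<Union>j\<in>{..k}. face j -` N) \<omega> \<le> of_nat (Suc k) * e"
proof -
  have meas: "face j -` N \<in> sets S" for j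
    using measurable_sets[OF measurable_face N] by simp
  have "AE \<omega> in S. \<forall>j\<in>{..k}. tail_prob k N (face j \<omega>) \<le> e"
    using AE_face[OF small] by (intro AE_finite_allI) auto
  then show ?thesis
  proof eventually_elim
    case (elim \<omega>)
    have "tail_prob (Suc k) (\<Union>j\<in>{..k}. face j -` N) \<omega> \<le> (\<Sum>j\<le>k. tail_prob (Suc k) (face j -` N) \<omega>)"
      by (rule tail_prob_UN) (auto intro: meas)
    also have "\<dots> \<le> (\<Sum>j\<le>k. e)"
      using elim by (intro sum_mono) (simp add: tail_prob_face)
    also have "\<dots> = of_nat (Suc k) * e" by simp
    finally show ?case .
  qed
qed

lemma AE_comb_seq:
  assumes "AE \<omega> in S. P \<omega>"
  shows "AE \<omega> in S. AE \<omega>' in S. P (comb_seq k \<omega> \<omega>')"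
proof -
  have "AE x in distr (S \<Otimes>\<^sub>M S) S (\<lambda>(\<omega>, \<omega>'). comb_seq k \<omega> \<omega>'). P x"
    unfolding PiM_comb_seq by (rule assms)
  from AE_distrD[OF measurable_comb_seq this]
  have "AE x in S \<Otimes>\<^sub>M S. P (case x of (\<omega>, \<omega>') \<Rightarrow> comb_seq k \<omega> \<omega>')" .
  from SS.AE_pair[OF this] show ?thesis by simp
qed

lemma update_prob_cong: "(\<And>i. i < k \<Longrightarrow> \<omega> i = \<omega>' i) \<Longrightarrow> update_prob k r N \<omega> w = update_prob k r N \<omega>' w"
  unfolding update_prob_def by (rule tail_prob_cong)

lemma good_vertex_cong:
  "(\<And>i. i < k \<Longrightarrow> \<omega> i = \<omega>' i) \<Longrightarrow> good_vertex k q \<omega> w = good_vertex k q \<omega>' w"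
  using update_prob_cong[of k \<omega> \<omega>'] tail_prob_cong[of k \<omega> \<omega>'] by (cases q) (simp add: good_vertex_def)

lemma good_vertex_shift:
  "N \<in> sets S \<Longrightarrow> invariant N \<Longrightarrow>
    good_vertex k (r, N) (shift c \<omega>) (c + w) = good_vertex k (r, N) \<omega> w"
  by (simp add: good_vertex_def update_prob_shift tail_prob_shift)

text \<open>
  Equivariance is built in by searching for \<open>v\<close> among the translates \<open>\<omega> 0 + t i\<close>: whether such a
  translate is good depends on \<open>\<omega>\<close> only up to translation. The events \<open>N\<close> and \<open>N'\<close> are treated together
  because \<open>v\<close> has to be good for both; each excludes at most a quarter of the group, so at least half of it
  remains.
\<close>

lemma good_vertex_selection:
  assumes N [measurable]: "N \<in> sets S" "N' \<in> sets S" and inv: "invariant N" "invariant N'"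
    and k: "0 < k" "k \<le> r" "k \<le> r'"
  obtains v where "v \<in> measurable S \<mu>" "\<And>c \<omega>. v (shift c \<omega>) = c + v \<omega>"
    "\<forall>\<omega> \<omega>'. (\<forall>i<k. \<omega> i = \<omega>' i) \<longrightarrow> v \<omega> = v \<omega>'"
    "AE \<omega> in S. good_vertex k (r, N) \<omega> (v \<omega>) \<and> good_vertex k (r', N') \<omega> (v \<omega>)"
proof -
  define G where "G \<omega> w \<longleftrightarrow> good_vertex k (r, N) \<omega> w \<and> good_vertex k (r', N') \<omega> w" for \<omega> w
  \<comment> \<open>\<open>Q\<close> is invariant under translation of \<open>\<omega>\<close>; hence so is the first \<open>i\<close> with \<open>Q \<omega> (t i)\<close>.\<close>
  define Q where "Q \<omega> s = G \<omega> (\<omega> 0 + s)" for \<omega> s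
  have G [measurable]: "Measurable.pred (S \<Otimes>\<^sub>M \<mu>) (\<lambda>x. G (fst x) (snd x))"
  proof -
    have [measurable]: "(\<lambda>x. update_prob k r N (fst x) (snd x)) \<in> borel_measurable (S \<Otimes>\<^sub>M \<mu>)"
      "(\<lambda>x. update_prob k r' N' (fst x) (snd x)) \<in> borel_measurable (S \<Otimes>\<^sub>M \<mu>)"
      using measurable_update_prob[OF N(1)] measurable_update_prob[OF N(2)] by (simp_all add: split_beta')
    show ?thesis unfolding G_def good_vertex_def prod.case by measurable
  qed
  have Q: "Measurable.pred (S \<Otimes>\<^sub>M \<mu>) (\<lambda>x. Q (fst x) (snd x))"
  proof -
    have "(\<lambda>x. (fst x, fst x 0 + snd x)) \<in> measurable (S \<Otimes>\<^sub>M \<mu>) (S \<Otimes>\<^sub>M \<mu>)" by measurable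
    from measurable_compose[OF this G] show ?thesis by (simp add: Q_def)
  qed
  have half: "2 * emeasure \<mu> {s. \<not> Q \<omega> s} \<le> 1" for \<omega>
  proof -
    let ?b = "{w. \<not> good_vertex k (r, N) \<omega> w}" and ?b' = "{w. \<not> good_vertex k (r', N') \<omega> w}"
    have [measurable]: "update_prob k r N \<omega> \<in> borel_measurable \<mu>" "update_prob k r' N' \<omega> \<in> borel_measurable \<mu>"
      using measurable_compose_Pair1[OF _ measurable_update_prob[OF N(1)], of \<omega> k r]
        measurable_compose_Pair1[OF _ measurable_update_prob[OF N(2)], of \<omega> k r'] by simp_all
    have b: "?b \<in> sets \<mu>" "?b' \<in> sets \<mu>"
      unfolding good_vertex_def prod.case by measurable
    then have b': "?b \<union> ?b' \<in> sets \<mu>" by (rule sets.Un)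
    have "emeasure \<mu> {s. \<not> Q \<omega> s} = emeasure (distr \<mu> \<mu> (\<lambda>x. \<omega> 0 + x)) (?b \<union> ?b')"
      using b' by (subst emeasure_distr) (auto simp: Q_def G_def intro!: arg_cong[where f="emeasure \<mu>"])
    also have "\<dots> = emeasure \<mu> (?b \<union> ?b')" by (simp add: translate)
    also have "\<dots> \<le> emeasure \<mu> ?b + emeasure \<mu> ?b'" by (rule emeasure_subadditive[OF b])
    finally have "4 * emeasure \<mu> {s. \<not> Q \<omega> s} \<le> 4 * (emeasure \<mu> ?b + emeasure \<mu> ?b')"
      by (rule mult_left_mono) simp
    also have "\<dots> \<le> 1 + 1"
      unfolding distrib_left by (intro add_mono emeasure_bad_vertex N k)
    finally have "2 * (2 * emeasure \<mu> {s. \<not> Q \<omega> s}) \<le> 2 * 1"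
      by (simp add: mult.assoc[symmetric])
    then show ?thesis by (subst (asm) ennreal_mult_le_mult_iff) auto
  qed
  from generic_sequence[OF Q half] obtain t where t: "AE \<omega> in S. \<exists>i::nat. Q \<omega> (t i)" by blast
  define v where "v \<omega> = \<omega> 0 + t (LEAST i. Q \<omega> (t i))" for \<omega>
  show ?thesis
  proof
    have [measurable]: "Measurable.pred S (\<lambda>\<omega>. Q \<omega> (t i))" for i
    proof -
      have "(\<lambda>\<omega>. (\<omega>, t i)) \<in> measurable S (S \<Otimes>\<^sub>M \<mu>)" by measurable
      from measurable_compose[OF this Q] show ?thesis by simp
    qed
    have "(\<lambda>\<omega>. t (LEAST i. Q \<omega> (t i))) \<in> measurable S \<mu>"
      by (rule measurable_compose_countable[where f="\<lambda>i \<omega>. t i"]) auto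
    then have "v \<in> borel_measurable S" unfolding v_def by measurable
    then show "v \<in> measurable S \<mu>"
      using measurable_cong_sets[OF refl sets_mu, of S] by simp
  next
    fix c \<omega>
    have "Q (shift c \<omega>) s = Q \<omega> s" for s
      using good_vertex_shift[OF N(1) inv(1), of k r c \<omega> "\<omega> 0 + s"]
        good_vertex_shift[OF N(2) inv(2), of k r' c \<omega> "\<omega> 0 + s"]
      by (simp add: Q_def G_def add.assoc shift_def[of c \<omega> 0])
    then show "v (shift c \<omega>) = c + v \<omega>"
      by (simp add: v_def add.assoc shift_def[of c \<omega> 0])
  next
    have "v \<omega> = v \<omega>'" if eq: "\<And>i. i < k \<Longrightarrow> \<omega> i = \<omega>' i" for \<omega> \<omega>'
    proof -
      have "Q \<omega> s = Q \<omega>' s" for s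
        using good_vertex_cong[of k \<omega> \<omega>', OF eq] eq[OF k(1)] by (simp add: Q_def G_def)
      then show ?thesis using eq[OF k(1)] by (simp add: v_def)
    qed
    then show "\<forall>\<omega> \<omega>'. (\<forall>i<k. \<omega> i = \<omega>' i) \<longrightarrow> v \<omega> = v \<omega>'" by blast
  next
    show "AE \<omega> in S. good_vertex k (r, N) \<omega> (v \<omega>) \<and> good_vertex k (r', N') \<omega> (v \<omega>)"
      using t
    proof eventually_elim
      case (elim \<omega>)
      then have "Q \<omega> (t (LEAST i. Q \<omega> (t i)))" by (rule LeastI_ex)
      then show ?case by (simp add: Q_def G_def v_def)
    qed
  qed
qed

lemma tail_prob_update:
  assumes "\<And>\<omega> \<omega>'. (\<And>i. i < k \<Longrightarrow> \<omega> i = \<omega>' i) \<Longrightarrow> v \<omega> = v \<omega>'"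
  shows "tail_prob k {\<eta>. \<eta>(r := v \<eta>) \<in> N} \<omega> = update_prob k r N \<omega> (v \<omega>)"
proof -
  have "v (comb_seq k \<omega> \<omega>') = v \<omega>" for \<omega>'
    by (rule assms) (simp add: comb_seq_less)
  then show ?thesis by (simp add: tail_prob_def update_prob_def)
qed

text \<open>
  The cone vertex \<open>v\<close> is chosen good for two events. One is that \<open>f\<close> fails to be a cocycle modulo \<open>B\<close> or
  has a value outside \<open>B\<close> on a face that omits one of the first \<open>k + 1\<close> vertices, with \<open>v\<close> as
  vertex \<open>q + 2\<close>; this controls the terms \<open>g\<^sub>j\<close> of \<open>cone_defect\<close>. The other is \<open>f \<notin> B\<close> with \<open>v\<close>
  as vertex \<open>q + 1\<close>; it makes \<open>\<kappa>\<close> itself concentrated, which controls the terms \<open>h\<^sub>j\<close>.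
  Each contributes a factor 4 and \<open>k + 1\<close> faces, whence the constant \<open>8 (k + 1)\<close>.
\<close>

lemma concentration_step:
  assumes f: "f \<in> homogeneous_cochains (Suc q)" and B: "stable B" and k: "0 < k" "k \<le> q"
    and cocycle: "AE \<omega> in S. homogeneous_coboundary (Suc q) f \<omega> \<in> B"
    and conc: "concentrated k B e f"
  shows "\<exists>\<kappa>\<in>homogeneous_cochains q.
    concentrated (Suc k) B (8 * of_nat (Suc k) * e) (\<lambda>\<omega>. f \<omega> - homogeneous_coboundary q \<kappa> \<omega>)"
proof -
  let ?p = "Suc q"
  let ?D = "{\<omega>. homogeneous_coboundary ?p f \<omega> \<notin> B}"
  define N where "N = {\<omega>. f \<omega> \<notin> B}"
  define F where "F = (\<Union>j\<in>{..k}. face j -` N)"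
  have df: "homogeneous_coboundary ?p f \<in> homogeneous_cochains (Suc ?p)"
    by (rule homogeneous_coboundary_cochain[OF f])
  have N [measurable]: "N \<in> sets S" and D [measurable]: "?D \<in> sets S"
    unfolding N_def by (rule sets_cochain_not_in[OF f B] sets_cochain_not_in[OF df B])+
  have meas_face: "face j -` X \<in> sets S" if "X \<in> sets S" for j X
    using measurable_sets[OF measurable_face that] by simp
  have F [measurable]: "F \<in> sets S"
    unfolding F_def by (intro sets.finite_UN) (auto intro: meas_face)
  have inv_N: "invariant N" and inv_D: "invariant ?D"
    unfolding N_def by (rule invariant_cochain_not_in[OF f B] invariant_cochain_not_in[OF df B])+
  have inv_DF: "invariant (?D \<union> F)"
    unfolding F_def by (intro invariant_Un invariant_faces inv_N inv_D)
  have k': "Suc k \<le> Suc ?p" "Suc k \<le> ?p" using k by simp_all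
  obtain v where v [measurable]: "v \<in> measurable S \<mu>" and v_shift: "\<And>c \<omega>. v (shift c \<omega>) = c + v \<omega>"
    and v_dep: "\<forall>\<omega> \<omega>'. (\<forall>i<Suc k. \<omega> i = \<omega>' i) \<longrightarrow> v \<omega> = v \<omega>'"
    and good: "AE \<omega> in S. good_vertex (Suc k) (Suc ?p, ?D \<union> F) \<omega> (v \<omega>) \<and> good_vertex (Suc k) (?p, N) \<omega> (v \<omega>)"
    by (rule good_vertex_selection[OF sets.Un[OF D F] N inv_DF inv_N zero_less_Suc k'], rule that)
  have v_cong: "v \<omega> = v \<omega>'" if "\<And>i. i < Suc k \<Longrightarrow> \<omega> i = \<omega>' i" for \<omega> \<omega>'
    using v_dep that by blast
  have v_update: "tail_prob (Suc k) {\<eta>. \<eta>(r := v \<eta>) \<in> X} \<omega> = update_prob (Suc k) r X \<omega> (v \<omega>)" for r X \<omega>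
    by (rule tail_prob_update) (rule v_cong)
  define \<kappa> where "\<kappa> \<omega> = alternating ?p (f ((\<omega>)(?p := v \<omega>)))" for \<omega>
  have \<kappa>: "\<kappa> \<in> homogeneous_cochains q"
  proof (rule cochainI)
    have "(\<lambda>\<omega>. f ((\<omega>)(?p := v \<omega>))) \<in> measurable S (count_space A)"
      by (rule measurable_compose[OF _ cochain_measurable[OF f]]) measurable
    then show "\<kappa> \<in> measurable S (count_space A)"
      unfolding \<kappa>_def by (rule measurable_alternating_A)
    show "\<kappa> (shift c \<omega>) = T c (\<kappa> \<omega>)" for c \<omega>
    proof -
      have "(shift c \<omega>)(?p := v (shift c \<omega>)) = shift c ((\<omega>)(?p := v \<omega>))"
        by (auto simp: v_shift shift_def fun_eq_iff)
      then show ?thesis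
        by (simp add: \<kappa>_def cochain_shift[OF f] T_alternating cochain_in[OF f])
    qed
    show "\<kappa> \<omega> = \<kappa> \<omega>'" if eq: "\<And>i. i \<le> q \<Longrightarrow> \<omega> i = \<omega>' i" for \<omega> \<omega>'
    proof -
      have "v \<omega> = v \<omega>'" by (rule v_cong) (use eq k in auto)
      then show ?thesis
        unfolding \<kappa>_def by (intro arg_cong[where f="alternating _"] cochain_cong[OF f]) (use eq in auto)
    qed
  qed
  define K where "K = {\<omega>. (\<omega>)(?p := v \<omega>) \<in> N}"
  have K [measurable]: "K \<in> sets S"
  proof -
    have "Measurable.pred S (\<lambda>\<omega>. (\<omega>)(?p := v \<omega>) \<in> N)" by measurable
    then show ?thesis by (simp add: K_def pred_def)
  qed
  have conc': "AE \<omega> in S. tail_prob k N \<omega> \<le> e"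
    using conc by (simp add: concentrated_def N_def)
  have DF: "AE \<omega> in S. tail_prob (Suc k) (?D \<union> F) \<omega> \<le> of_nat (Suc k) * e"
  proof -
    have "AE \<omega> in S. tail_prob (Suc k) ?D \<omega> = 0"
      by (rule tail_prob_null[OF _ D]) (use cocycle in auto)
    moreover have "AE \<omega> in S. tail_prob (Suc k) F \<omega> \<le> of_nat (Suc k) * e"
      unfolding F_def by (rule tail_prob_faces[OF N conc'])
    ultimately show ?thesis
    proof eventually_elim
      case (elim \<omega>)
      have "tail_prob (Suc k) (?D \<union> F) \<omega> \<le> tail_prob (Suc k) ?D \<omega> + tail_prob (Suc k) F \<omega>"
        by (rule tail_prob_union[OF D F])
      also have "\<dots> = tail_prob (Suc k) F \<omega>" using elim(1) by simp
      finally show ?case using elim(2) by (rule order_trans)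
    qed
  qed
  \<comment> \<open>The bound for \<open>K\<close> holds with only \<open>k\<close> vertices prescribed: given vertex \<open>k\<close> as well, the vertex \<open>v\<close> costs
    a factor 4, and vertex \<open>k\<close> is then averaged out.\<close>
  have K_small: "AE \<omega> in S. tail_prob k K \<omega> \<le> 4 * e"
    using AE_comb_seq[OF good, of k] conc'
  proof eventually_elim
    case (elim \<omega>)
    have "tail_prob k K \<omega> = (\<integral>\<^sup>+\<omega>'. tail_prob (Suc k) K (comb_seq k \<omega> \<omega>') \<partial>S)"
      by (simp add: nn_integral_tail_prob_Suc)
    also have "\<dots> \<le> (\<integral>\<^sup>+\<omega>'. 4 * tail_prob (Suc k) N (comb_seq k \<omega> \<omega>') \<partial>S)"
    proof (rule nn_integral_mono_AE)
      show "AE \<omega>' in S. tail_prob (Suc k) K (comb_seq k \<omega> \<omega>') \<le> 4 * tail_prob (Suc k) N (comb_seq k \<omega> \<omega>')"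
        using elim(1)
      proof eventually_elim
        case (elim \<omega>')
        then show ?case
          unfolding K_def v_update by (simp add: good_vertex_def)
      qed
    qed
    also have "\<dots> = 4 * tail_prob k N \<omega>"
      by (subst nn_integral_cmult) (simp_all add: nn_integral_tail_prob_Suc)
    also have "\<dots> \<le> 4 * e" using elim(2) by (rule mult_left_mono) simp
    finally show ?case .
  qed
  let ?f' = "\<lambda>\<omega>. f \<omega> - homogeneous_coboundary q \<kappa> \<omega>"
  let ?E = "{\<eta>. \<eta>(Suc ?p := v \<eta>) \<in> ?D \<union> F}" and ?KF = "\<Union>j\<in>{..k}. face j -` K"
  have E [measurable]: "?E \<in> sets S"
  proof -
    have "Measurable.pred S (\<lambda>\<omega>. (\<omega>)(Suc ?p := v \<omega>) \<in> ?D \<union> F)" by measurable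
    then show ?thesis by (simp add: pred_def)
  qed
  have KF: "?KF \<in> sets S" by (intro sets.finite_UN) (auto intro: meas_face)
  \<comment> \<open>Outside \<open>?E\<close> and \<open>?KF\<close> all hypotheses of \<open>cone_defect\<close> hold.\<close>
  have sub: "{\<omega>. ?f' \<omega> \<notin> B} \<subseteq> ?E \<union> ?KF"
  proof
    fix \<eta> assume bad: "\<eta> \<in> {\<omega>. ?f' \<omega> \<notin> B}"
    show "\<eta> \<in> ?E \<union> ?KF"
    proof (rule ccontr)
      assume not: "\<eta> \<notin> ?E \<union> ?KF"
      have "f \<eta> - homogeneous_coboundary q \<kappa> \<eta> \<in> B"
        unfolding \<kappa>_def
      proof (rule cone_defect[OF f B k(2)])
        show "v \<omega> = v \<omega>'" if "\<And>i. i \<le> k \<Longrightarrow> \<omega> i = \<omega>' i" for \<omega> \<omega>'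
          by (rule v_cong) (use that in auto)
        show "homogeneous_coboundary ?p f (\<eta>(Suc ?p := v \<eta>)) \<in> B" using not by blast
        show "f (face j (\<eta>(Suc ?p := v \<eta>))) \<in> B" if "j \<le> k" for j
          using not that unfolding F_def N_def by blast
        show "f ((face j \<eta>)(?p := v (face j \<eta>))) \<in> B" if "j \<le> k" for j
          using not that unfolding K_def N_def by blast
      qed
      with bad show False by simp
    qed
  qed
  have "concentrated (Suc k) B (8 * of_nat (Suc k) * e) ?f'"
    unfolding concentrated_def using DF good tail_prob_faces[OF K K_small]
  proof eventually_elim
    case (elim \<omega>)
    have "tail_prob (Suc k) {\<omega>. ?f' \<omega> \<notin> B} \<omega> \<le> tail_prob (Suc k) (?E \<union> ?KF) \<omega>"
      by (rule tail_prob_mono[OF sub]) (use E KF in auto)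
    also have "\<dots> \<le> tail_prob (Suc k) ?E \<omega> + tail_prob (Suc k) ?KF \<omega>"
      by (rule tail_prob_union[OF E KF])
    also have "\<dots> \<le> 4 * (of_nat (Suc k) * e) + of_nat (Suc k) * (4 * e)"
    proof (rule add_mono)
      have "tail_prob (Suc k) ?E \<omega> \<le> 4 * tail_prob (Suc k) (?D \<union> F) \<omega>"
        unfolding v_update using elim(2) by (simp add: good_vertex_def)
      also have "\<dots> \<le> 4 * (of_nat (Suc k) * e)" using elim(1) by (rule mult_left_mono) simp
      finally show "tail_prob (Suc k) ?E \<omega> \<le> 4 * (of_nat (Suc k) * e)" .
    qed (rule elim(3))
    also have "\<dots> = 8 * of_nat (Suc k) * e"
    proof -
      have "of_nat (Suc k) * (4 * e) = 4 * (of_nat (Suc k) * e)" by (rule mult.left_commute)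
      then have "4 * (of_nat (Suc k) * e) + of_nat (Suc k) * (4 * e) = (4 + 4) * (of_nat (Suc k) * e)"
        by (simp only: distrib_right)
      then show ?thesis by (simp only: mult.assoc numeral_plus_numeral Num.add_num_simps)
    qed
    finally show ?case .
  qed
  with \<kappa> show ?thesis by blast
qed

text \<open>
  With \<open>p\<close> vertices prescribed, only the last vertex is random. Appending one more random vertex, the union
  bound finds one for which all other faces have values in \<open>B\<close>; the cocycle identity then
  puts the remaining value, \<open>f \<omega>\<close>, into \<open>B\<close> as well.
\<close>

lemma concentrated_top:
  assumes f: "f \<in> homogeneous_cochains p" and B: "stable B"
    and cocycle: "AE \<omega> in S. homogeneous_coboundary p f \<omega> \<in> B"
    and conc: "concentrated p B e f" and e: "of_nat (Suc p) * e < 1"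
  shows "AE \<omega> in S. f \<omega> \<in> B"
proof -
  let ?N = "{\<omega>. f \<omega> \<notin> B}" and ?D = "{\<omega>. homogeneous_coboundary p f \<omega> \<notin> B}"
  have N: "?N \<in> sets S" and D: "?D \<in> sets S"
    using sets_cochain_not_in[OF f B] sets_cochain_not_in[OF homogeneous_coboundary_cochain[OF f] B] by auto
  let ?F = "\<Union>j\<in>{..p}. face j -` ?N"
  have F: "?F \<in> sets S"
    using measurable_sets[OF measurable_face N] by (intro sets.finite_UN) auto
  have "AE \<omega> in S. tail_prob (Suc p) ?F \<omega> \<le> of_nat (Suc p) * e"
    by (rule tail_prob_faces[OF N]) (use conc in \<open>simp add: concentrated_def\<close>)
  moreover have "AE \<omega> in S. tail_prob (Suc p) ?D \<omega> = 0"
    by (rule tail_prob_null[OF _ D]) (use cocycle in auto)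
  ultimately show ?thesis
  proof eventually_elim
    case (elim \<omega>)
    have "tail_prob (Suc p) (?D \<union> ?F) \<omega> \<le> tail_prob (Suc p) ?D \<omega> + tail_prob (Suc p) ?F \<omega>"
      by (rule tail_prob_union[OF D F])
    also have "\<dots> = tail_prob (Suc p) ?F \<omega>" using elim(2) by simp
    also have "\<dots> \<le> of_nat (Suc p) * e" by (rule elim(1))
    also have "\<dots> < 1" by (rule e)
    finally have "tail_prob (Suc p) (?D \<union> ?F) \<omega> < 1" .
    then have "{\<omega>'. comb_seq (Suc p) \<omega> \<omega>' \<in> ?D \<union> ?F} \<noteq> UNIV"
      unfolding tail_prob_def by (metis emeasure_S_UNIV less_irrefl)
    then obtain \<omega>' where \<omega>': "comb_seq (Suc p) \<omega> \<omega>' \<notin> ?D \<union> ?F" by blast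
    let ?\<eta> = "comb_seq (Suc p) \<omega> \<omega>'"
    have "homogeneous_coboundary p f ?\<eta> = (\<Sum>j\<le>p. alternating j (f (face j ?\<eta>))) - alternating p (f \<omega>)"
    proof -
      have "f (face (Suc p) ?\<eta>) = f \<omega>"
        by (rule cochain_cong[OF f]) (auto simp: face_def comb_seq_def)
      then show ?thesis by (simp add: homogeneous_coboundary_def alternating_Suc)
    qed
    then have "alternating p (f \<omega>) = (\<Sum>j\<le>p. alternating j (f (face j ?\<eta>))) - homogeneous_coboundary p f ?\<eta>"
      by simp
    also have "\<dots> \<in> B"
      using \<omega>' by (intro stableD(6)[OF B] stable_sum[OF B]) (auto simp: stable_alternating[OF B])
    finally show ?case by (simp add: stable_alternating[OF B])
  qed
qed

text \<open>
  Downward induction on \<open>k\<close>. The tolerance is chosen before \<open>B\<close> and \<open>f\<close>, and this uniformity is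
  essential: in the application \<open>B\<close> is chosen according to the tolerance.
\<close>

lemma concentrated_trivial:
  assumes "0 < k" "k \<le> Suc q"
  shows "\<exists>e>0. \<forall>B f. stable B \<longrightarrow> f \<in> homogeneous_cochains (Suc q) \<longrightarrow>
    (AE \<omega> in S. homogeneous_coboundary (Suc q) f \<omega> \<in> B) \<longrightarrow> concentrated k B e f \<longrightarrow>
    (\<exists>\<kappa>\<in>homogeneous_cochains q. AE \<omega> in S. f \<omega> - homogeneous_coboundary q \<kappa> \<omega> \<in> B)"
  using assms(2,1)
proof (induction k rule: inc_induct)
  case base
  have zero: "(\<lambda>_. 0) \<in> homogeneous_cochains q"
    by (rule cochainI) (auto simp: T_0 zero_closed)
  \<comment> \<open>Any tolerance below \<open>1 / (q + 2)\<close> serves in \<open>concentrated_top\<close>, and the cone is zero.\<close>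
  let ?n = "Suc (Suc q)" and ?e = "ennreal (1 / (2 * real (Suc (Suc q))))"
  have e: "of_nat ?n * ?e < 1"
  proof -
    have "of_nat ?n * ?e = ennreal (real ?n * (1 / (2 * real ?n)))"
      unfolding ennreal_of_nat_eq_real_of_nat by (rule ennreal_mult[symmetric]) simp_all
    also have "real ?n * (1 / (2 * real ?n)) = 1 / 2" by (simp del: of_nat_Suc)
    also have "ennreal (1 / 2) < ennreal 1" by (subst ennreal_less_iff) simp_all
    finally show ?thesis by simp
  qed
  show ?case
  proof (intro exI[of _ ?e] conjI allI impI)
    fix B f
    assume B: "stable B" and f: "f \<in> homogeneous_cochains (Suc q)"
      and cocycle: "AE \<omega> in S. homogeneous_coboundary (Suc q) f \<omega> \<in> B" and conc: "concentrated (Suc q) B ?e f"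
    have "AE \<omega> in S. f \<omega> \<in> B" by (rule concentrated_top[OF f B cocycle conc e])
    with zero show "\<exists>\<kappa>\<in>homogeneous_cochains q. AE \<omega> in S. f \<omega> - homogeneous_coboundary q \<kappa> \<omega> \<in> B"
      by (intro bexI[OF _ zero]) (simp add: homogeneous_coboundary_def)
  qed (simp add: ennreal_zero_less_divide)
next
  case (step k)
  have k: "0 < k" "k \<le> q" using step.hyps step.prems by simp_all
  from step.IH[OF zero_less_Suc] obtain e where e: "e > 0" and IH: "\<forall>B f. stable B \<longrightarrow>
    f \<in> homogeneous_cochains (Suc q) \<longrightarrow> (AE \<omega> in S. homogeneous_coboundary (Suc q) f \<omega> \<in> B) \<longrightarrow>
    concentrated (Suc k) B e f \<longrightarrow>
    (\<exists>\<kappa>\<in>homogeneous_cochains q. AE \<omega> in S. f \<omega> - homogeneous_coboundary q \<kappa> \<omega> \<in> B)"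
    by (elim exE conjE)
  let ?d = "e / (8 * of_nat (Suc k))"
  have d: "8 * of_nat (Suc k) * ?d = e"
  proof -
    let ?c = "8 * of_nat (Suc k) :: ennreal"
    have "?c = of_nat (8 * Suc k)" by (simp only: of_nat_mult of_nat_numeral)
    then have c: "?c \<noteq> 0" "?c \<noteq> top_class.top"
      by (simp_all only: of_nat_eq_0_iff ennreal_of_nat_neq_top) simp_all
    have "?c * ?d = e * ?c / ?c" by (simp only: ennreal_times_divide mult.commute[of e])
    also have "\<dots> = e" by (rule mult_divide_eq_ennreal[OF c])
    finally show ?thesis .
  qed
  have pos: "?d > 0"
  proof (rule ccontr)
    assume "\<not> ?d > 0"
    then have "?d = 0" by (simp only: zero_less_iff_neq_zero not_not)
    with d have "e = 0" by (simp only: mult_zero_right)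
    with e show False by simp
  qed
  show ?case
  proof (intro exI[of _ ?d] conjI allI impI)
    fix B f
    assume B: "stable B" and f: "f \<in> homogeneous_cochains (Suc q)"
      and cocycle: "AE \<omega> in S. homogeneous_coboundary (Suc q) f \<omega> \<in> B" and conc: "concentrated k B ?d f"
    obtain \<kappa> where \<kappa>: "\<kappa> \<in> homogeneous_cochains q"
      and conc': "concentrated (Suc k) B e (\<lambda>\<omega>. f \<omega> - homogeneous_coboundary q \<kappa> \<omega>)"
      using concentration_step[OF f B k cocycle conc, unfolded d] by (elim bexE)
    have "\<exists>\<kappa>'\<in>homogeneous_cochains q.
        AE \<omega> in S. (f \<omega> - homogeneous_coboundary q \<kappa> \<omega>) - homogeneous_coboundary q \<kappa>' \<omega> \<in> B"
    proof (rule IH[rule_format, OF B _ _ conc'])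
      show "(\<lambda>\<omega>. f \<omega> - homogeneous_coboundary q \<kappa> \<omega>) \<in> homogeneous_cochains (Suc q)"
        by (rule cochain_diff[OF f homogeneous_coboundary_cochain[OF \<kappa>]])
      show "AE \<omega> in S. homogeneous_coboundary (Suc q) (\<lambda>\<omega>. f \<omega> - homogeneous_coboundary q \<kappa> \<omega>) \<omega> \<in> B"
        using cocycle by (simp add: homogeneous_coboundary_diff homogeneous_coboundary_square)
    qed
    then obtain \<kappa>' where \<kappa>': "\<kappa>' \<in> homogeneous_cochains q"
      and "AE \<omega> in S. (f \<omega> - homogeneous_coboundary q \<kappa> \<omega>) - homogeneous_coboundary q \<kappa>' \<omega> \<in> B" by blast
    then have "AE \<omega> in S. f \<omega> - homogeneous_coboundary q (\<lambda>\<omega>. \<kappa> \<omega> + \<kappa>' \<omega>) \<omega> \<in> B"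
      by (simp add: homogeneous_coboundary_add diff_diff_eq)
    then show "\<exists>\<kappa>\<in>homogeneous_cochains q. AE \<omega> in S. f \<omega> - homogeneous_coboundary q \<kappa> \<omega> \<in> B"
      by (rule bexI[OF _ cochain_add[OF \<kappa> \<kappa>']])
  qed (rule pos)
qed

lemma almost_stable_cocycle:
  "\<exists>e>0. \<forall>B f. stable B \<longrightarrow> f \<in> homogeneous_cochains (Suc q) \<longrightarrow>
    (AE \<omega> in S. homogeneous_coboundary (Suc q) f \<omega> \<in> B) \<longrightarrow> emeasure S {\<omega>. f \<omega> \<notin> B} \<le> e \<longrightarrow>
    (\<exists>\<kappa>\<in>homogeneous_cochains q. AE \<omega> in S. f \<omega> - homogeneous_coboundary q \<kappa> \<omega> \<in> B)"
proof -
  have "1 \<le> Suc q" by simp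
  from concentrated_trivial[OF zero_less_one this] obtain e where "e > 0" and e: "\<forall>B f. stable B \<longrightarrow>
    f \<in> homogeneous_cochains (Suc q) \<longrightarrow> (AE \<omega> in S. homogeneous_coboundary (Suc q) f \<omega> \<in> B) \<longrightarrow>
    concentrated 1 B e f \<longrightarrow>
    (\<exists>\<kappa>\<in>homogeneous_cochains q. AE \<omega> in S. f \<omega> - homogeneous_coboundary q \<kappa> \<omega> \<in> B)"
    by (elim exE conjE)
  show ?thesis
  proof (intro exI[of _ e] conjI allI impI)
    fix B f
    assume B: "stable B" and f: "f \<in> homogeneous_cochains (Suc q)"
      and cocycle: "AE \<omega> in S. homogeneous_coboundary (Suc q) f \<omega> \<in> B" and small: "emeasure S {\<omega>. f \<omega> \<notin> B} \<le> e"
    have "concentrated 1 B e f"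
      unfolding concentrated_def
      using small tail_prob_one[OF sets_cochain_not_in[OF f B] invariant_cochain_not_in[OF f B]] by simp
    then show "\<exists>\<kappa>\<in>homogeneous_cochains q. AE \<omega> in S. f \<omega> - homogeneous_coboundary q \<kappa> \<omega> \<in> B"
      by (rule e[rule_format, OF B f cocycle])
  qed fact
qed

end


section \<open>Inhomogeneous coordinates\<close>

text \<open>
  Index sets \<open>{1..p}\<close> are to keep this form under simplification.
\<close>

declare One_nat_def [simp del]

context haar_prob
begin


text \<open>
  The coordinates \<open>g\<^sub>j = x\<^sub>j\<^sub>-\<^sub>1\<inverse> x\<^sub>j\<close> of the simplex \<open>(x\<^sub>0, \<dots>, x\<^sub>p)\<close>, and below the simplex
  \<open>(1, g\<^sub>1, g\<^sub>1 g\<^sub>2, \<dots>)\<close> with given coordinates.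
\<close>

definition differences :: "nat \<Rightarrow> (nat \<Rightarrow> 'g) \<Rightarrow> nat \<Rightarrow> 'g" where
  "differences p \<omega> = (\<lambda>j\<in>{1..p}. - \<omega> (j - 1) + \<omega> j)"

fun path :: "nat \<Rightarrow> (nat \<Rightarrow> 'g) \<Rightarrow> nat \<Rightarrow> 'g" where
  "path p x 0 = 0"
| "path p x (Suc i) = path p x i + (if Suc i \<le> p then x (Suc i) else 0)"

abbreviation mu_power :: "nat \<Rightarrow> (nat \<Rightarrow> 'g) measure" where
  "mu_power p \<equiv> Pi\<^sub>M {1..p} (\<lambda>_. \<mu>)"

lemma measurable_differences [measurable]: "differences p \<in> measurable S (mu_power p)"
  unfolding differences_def
proof (rule measurable_restrict)
  show "(\<lambda>\<omega>. - \<omega> (j - 1) + \<omega> j) \<in> measurable S \<mu>" for j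
  proof -
    have "(\<lambda>\<omega>. - \<omega> (j - 1) + \<omega> j) \<in> borel_measurable S" by measurable
    then show ?thesis using measurable_cong_sets[OF refl sets_mu, of S] by simp
  qed
qed

lemma measurable_path [measurable]: "path p \<in> measurable (mu_power p) S"
proof (rule measurable_PiM_single')
  show "(\<lambda>x. path p x i) \<in> measurable (mu_power p) \<mu>" for i
  proof (induction i)
    case (Suc i)
    have [measurable]: "(\<lambda>x. path p x i) \<in> borel_measurable (mu_power p)"
      using Suc measurable_cong_sets[OF refl sets_mu, of "mu_power p"] by simp
    have "(\<lambda>x. path p x (Suc i)) \<in> borel_measurable (mu_power p)"
    proof (cases "Suc i \<le> p")
      case True
      then have [measurable]: "(\<lambda>x. x (Suc i)) \<in> measurable (mu_power p) \<mu>"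
        by (intro measurable_component_singleton) simp
      show ?thesis using True by simp
    qed simp
    then show ?case using measurable_cong_sets[OF refl sets_mu, of "mu_power p"] by simp
  qed simp
qed auto

lemma differences_update:
  "differences (Suc p) ((\<omega>)(Suc p := w)) = (differences p \<omega>)(Suc p := - \<omega> p + w)"
  by (auto simp: differences_def fun_eq_iff)

lemma nn_integral_translate:
  assumes [measurable]: "h \<in> borel_measurable \<mu>"
  shows "(\<integral>\<^sup>+w. h (c + w) \<partial>\<mu>) = (\<integral>\<^sup>+w. h w \<partial>\<mu>)"
proof -
  have "(\<integral>\<^sup>+w. h w \<partial>\<mu>) = (\<integral>\<^sup>+w. h w \<partial>distr \<mu> \<mu> (\<lambda>w. c + w))" by (simp add: translate)
  also have "\<dots> = (\<integral>\<^sup>+w. h (c + w) \<partial>\<mu>)" by (rule nn_integral_distr) auto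
  finally show ?thesis by simp
qed

lemma nn_integral_update:
  assumes [measurable]: "h \<in> borel_measurable S"
  shows "(\<integral>\<^sup>+\<omega>. h \<omega> \<partial>S) = (\<integral>\<^sup>+\<omega>. \<integral>\<^sup>+w. h ((\<omega>)(r := w)) \<partial>\<mu> \<partial>S)"
proof -
  have "(\<integral>\<^sup>+\<omega>. h \<omega> \<partial>S) = (\<integral>\<^sup>+\<omega>. h \<omega> \<partial>distr (\<mu> \<Otimes>\<^sub>M S) S (\<lambda>(w, \<omega>). (\<omega>)(r := w)))"
    by (simp add: distr_update)
  also have "\<dots> = (\<integral>\<^sup>+x. h (case x of (w, \<omega>) \<Rightarrow> (\<omega>)(r := w)) \<partial>(\<mu> \<Otimes>\<^sub>M S))"
    by (rule nn_integral_distr) auto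
  also have "\<dots> = (\<integral>\<^sup>+\<omega>. \<integral>\<^sup>+w. h ((\<omega>)(r := w)) \<partial>\<mu> \<partial>S)"
    by (subst MS.nn_integral_snd[symmetric]) (simp_all add: split_beta')
  finally show ?thesis .
qed

text \<open>
  The last coordinate is a left translate of the last vertex by a function of the earlier vertices, so by left
  invariance it may be replaced by the last vertex itself; induction treats the others.
\<close>

lemma nn_integral_differences:
  assumes "h \<in> borel_measurable (mu_power p)"
  shows "(\<integral>\<^sup>+\<omega>. h (differences p \<omega>) \<partial>S) = (\<integral>\<^sup>+x. h x \<partial>mu_power p)"
  using assms
proof (induction p arbitrary: h)
  case 0
  have "mu_power 0 = count_space {\<lambda>_. undefined}" by (simp add: PiM_empty)
  moreover have "differences 0 \<omega> = (\<lambda>_. undefined)" for \<omega>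
    by (simp add: differences_def fun_eq_iff)
  ultimately show ?case by (simp add: nn_integral_count_space_finite)
next
  case (Suc p)
  have I: "{1..Suc p} = insert (Suc p) {1..p}" by auto
  have [measurable]: "h \<in> borel_measurable (mu_power (Suc p))" by (rule Suc.prems)
  have upd [measurable]: "(\<lambda>(x, w). x(Suc p := w)) \<in> measurable (mu_power p \<Otimes>\<^sub>M \<mu>) (mu_power (Suc p))"
    unfolding I by (rule measurable_add_dim)
  have h_upd: "(\<lambda>(x, w). h (x(Suc p := w))) \<in> borel_measurable (mu_power p \<Otimes>\<^sub>M \<mu>)"
    using measurable_compose[OF upd Suc.prems] by (simp only: split_beta')
  have "(\<integral>\<^sup>+\<omega>. h (differences (Suc p) \<omega>) \<partial>S)
      = (\<integral>\<^sup>+\<omega>. \<integral>\<^sup>+w. h ((differences p \<omega>)(Suc p := - \<omega> p + w)) \<partial>\<mu> \<partial>S)"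
    by (subst nn_integral_update[where r="Suc p"]) (simp_all add: differences_update)
  also have "\<dots> = (\<integral>\<^sup>+\<omega>. \<integral>\<^sup>+w. h ((differences p \<omega>)(Suc p := w)) \<partial>\<mu> \<partial>S)"
  proof (rule nn_integral_cong)
    fix \<omega>
    have "differences p \<omega> \<in> space (mu_power p)"
      by (rule measurable_space[OF measurable_differences]) simp
    from measurable_compose[OF measurable_Pair1'[OF this] h_upd]
    have "(\<lambda>w. h ((differences p \<omega>)(Suc p := w))) \<in> borel_measurable \<mu>" by simp
    then show "(\<integral>\<^sup>+w. h ((differences p \<omega>)(Suc p := - \<omega> p + w)) \<partial>\<mu>) =
        (\<integral>\<^sup>+w. h ((differences p \<omega>)(Suc p := w)) \<partial>\<mu>)"
      by (rule nn_integral_translate)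
  qed
  also have "\<dots> = (\<integral>\<^sup>+x. \<integral>\<^sup>+w. h (x(Suc p := w)) \<partial>\<mu> \<partial>mu_power p)"
    by (rule Suc.IH, rule M.borel_measurable_nn_integral, rule h_upd)
  also have "\<dots> = (\<integral>\<^sup>+x. h x \<partial>mu_power (Suc p))"
    unfolding I by (rule product_nn_integral_insert[symmetric]) (use Suc.prems I in auto)
  finally show ?case .
qed

lemma distr_differences: "distr S (mu_power p) (differences p) = mu_power p"
proof (rule measure_eqI)
  fix X assume X: "X \<in> sets (distr S (mu_power p) (differences p))"
  then have [measurable]: "X \<in> sets (mu_power p)" by simp
  have "emeasure (distr S (mu_power p) (differences p)) X =
      (\<integral>\<^sup>+x. indicator X x \<partial>distr S (mu_power p) (differences p))"
    using X by simp
  also have "\<dots> = (\<integral>\<^sup>+\<omega>. indicator X (differences p \<omega>) \<partial>S)"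
    by (rule nn_integral_distr) auto
  also have "\<dots> = (\<integral>\<^sup>+x. indicator X x \<partial>mu_power p)"
    by (rule nn_integral_differences) simp
  finally show "emeasure (distr S (mu_power p) (differences p)) X = emeasure (mu_power p) X" by simp
qed simp

lemma differences_in_space: "differences p \<omega> \<in> space (mu_power p)"
  by (rule measurable_space[OF measurable_differences]) simp

lemma differences_path:
  assumes "x \<in> space (mu_power p)"
  shows "differences p (path p x) = x"
proof
  show "differences p (path p x) j = x j" for j
  proof (cases "j \<in> {1..p}")
    case True
    then obtain i where "j = Suc i" by (cases j) auto
    with True show ?thesis by (simp add: differences_def add.assoc[symmetric])
  next
    case False
    then show ?thesis using assms by (auto simp: differences_def space_PiM PiE_iff extensional_def)
  qed
qed

lemma path_differences: "i \<le> p \<Longrightarrow> path p (differences p \<omega>) i = - \<omega> 0 + \<omega> i"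
proof (induction i)
  case (Suc i)
  then have "path p (differences p \<omega>) (Suc i) = (- \<omega> 0 + \<omega> i) + differences p \<omega> (Suc i)" by simp
  also have "differences p \<omega> (Suc i) = - \<omega> i + \<omega> (Suc i)"
    using Suc.prems by (simp add: differences_def)
  also have "(- \<omega> 0 + \<omega> i) + (- \<omega> i + \<omega> (Suc i)) = - \<omega> 0 + (\<omega> i + - \<omega> i) + \<omega> (Suc i)"
    by (simp only: add.assoc)
  finally show ?case by simp
qed simp

end

context discrete_action
begin


text \<open>
  The usual bijection between inhomogeneous and homogeneous cochains, with inverse given by
  \<open>dehomogenize\<close>.
\<close>

definition homogenize :: "nat \<Rightarrow> ((nat \<Rightarrow> 'g) \<Rightarrow> 'a) \<Rightarrow> (nat \<Rightarrow> 'g) \<Rightarrow> 'a" where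
  "homogenize p \<phi> \<omega> = T (\<omega> 0) (\<phi> (differences p \<omega>))"

lemma cochain_values: "\<phi> \<in> measurable (mu_power p) (count_space A) \<Longrightarrow> \<phi> (differences p \<omega>) \<in> A"
  using measurable_space[of \<phi> "mu_power p" "count_space A"] differences_in_space by simp

lemma homogenize_cochain:
  assumes \<phi>: "\<phi> \<in> measurable (mu_power p) (count_space A)"
  shows "homogenize p \<phi> \<in> homogeneous_cochains p"
proof (rule cochainI)
  show "homogenize p \<phi> \<in> measurable S (count_space A)"
    unfolding homogenize_def[abs_def]
    by (rule measurable_T_A[OF measurable_compose[OF measurable_differences \<phi>]]) simp
  have "- (c + a) + (c + b) = - a + b" for a b c :: 'g
  proof -
    have "- (c + a) + (c + b) = - a + (- c + (c + b))" by (simp only: minus_add add.assoc)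
    then show ?thesis by simp
  qed
  then have "differences p (shift c \<omega>) = differences p \<omega>" for c \<omega>
    by (simp only: differences_def shift_def)
  then show "homogenize p \<phi> (shift c \<omega>) = T c (homogenize p \<phi> \<omega>)" for c \<omega>
    by (simp add: homogenize_def shift_def[of c \<omega> 0] T_T cochain_values[OF \<phi>])
  show "homogenize p \<phi> \<omega> = homogenize p \<phi> \<omega>'" if "\<And>i. i \<le> p \<Longrightarrow> \<omega> i = \<omega>' i" for \<omega> \<omega>'
  proof -
    have "differences p \<omega> = differences p \<omega>'"
      using that by (auto simp: differences_def fun_eq_iff)
    then show ?thesis using that[of 0] by (simp add: homogenize_def)
  qed
qed

lemma dehomogenize:
  assumes f: "f \<in> homogeneous_cochains p"
  shows "(\<lambda>x. f (path p x)) \<in> measurable (mu_power p) (count_space A)"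
    and "homogenize p (\<lambda>x. f (path p x)) \<omega> = f \<omega>"
proof -
  show "(\<lambda>x. f (path p x)) \<in> measurable (mu_power p) (count_space A)"
    by (rule measurable_compose[OF measurable_path cochain_measurable[OF f]])
  have "homogenize p (\<lambda>x. f (path p x)) \<omega> = f (shift (\<omega> 0) (path p (differences p \<omega>)))"
    by (simp add: homogenize_def cochain_shift[OF f])
  also have "\<dots> = f \<omega>"
    by (rule cochain_cong[OF f]) (simp add: shift_def path_differences add.assoc[symmetric])
  finally show "homogenize p (\<lambda>x. f (path p x)) \<omega> = f \<omega>" .
qed

lemma AE_homogenize:
  assumes B: "stable B" and \<phi>: "\<phi> \<in> measurable (mu_power p) (count_space A)"
  shows "(AE \<omega> in S. homogenize p \<phi> \<omega> \<in> B) \<longleftrightarrow> (AE x in mu_power p. \<phi> x \<in> B)"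
proof -
  have "(AE \<omega> in S. homogenize p \<phi> \<omega> \<in> B) \<longleftrightarrow> (AE \<omega> in S. \<phi> (differences p \<omega>) \<in> B)"
    by (simp add: homogenize_def stable_T_iff[OF B] cochain_values[OF \<phi>])
  also have "\<dots> \<longleftrightarrow> (AE x in distr S (mu_power p) (differences p). \<phi> x \<in> B)"
  proof (rule AE_distr_iff[symmetric, OF measurable_differences])
    have "\<phi> -` B \<inter> space (mu_power p) \<in> sets (mu_power p)"
      by (rule measurable_sets[OF \<phi>]) (use stableD(1)[OF B] in simp)
    also have "\<phi> -` B \<inter> space (mu_power p) = {x \<in> space (mu_power p). \<phi> x \<in> B}" by auto
    finally show "{x \<in> space (mu_power p). \<phi> x \<in> B} \<in> sets (mu_power p)" .
  qed
  finally show ?thesis unfolding distr_differences .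
qed

lemma emeasure_homogenize:
  assumes B: "stable B" and \<phi>: "\<phi> \<in> measurable (mu_power p) (count_space A)"
  shows "emeasure S {\<omega>. homogenize p \<phi> \<omega> \<notin> B} = emeasure (mu_power p) {x \<in> space (mu_power p). \<phi> x \<notin> B}"
proof -
  let ?X = "{x \<in> space (mu_power p). \<phi> x \<notin> B}"
  have "?X \<in> sets (mu_power p)" by (rule sets_not_in[OF \<phi> stableD(1)[OF B]])
  then have "emeasure (distr S (mu_power p) (differences p)) ?X = emeasure S (differences p -` ?X \<inter> space S)"
    by (intro emeasure_distr) auto
  moreover have "differences p -` ?X \<inter> space S = {\<omega>. homogenize p \<phi> \<omega> \<notin> B}"
    by (auto simp: homogenize_def stable_T_iff[OF B] cochain_values[OF \<phi>] differences_in_space)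
  ultimately show ?thesis by (simp add: distr_differences)
qed

text \<open>
  The arguments in the bar differential are the coordinates of the faces of the simplex: multiplying two
  adjacent coordinates omits the vertex between them.
\<close>

lemma coboundary_map_differences:
  "coboundary_map T p \<phi> (differences (Suc p) \<omega>) =
    T (- \<omega> 0 + \<omega> 1) (\<phi> (differences p (face 0 \<omega>))) +
    (\<Sum>i\<in>{1..p}. alternating i (\<phi> (differences p (face i \<omega>)))) +
    alternating (p + 1) (\<phi> (differences p (face (Suc p) \<omega>)))"
proof -
  let ?x = "differences (Suc p) \<omega>"
  let ?h = "\<lambda>i j. if j < i then ?x j else if j = i then ?x i + ?x (i + 1) else ?x (j + 1)"
  have first: "(\<lambda>j\<in>{1..p}. ?x (j + 1)) = differences p (face 0 \<omega>)"
    by (auto simp: differences_def face_def fun_eq_iff One_nat_def)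
  have last: "(\<lambda>j\<in>{1..p}. ?x j) = differences p (face (Suc p) \<omega>)"
    by (auto simp: differences_def face_def fun_eq_iff)
  have middle: "(\<lambda>j\<in>{1..p}. ?h i j) = differences p (face i \<omega>)" if i: "i \<in> {1..p}" for i
  proof
    fix j
    show "(\<lambda>j\<in>{1..p}. ?h i j) j = differences p (face i \<omega>) j"
    proof (cases "j = i")
      case True
      then have "?x i + ?x (i + 1) = - \<omega> (i - 1) + \<omega> (Suc i)"
        using i by (simp add: differences_def add.assoc One_nat_def)
      then show ?thesis using True i by (simp add: differences_def face_def)
    next
      case False
      then show ?thesis using i by (auto simp: differences_def face_def One_nat_def)
    qed
  qed
  have "?x 1 = - \<omega> 0 + \<omega> 1" by (simp add: differences_def)
  then show ?thesis
    unfolding coboundary_map_def first last by (simp only: middle cong: sum.cong)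
qed

lemma homogenize_coboundary:
  assumes \<phi>: "\<phi> \<in> measurable (mu_power p) (count_space A)"
  shows "homogenize (Suc p) (coboundary_map T p \<phi>) \<omega> = homogeneous_coboundary p (homogenize p \<phi>) \<omega>"
proof -
  have in_A: "\<phi> (differences p \<omega>) \<in> A" for \<omega> by (rule cochain_values[OF \<phi>])
  have in_A': "alternating i (\<phi> (differences p \<omega>)) \<in> A" for i \<omega>
    by (simp add: stable_alternating[OF stable_A] in_A)
  have x1: "\<omega> 0 + (- \<omega> 0 + \<omega> 1) = \<omega> 1" by simp
  have "homogenize (Suc p) (coboundary_map T p \<phi>) \<omega> =
      T (\<omega> 0) (T (- \<omega> 0 + \<omega> 1) (\<phi> (differences p (face 0 \<omega>)))) +
      (\<Sum>i\<in>{1..p}. alternating i (T (\<omega> 0) (\<phi> (differences p (face i \<omega>))))) +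
      alternating (p + 1) (T (\<omega> 0) (\<phi> (differences p (face (Suc p) \<omega>))))"
    unfolding homogenize_def coboundary_map_differences
    by (simp add: T_add T_sum T_alternating in_A in_A' T_closed add_closed stable_sum[OF stable_A])
  also have "T (\<omega> 0) (T (- \<omega> 0 + \<omega> 1) (\<phi> (differences p (face 0 \<omega>)))) = alternating 0 (homogenize p \<phi> (face 0 \<omega>))"
    using x1 by (simp add: T_T[symmetric] in_A homogenize_def face_def alternating_def One_nat_def)
  also have "(\<Sum>i\<in>{1..p}. alternating i (T (\<omega> 0) (\<phi> (differences p (face i \<omega>))))) =
      (\<Sum>i\<in>{1..p}. alternating i (homogenize p \<phi> (face i \<omega>)))"
    by (rule sum.cong) (auto simp: homogenize_def face_def)
  also have "T (\<omega> 0) (\<phi> (differences p (face (Suc p) \<omega>))) = homogenize p \<phi> (face (Suc p) \<omega>)"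
    by (simp add: homogenize_def face_def)
  also have "alternating 0 (homogenize p \<phi> (face 0 \<omega>)) +
      (\<Sum>i\<in>{1..p}. alternating i (homogenize p \<phi> (face i \<omega>))) +
      alternating (p + 1) (homogenize p \<phi> (face (Suc p) \<omega>)) = homogeneous_coboundary p (homogenize p \<phi>) \<omega>"
    unfolding homogeneous_coboundary_def
    by (simp add: sum.atMost_Suc_shift[symmetric] atMost_atLeast0 sum.atLeast_Suc_atMost One_nat_def)
  finally show ?thesis .
qed

lemma coboundary_map_measurable:
  assumes \<phi>: "\<phi> \<in> measurable (mu_power p) (count_space A)"
  shows "coboundary_map T p \<phi> \<in> measurable (mu_power (Suc p)) (count_space A)"
proof -
  let ?f = "homogeneous_coboundary p (homogenize p \<phi>)"
  have f: "?f \<in> homogeneous_cochains (Suc p)"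
    by (rule homogeneous_coboundary_cochain[OF homogenize_cochain[OF \<phi>]])
  have "coboundary_map T p \<phi> x = ?f (path (Suc p) x)" if x: "x \<in> space (mu_power (Suc p))" for x
  proof -
    have "?f (path (Suc p) x) = T 0 (coboundary_map T p \<phi> x)"
      using homogenize_coboundary[OF \<phi>, of "path (Suc p) x"] differences_path[OF x] by (simp add: homogenize_def)
    moreover have "coboundary_map T p \<phi> x \<in> A"
      using coboundary_map_differences[of p \<phi> "path (Suc p) x"] differences_path[OF x] cochain_values[OF \<phi>]
      by (simp add: add_closed T_closed stable_sum[OF stable_A] stable_alternating[OF stable_A])
    ultimately show ?thesis by (simp add: T_zero)
  qed
  then show ?thesis
    using dehomogenize(1)[OF f] measurable_cong[of "mu_power (Suc p)" "coboundary_map T p \<phi>"] by metis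
qed

end


section \<open>Cochain and cohomology classes of a discrete module\<close>

lemma (in group) coset_eq_iff:
  assumes "subgroup H G" "x \<in> carrier G" "y \<in> carrier G"
  shows "H #> x = H #> y \<longleftrightarrow> (\<exists>h\<in>H. x = h \<otimes> y)"
proof
  assume "H #> x = H #> y"
  then have "x \<in> H #> y" using rcos_self[OF assms(2,1)] by simp
  then show "\<exists>h\<in>H. x = h \<otimes> y" by (auto simp: r_coset_def)
next
  assume "\<exists>h\<in>H. x = h \<otimes> y"
  then have "x \<in> H #> y" by (auto simp: r_coset_def)
  then show "H #> x = H #> y" using repr_independence[OF _ assms(3,1)] by simp
qed

lemma induced_map_coset:
  assumes "M \<noteq> {}" and "\<And>m. m \<in> M \<Longrightarrow> N #>\<^bsub>H\<^esub> f (m \<otimes>\<^bsub>G\<^esub> x) = N #>\<^bsub>H\<^esub> f x"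
  shows "induced_map H N f (M #>\<^bsub>G\<^esub> x) = N #>\<^bsub>H\<^esub> f x"
  using assms by (auto simp: induced_map_def r_coset_def)

lemma sets_borel_of_discrete: "sets (borel_of (discrete_topology A)) = sets (count_space A)"
proof -
  have "{U. openin (discrete_topology A) U} = Pow A" by (simp add: Pow_def)
  then show ?thesis by (simp add: borel_of_def sigma_algebra.sigma_sets_eq[OF sigma_algebra_Pow])
qed

text \<open>
  The cochains are defined by \<open>\<nu>\<close>, while probabilities are computed with its normalization \<open>\<mu>\<close>. The
  powers of the two measures have the same measurable sets and the same null sets, so they
  have the same cochains.
\<close>

locale haar_module = discrete_action \<mu> T A
  for \<mu> :: "'g::{topological_group_add, second_countable_topology} measure"
    and T :: "'g \<Rightarrow> 'a::ab_group_add \<Rightarrow> 'a" and A :: "'a set" +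
  fixes \<nu> :: "'g measure"
  assumes sets_power: "sets (haar_power \<nu> p) = sets (mu_power p)"
    and AE_power: "(AE x in haar_power \<nu> p. P x) \<longleftrightarrow> (AE x in mu_power p. P x)"
begin

abbreviation maps :: "nat \<Rightarrow> ((nat \<Rightarrow> 'g) \<Rightarrow> 'a) set" where
  "maps p \<equiv> measurable (mu_power p) (count_space A)"

abbreviation "Y \<equiv> discrete_topology A"

abbreviation "C p \<equiv> borel_maps \<nu> Y p"
abbreviation "N p \<equiv> null_maps \<nu> Y p"
abbreviation "D p \<equiv> coboundary_map T p"

lemma carrier_borel_maps [simp]: "carrier (C p) = maps p"
  unfolding borel_maps_def
  using measurable_cong_sets[OF sets_power sets_borel_of_discrete] by simp

lemma mult_borel_maps [simp]: "\<phi> \<otimes>\<^bsub>C p\<^esub> \<psi> = (\<lambda>x. \<phi> x + \<psi> x)"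
  by (simp add: borel_maps_def)

lemma one_borel_maps [simp]: "\<one>\<^bsub>C p\<^esub> = (\<lambda>_. 0)"
  by (simp add: borel_maps_def)

lemma zero_map: "(\<lambda>_. 0) \<in> maps p"
  by (simp add: zero_closed)

lemma diff_map: "\<phi> \<in> maps p \<Longrightarrow> \<psi> \<in> maps p \<Longrightarrow> (\<lambda>x. \<phi> x - \<psi> x) \<in> maps p"
  using measurable_add_A[of \<phi> _ "\<lambda>x. - \<psi> x"] measurable_minus_A[of \<psi>] by simp

lemma comm_group_borel_maps: "comm_group (C p)"
proof (rule comm_groupI)
  show "\<phi> \<otimes>\<^bsub>C p\<^esub> \<psi> \<in> carrier (C p)" if "\<phi> \<in> carrier (C p)" "\<psi> \<in> carrier (C p)" for \<phi> \<psi>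
    using that by (simp add: measurable_add_A)
  show "\<exists>\<psi>\<in>carrier (C p). \<psi> \<otimes>\<^bsub>C p\<^esub> \<phi> = \<one>\<^bsub>C p\<^esub>" if "\<phi> \<in> carrier (C p)" for \<phi>
    by (rule bexI[of _ "\<lambda>x. - \<phi> x"]) (use that measurable_minus_A in simp_all)
qed (simp_all add: zero_map add_ac)

sublocale C: comm_group "C p" for p
  by (rule comm_group_borel_maps)

lemma null_maps_iff: "\<phi> \<in> N p \<longleftrightarrow> \<phi> \<in> maps p \<and> (AE x in mu_power p. \<phi> x = 0)"
  by (simp add: null_maps_def AE_power)

lemma inv_borel_maps: "\<phi> \<in> maps p \<Longrightarrow> inv\<^bsub>C p\<^esub> \<phi> = (\<lambda>x. - \<phi> x)"
  by (rule C.inv_equality) (auto intro: measurable_minus_A)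

lemma subgroup_null_maps: "subgroup (N p) (C p)"
proof
  show "\<phi> \<otimes>\<^bsub>C p\<^esub> \<psi> \<in> N p" if "\<phi> \<in> N p" "\<psi> \<in> N p" for \<phi> \<psi>
    using that by (auto simp: null_maps_iff intro: measurable_add_A)
  show "inv\<^bsub>C p\<^esub> \<phi> \<in> N p" if "\<phi> \<in> N p" for \<phi>
    using that by (auto simp: null_maps_iff inv_borel_maps intro: measurable_minus_A)
qed (auto simp: null_maps_iff zero_map)

definition cochain_class :: "nat \<Rightarrow> ((nat \<Rightarrow> 'g) \<Rightarrow> 'a) \<Rightarrow> ((nat \<Rightarrow> 'g) \<Rightarrow> 'a) set" where
  "cochain_class p \<phi> = N p #>\<^bsub>C p\<^esub> \<phi>"

lemma cochain_class_eq_iff: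
  assumes "\<phi> \<in> maps p" "\<psi> \<in> maps p"
  shows "cochain_class p \<phi> = cochain_class p \<psi> \<longleftrightarrow> (AE x in mu_power p. \<phi> x = \<psi> x)"
proof -
  have "cochain_class p \<phi> = cochain_class p \<psi> \<longleftrightarrow> (\<exists>\<theta>\<in>N p. \<phi> = (\<lambda>x. \<theta> x + \<psi> x))"
    unfolding cochain_class_def using C.coset_eq_iff[OF subgroup_null_maps] assms by simp
  also have "\<dots> \<longleftrightarrow> (\<lambda>x. \<phi> x - \<psi> x) \<in> N p"
  proof
    assume "(\<lambda>x. \<phi> x - \<psi> x) \<in> N p"
    then show "\<exists>\<theta>\<in>N p. \<phi> = (\<lambda>x. \<theta> x + \<psi> x)" by (rule rev_bexI) auto
  qed (auto simp: fun_eq_iff)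
  finally show ?thesis by (simp add: null_maps_iff diff_map assms)
qed

lemma carrier_cochains: "carrier (cochains \<nu> Y p) = cochain_class p ` maps p"
  by (simp add: cochains_def carrier_FactGroup cochain_class_def)

lemma comm_group_cochains: "comm_group (cochains \<nu> Y p)"
  unfolding cochains_def by (rule C.abelian_FactGroup[OF subgroup_null_maps])

sublocale Ch: comm_group "cochains \<nu> Y p" for p
  by (rule comm_group_cochains)

lemma cochain_class_mult:
  "\<phi> \<in> maps p \<Longrightarrow> \<psi> \<in> maps p \<Longrightarrow> cochain_class p \<phi> \<otimes>\<^bsub>cochains \<nu> Y p\<^esub> cochain_class p \<psi> = cochain_class p (\<lambda>x. \<phi> x + \<psi> x)"
  using normal.rcos_sum[OF C.subgroup_imp_normal[OF subgroup_null_maps], of \<phi> p \<psi>]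
  by (simp add: cochains_def cochain_class_def)

lemma cochain_class_zero: "cochain_class p (\<lambda>_. 0) = \<one>\<^bsub>cochains \<nu> Y p\<^esub>"
  using C.coset_mult_one[of "N p" p] subgroup.subset[OF subgroup_null_maps[of p]]
  by (simp add: cochains_def cochain_class_def)

lemma cochain_class_eq_one_iff:
  "\<phi> \<in> maps p \<Longrightarrow> cochain_class p \<phi> = \<one>\<^bsub>cochains \<nu> Y p\<^esub> \<longleftrightarrow> (AE x in mu_power p. \<phi> x = 0)"
  unfolding cochain_class_zero[symmetric] by (rule cochain_class_eq_iff) (simp_all add: zero_map)

lemma homogenize_add:
  "\<phi> \<in> maps p \<Longrightarrow> \<psi> \<in> maps p \<Longrightarrow> homogenize p (\<lambda>x. \<phi> x + \<psi> x) \<omega> = homogenize p \<phi> \<omega> + homogenize p \<psi> \<omega>"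
  by (simp add: homogenize_def T_add cochain_values)

lemma homogenize_diff:
  assumes "\<phi> \<in> maps p" "\<psi> \<in> maps p"
  shows "homogenize p (\<lambda>x. \<phi> x - \<psi> x) \<omega> = homogenize p \<phi> \<omega> - homogenize p \<psi> \<omega>"
  using homogenize_add[OF diff_map[OF assms] assms(2), of \<omega>] by (simp add: eq_diff_eq)

text \<open>
  Identities between maps almost everywhere are transferred to sequences, where the differential is a plain
  alternating sum over measure preserving faces.
\<close>

lemma AE_eq_homogenize:
  assumes "\<phi> \<in> maps p" "\<psi> \<in> maps p"
  shows "(AE x in mu_power p. \<phi> x = \<psi> x) \<longleftrightarrow> (AE \<omega> in S. homogenize p \<phi> \<omega> = homogenize p \<psi> \<omega>)"
proof -
  have "stable {0}" by (simp add: stable_def zero_closed T_0)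
  from AE_homogenize[OF this diff_map[OF assms]]
  show ?thesis by (simp add: homogenize_diff assms)
qed

lemma D_map: "\<phi> \<in> maps p \<Longrightarrow> D p \<phi> \<in> maps (Suc p)"
  by (rule coboundary_map_measurable)

lemma D_cong:
  assumes "\<phi> \<in> maps p" "\<psi> \<in> maps p" "AE x in mu_power p. \<phi> x = \<psi> x"
  shows "AE x in mu_power (Suc p). D p \<phi> x = D p \<psi> x"
proof -
  have "AE \<omega> in S. homogenize p \<phi> \<omega> = homogenize p \<psi> \<omega>"
    using assms AE_eq_homogenize by simp
  then have "AE \<omega> in S. \<forall>j\<in>{..Suc p}. homogenize p \<phi> (face j \<omega>) = homogenize p \<psi> (face j \<omega>)"
    by (intro AE_finite_allI AE_face) auto
  then have "AE \<omega> in S. homogeneous_coboundary p (homogenize p \<phi>) \<omega> = homogeneous_coboundary p (homogenize p \<psi>) \<omega>"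
    by eventually_elim (simp add: homogeneous_coboundary_def del: sum.atMost_Suc)
  then show ?thesis
    by (simp add: AE_eq_homogenize D_map assms homogenize_coboundary)
qed

lemma D_add:
  assumes "\<phi> \<in> maps p" "\<psi> \<in> maps p"
  shows "AE x in mu_power (Suc p). D p (\<lambda>x. \<phi> x + \<psi> x) x = D p \<phi> x + D p \<psi> x"
proof -
  have "homogenize p (\<lambda>x. \<phi> x + \<psi> x) = (\<lambda>\<omega>. homogenize p \<phi> \<omega> + homogenize p \<psi> \<omega>)"
    using homogenize_add assms by blast
  then show ?thesis
    by (subst AE_eq_homogenize)
      (simp_all add: D_map measurable_add_A assms homogenize_coboundary homogenize_add homogeneous_coboundary_add)
qed

lemma D_diff:
  assumes "\<phi> \<in> maps p" "\<psi> \<in> maps p"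
  shows "AE x in mu_power (Suc p). D p (\<lambda>x. \<phi> x - \<psi> x) x = D p \<phi> x - D p \<psi> x"
proof -
  have "homogenize p (\<lambda>x. \<phi> x - \<psi> x) = (\<lambda>\<omega>. homogenize p \<phi> \<omega> - homogenize p \<psi> \<omega>)"
    using homogenize_diff assms by blast
  then show ?thesis
    by (subst AE_eq_homogenize)
      (simp_all add: D_map diff_map assms homogenize_coboundary homogenize_diff homogeneous_coboundary_diff)
qed

lemma D_D:
  assumes "\<phi> \<in> maps p"
  shows "AE x in mu_power (Suc (Suc p)). D (Suc p) (D p \<phi>) x = 0"
proof -
  have "homogenize (Suc p) (D p \<phi>) = homogeneous_coboundary p (homogenize p \<phi>)"
    using homogenize_coboundary[OF assms] by blast
  then have "homogenize (Suc (Suc p)) (D (Suc p) (D p \<phi>)) \<omega> = 0" for \<omega>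
    by (simp add: homogenize_coboundary D_map assms homogeneous_coboundary_square)
  moreover have "homogenize (Suc (Suc p)) (\<lambda>_. 0) \<omega> = 0" for \<omega>
    by (simp add: homogenize_def T_0)
  ultimately show ?thesis
    by (subst AE_eq_homogenize) (simp_all add: D_map assms zero_map)
qed

lemma coboundary_cochain_class:
  assumes "\<phi> \<in> maps p"
  shows "coboundary \<nu> T Y p (cochain_class p \<phi>) = cochain_class (Suc p) (D p \<phi>)"
  unfolding coboundary_def cochain_class_def Suc_eq_plus1[symmetric]
proof (rule induced_map_coset)
  have "(\<lambda>_. 0) \<in> N p" by (simp add: null_maps_iff zero_map)
  then show "N p \<noteq> {}" by (metis empty_iff)
  fix \<theta> assume \<theta>: "\<theta> \<in> N p"
  then have map: "(\<lambda>x. \<theta> x + \<phi> x) \<in> maps p"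
    using assms by (simp add: null_maps_iff measurable_add_A)
  have "AE x in mu_power p. \<theta> x + \<phi> x = \<phi> x"
    using \<theta> by (simp add: null_maps_iff)
  then have "cochain_class (Suc p) (D p (\<lambda>x. \<theta> x + \<phi> x)) = cochain_class (Suc p) (D p \<phi>)"
    using D_cong[OF map assms] by (subst cochain_class_eq_iff) (simp_all only: D_map map assms)
  then show "N (Suc p) #>\<^bsub>C (Suc p)\<^esub> D p (\<theta> \<otimes>\<^bsub>C p\<^esub> \<phi>) = N (Suc p) #>\<^bsub>C (Suc p)\<^esub> D p \<phi>"
    by (simp only: cochain_class_def mult_borel_maps)
qed

lemma coboundary_hom: "coboundary \<nu> T Y p \<in> hom (cochains \<nu> Y p) (cochains \<nu> Y (Suc p))"
proof (rule homI)
  fix X assume "X \<in> carrier (cochains \<nu> Y p)"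
  then obtain \<phi> where "\<phi> \<in> maps p" and X: "X = cochain_class p \<phi>"
    unfolding carrier_cochains by (elim imageE)
  then show "coboundary \<nu> T Y p X \<in> carrier (cochains \<nu> Y (Suc p))"
    unfolding X carrier_cochains by (simp only: coboundary_cochain_class D_map imageI)
  fix X' assume "X' \<in> carrier (cochains \<nu> Y p)"
  then obtain \<psi> where \<psi>: "\<psi> \<in> maps p" and X': "X' = cochain_class p \<psi>"
    unfolding carrier_cochains by (elim imageE)
  have "cochain_class (Suc p) (D p (\<lambda>x. \<phi> x + \<psi> x)) = cochain_class (Suc p) (\<lambda>x. D p \<phi> x + D p \<psi> x)"
    by (subst cochain_class_eq_iff) (simp_all only: D_map measurable_add_A D_add \<open>\<phi> \<in> maps p\<close> \<psi>)
  then show "coboundary \<nu> T Y p (X \<otimes>\<^bsub>cochains \<nu> Y p\<^esub> X') =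
      coboundary \<nu> T Y p X \<otimes>\<^bsub>cochains \<nu> Y (Suc p)\<^esub> coboundary \<nu> T Y p X'"
    unfolding X X' by (simp only: cochain_class_mult coboundary_cochain_class measurable_add_A D_map \<open>\<phi> \<in> maps p\<close> \<psi>)
qed

lemma coboundary_group_hom: "group_hom (cochains \<nu> Y p) (cochains \<nu> Y (Suc p)) (coboundary \<nu> T Y p)"
  by unfold_locales (rule coboundary_hom)

definition cocycle_maps :: "nat \<Rightarrow> ((nat \<Rightarrow> 'g) \<Rightarrow> 'a) set" where
  "cocycle_maps p = {\<phi> \<in> maps p. AE x in mu_power (Suc p). D p \<phi> x = 0}"

lemma cocycles_eq: "cocycles \<nu> T Y p = cochain_class p ` cocycle_maps p"
proof -
  have "coboundary \<nu> T Y p (cochain_class p \<phi>) = \<one>\<^bsub>cochains \<nu> Y (Suc p)\<^esub> \<longleftrightarrow>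
      (AE x in mu_power (Suc p). D p \<phi> x = 0)" if "\<phi> \<in> maps p" for \<phi>
    using that by (simp only: coboundary_cochain_class cochain_class_eq_one_iff D_map)
  then show ?thesis
    unfolding cocycles_def kernel_def carrier_cochains cocycle_maps_def Suc_eq_plus1[symmetric] by blast
qed

lemma cocycle_maps_add:
  assumes "\<phi> \<in> cocycle_maps p" "\<psi> \<in> cocycle_maps p"
  shows "(\<lambda>x. \<phi> x + \<psi> x) \<in> cocycle_maps p"
proof -
  have maps: "\<phi> \<in> maps p" "\<psi> \<in> maps p"
    and zero: "AE x in mu_power (Suc p). D p \<phi> x = 0" "AE x in mu_power (Suc p). D p \<psi> x = 0"
    using assms by (simp_all add: cocycle_maps_def)
  from D_add[OF maps] zero have "AE x in mu_power (Suc p). D p (\<lambda>x. \<phi> x + \<psi> x) x = 0"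
    by eventually_elim simp
  then show ?thesis by (simp add: cocycle_maps_def maps measurable_add_A)
qed

lemma cocycle_maps_diff:
  assumes "\<phi> \<in> cocycle_maps p" "\<psi> \<in> cocycle_maps p"
  shows "(\<lambda>x. \<phi> x - \<psi> x) \<in> cocycle_maps p"
proof -
  have maps: "\<phi> \<in> maps p" "\<psi> \<in> maps p"
    and zero: "AE x in mu_power (Suc p). D p \<phi> x = 0" "AE x in mu_power (Suc p). D p \<psi> x = 0"
    using assms by (simp_all add: cocycle_maps_def)
  from D_diff[OF maps] zero have "AE x in mu_power (Suc p). D p (\<lambda>x. \<phi> x - \<psi> x) x = 0"
    by eventually_elim simp
  then show ?thesis by (simp add: cocycle_maps_def maps diff_map)
qed

text \<open>
  Representatives of the elements of \<open>coboundaries\<close>; in degree 0 these are the null maps.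
\<close>

fun bounding :: "nat \<Rightarrow> ((nat \<Rightarrow> 'g) \<Rightarrow> 'a) \<Rightarrow> bool" where
  "bounding 0 \<phi> \<longleftrightarrow> (AE x in mu_power 0. \<phi> x = 0)"
| "bounding (Suc p) \<phi> \<longleftrightarrow> (\<exists>\<psi>\<in>maps p. AE x in mu_power (Suc p). \<phi> x = D p \<psi> x)"

lemma cochain_class_in_coboundaries_iff:
  assumes "\<phi> \<in> maps p"
  shows "cochain_class p \<phi> \<in> coboundaries \<nu> T Y p \<longleftrightarrow> bounding p \<phi>"
proof (cases p)
  case 0
  then show ?thesis using assms by (simp add: cochain_class_eq_one_iff)
next
  case (Suc q)
  then show ?thesis
    using assms by (auto simp: carrier_cochains image_iff coboundary_cochain_class cochain_class_eq_iff D_map)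
qed

lemma subgroup_coboundaries: "subgroup (coboundaries \<nu> T Y p) (cochains \<nu> Y p)"
proof (cases p)
  case 0
  then show ?thesis by (simp add: Ch.triv_subgroup)
next
  case (Suc q)
  then show ?thesis using group_hom.img_is_subgroup[OF coboundary_group_hom] by simp
qed

lemma coboundaries_cochain_class:
  assumes "X \<in> coboundaries \<nu> T Y p"
  obtains \<beta> where "\<beta> \<in> maps p" "X = cochain_class p \<beta>" "bounding p \<beta>"
proof -
  have "X \<in> cochain_class p ` maps p"
    using assms subgroup.subset[OF subgroup_coboundaries, of p] unfolding carrier_cochains by blast
  then obtain \<beta> where "\<beta> \<in> maps p" "X = cochain_class p \<beta>" by (elim imageE)
  with assms show thesis by (intro that) (simp_all add: cochain_class_in_coboundaries_iff)
qed

definition cohomology_class :: "nat \<Rightarrow> ((nat \<Rightarrow> 'g) \<Rightarrow> 'a) \<Rightarrow> ((nat \<Rightarrow> 'g) \<Rightarrow> 'a) set set" where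
  "cohomology_class p \<phi> = coboundaries \<nu> T Y p #>\<^bsub>cochains \<nu> Y p\<^esub> cochain_class p \<phi>"

lemma carrier_cohomology: "carrier (cohomology \<nu> T Y p) = cohomology_class p ` cocycle_maps p"
  by (simp add: cohomology_def carrier_FactGroup cocycles_eq image_image cohomology_class_def r_coset_def)

lemma cohomology_class_eq_iff:
  assumes "\<phi> \<in> maps p" "\<psi> \<in> maps p"
  shows "cohomology_class p \<phi> = cohomology_class p \<psi> \<longleftrightarrow> bounding p (\<lambda>x. \<phi> x - \<psi> x)"
proof -
  have "cohomology_class p \<phi> = cohomology_class p \<psi> \<longleftrightarrow> (\<exists>h\<in>coboundaries \<nu> T Y p. cochain_class p \<phi> = h \<otimes>\<^bsub>cochains \<nu> Y p\<^esub> cochain_class p \<psi>)"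
    unfolding cohomology_class_def
    by (rule Ch.coset_eq_iff[OF subgroup_coboundaries]) (auto simp: carrier_cochains assms)
  also have "\<dots> \<longleftrightarrow> cochain_class p (\<lambda>x. \<phi> x - \<psi> x) \<in> coboundaries \<nu> T Y p"
  proof
    assume "\<exists>h\<in>coboundaries \<nu> T Y p. cochain_class p \<phi> = h \<otimes>\<^bsub>cochains \<nu> Y p\<^esub> cochain_class p \<psi>"
    then obtain h where h: "h \<in> coboundaries \<nu> T Y p" "cochain_class p \<phi> = h \<otimes>\<^bsub>cochains \<nu> Y p\<^esub> cochain_class p \<psi>"
      by (elim bexE)
    from h(1) obtain \<beta> where "\<beta> \<in> maps p" "h = cochain_class p \<beta>" by (rule coboundaries_cochain_class)
    with h have \<beta>: "\<beta> \<in> maps p" "cochain_class p \<beta> \<in> coboundaries \<nu> T Y p"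
      and "cochain_class p \<phi> = cochain_class p \<beta> \<otimes>\<^bsub>cochains \<nu> Y p\<^esub> cochain_class p \<psi>" by simp_all
    then have "AE x in mu_power p. \<phi> x = \<beta> x + \<psi> x"
      using assms by (simp add: cochain_class_mult cochain_class_eq_iff measurable_add_A)
    then have "AE x in mu_power p. \<phi> x - \<psi> x = \<beta> x" by eventually_elim simp
    then show "cochain_class p (\<lambda>x. \<phi> x - \<psi> x) \<in> coboundaries \<nu> T Y p"
      using \<beta> assms cochain_class_eq_iff[OF diff_map[OF assms] \<beta>(1)] by simp
  next
    assume "cochain_class p (\<lambda>x. \<phi> x - \<psi> x) \<in> coboundaries \<nu> T Y p"
    then show "\<exists>h\<in>coboundaries \<nu> T Y p. cochain_class p \<phi> = h \<otimes>\<^bsub>cochains \<nu> Y p\<^esub> cochain_class p \<psi>"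
      by (rule rev_bexI) (simp add: cochain_class_mult diff_map assms)
  qed
  finally show ?thesis by (simp add: cochain_class_in_coboundaries_iff diff_map assms)
qed

lemma cohomology_class_mult:
  assumes "\<phi> \<in> maps p" "\<psi> \<in> maps p"
  shows "cohomology_class p \<phi> \<otimes>\<^bsub>cohomology \<nu> T Y p\<^esub> cohomology_class p \<psi> = cohomology_class p (\<lambda>x. \<phi> x + \<psi> x)"
proof -
  have "cohomology_class p \<phi> <#>\<^bsub>cochains \<nu> Y p\<^esub> cohomology_class p \<psi> = cohomology_class p (\<lambda>x. \<phi> x + \<psi> x)"
    unfolding cohomology_class_def
    by (subst normal.rcos_sum[OF Ch.subgroup_imp_normal[OF subgroup_coboundaries]])
      (auto simp: carrier_cochains assms cochain_class_mult)
  then show ?thesis by (simp add: cohomology_def set_mult_def)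
qed

end


section \<open>Direct limits and inclusions of submodules\<close>

text \<open>
  Because of \<open>eventually_equal\<close> and \<open>compatible\<close>, two elements of the disjoint union are identified in
  the direct limit exactly when they have the same image in \<open>H\<close>. The points of the limit are therefore the fibres
  of the map to \<open>H\<close>, and \<open>direct_limit_map\<close> sends a fibre to its value.
\<close>

lemma direct_limit_map_iso:
  fixes G :: "'i \<Rightarrow> ('b, 'm) monoid_scheme" and H :: "('c, 'n) monoid_scheme"
  assumes directed: "\<And>i j. i \<in> I \<Longrightarrow> j \<in> I \<Longrightarrow> \<exists>k\<in>I. leq i k \<and> leq j k"
    and f_closed: "\<And>i j x. i \<in> I \<Longrightarrow> j \<in> I \<Longrightarrow> leq i j \<Longrightarrow> x \<in> carrier (G i) \<Longrightarrow> f i j x \<in> carrier (G j)"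
    and m_closed: "\<And>i x y. i \<in> I \<Longrightarrow> x \<in> carrier (G i) \<Longrightarrow> y \<in> carrier (G i) \<Longrightarrow> x \<otimes>\<^bsub>G i\<^esub> y \<in> carrier (G i)"
    and compatible: "\<And>i j x. i \<in> I \<Longrightarrow> j \<in> I \<Longrightarrow> leq i j \<Longrightarrow> x \<in> carrier (G i) \<Longrightarrow> h j (f i j x) = h i x"
    and h_mult: "\<And>i x y. i \<in> I \<Longrightarrow> x \<in> carrier (G i) \<Longrightarrow> y \<in> carrier (G i) \<Longrightarrow>
      h i (x \<otimes>\<^bsub>G i\<^esub> y) = h i x \<otimes>\<^bsub>H\<^esub> h i y"
    and eventually_equal: "\<And>i j x y. i \<in> I \<Longrightarrow> j \<in> I \<Longrightarrow> x \<in> carrier (G i) \<Longrightarrow> y \<in> carrier (G j) \<Longrightarrow>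
      h i x = h j y \<Longrightarrow> \<exists>k\<in>I. leq i k \<and> leq j k \<and> f i k x = f j k y"
    and image: "carrier H = (\<Union>i\<in>I. h i ` carrier (G i))"
  shows "direct_limit_map h \<in> iso (direct_limit I leq G f) H"
proof -
  define E where "E = (SIGMA i:I. carrier (G i))"
  define q where "q = (\<lambda>(i, x). h i x)"
  define fib where "fib v = {a \<in> E. q a = v}" for v
  let ?R = "direct_limit_rel I leq G f" and ?L = "direct_limit I leq G f"
  have R: "(a, b) \<in> ?R \<longleftrightarrow> a \<in> E \<and> b \<in> E \<and> q a = q b" for a b
  proof -
    obtain i x j y where ab: "a = (i, x)" "b = (j, y)" by (cases a, cases b)
    show ?thesis
      unfolding ab direct_limit_rel_def E_def q_def
      using eventually_equal[of i j x y] compatible[of i _ x] compatible[of j _ y] by (auto 0 3) metis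
  qed
  then have fib: "?R `` {a} = fib (q a)" if "a \<in> E" for a
    unfolding Image_singleton R fib_def using that by auto
  have carrier_H: "carrier H = q ` E"
    unfolding image E_def q_def by (auto simp: image_iff Bex_def)
  have carrier_L: "carrier ?L = fib ` carrier H"
    unfolding direct_limit_def E_def[symmetric] carrier_H by (auto simp: quotient_def fib)
  have map_fib: "direct_limit_map h (fib v) = v" if v: "v \<in> carrier H" for v
  proof -
    have "(\<lambda>(i, x). h i x) ` fib v = {v}"
      using v unfolding carrier_H q_def[symmetric] by (auto simp: fib_def)
    then show ?thesis by (simp add: direct_limit_map_def)
  qed
  have mult_fib: "fib v \<otimes>\<^bsub>?L\<^esub> fib w = fib (v \<otimes>\<^bsub>H\<^esub> w) \<and> v \<otimes>\<^bsub>H\<^esub> w \<in> carrier H"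
    if v: "v \<in> carrier H" and w: "w \<in> carrier H" for v w
  proof -
    have step: "?R `` {(k, f i k x \<otimes>\<^bsub>G k\<^esub> f j k y)} = fib (v \<otimes>\<^bsub>H\<^esub> w) \<and> v \<otimes>\<^bsub>H\<^esub> w \<in> carrier H"
      if "(i, x) \<in> fib v" "(j, y) \<in> fib w" "k \<in> I" "leq i k" "leq j k" for i j k x y
    proof -
      let ?a = "(k, f i k x \<otimes>\<^bsub>G k\<^esub> f j k y)"
      have closed: "f i k x \<in> carrier (G k)" "f j k y \<in> carrier (G k)"
        using that by (auto simp: fib_def E_def intro: f_closed)
      then have a: "?a \<in> E" using that by (simp add: E_def m_closed)
      have "q ?a = h k (f i k x) \<otimes>\<^bsub>H\<^esub> h k (f j k y)"
        using that closed by (simp add: q_def h_mult)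
      also have "\<dots> = v \<otimes>\<^bsub>H\<^esub> w"
        using that compatible[of i k x] compatible[of j k y] by (simp add: fib_def E_def q_def)
      finally show ?thesis using fib[OF a] a carrier_H by force
    qed
    obtain i x j y where ij: "(i, x) \<in> fib v" "(j, y) \<in> fib w"
      using v w unfolding carrier_H fib_def by auto
    then obtain k where k: "k \<in> I" "leq i k" "leq j k"
      using directed[of i j] by (auto simp: fib_def E_def)
    have "fib v \<otimes>\<^bsub>?L\<^esub> fib w = (\<Union>(i, x)\<in>fib v. \<Union>(j, y)\<in>fib w. \<Union>k\<in>{k \<in> I. leq i k \<and> leq j k}.
        ?R `` {(k, f i k x \<otimes>\<^bsub>G k\<^esub> f j k y)})"
      by (simp add: direct_limit_def)
    also have "\<dots> = fib (v \<otimes>\<^bsub>H\<^esub> w)"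
    proof
      show "(\<Union>(i, x)\<in>fib v. \<Union>(j, y)\<in>fib w. \<Union>k\<in>{k \<in> I. leq i k \<and> leq j k}.
        ?R `` {(k, f i k x \<otimes>\<^bsub>G k\<^esub> f j k y)}) \<subseteq> fib (v \<otimes>\<^bsub>H\<^esub> w)"
        using step by blast
      have "fib (v \<otimes>\<^bsub>H\<^esub> w) = ?R `` {(k, f i k x \<otimes>\<^bsub>G k\<^esub> f j k y)}"
        using step[OF ij k] by simp
      then show "fib (v \<otimes>\<^bsub>H\<^esub> w) \<subseteq> (\<Union>(i, x)\<in>fib v. \<Union>(j, y)\<in>fib w. \<Union>k\<in>{k \<in> I. leq i k \<and> leq j k}.
        ?R `` {(k, f i k x \<otimes>\<^bsub>G k\<^esub> f j k y)})"
        using ij k by blast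
    qed
    finally show ?thesis using step[OF ij k] by simp
  qed
  show ?thesis
  proof (rule isoI)
    show "direct_limit_map h \<in> hom ?L H"
    proof (rule homI)
      fix P assume "P \<in> carrier ?L"
      then obtain v where v: "v \<in> carrier H" "P = fib v" unfolding carrier_L by (elim imageE)
      then show "direct_limit_map h P \<in> carrier H" by (simp add: map_fib)
      fix Q assume "Q \<in> carrier ?L"
      then obtain w where w: "w \<in> carrier H" "Q = fib w" unfolding carrier_L by (elim imageE)
      show "direct_limit_map h (P \<otimes>\<^bsub>?L\<^esub> Q) = direct_limit_map h P \<otimes>\<^bsub>H\<^esub> direct_limit_map h Q"
        using mult_fib[OF v(1) w(1)] by (simp add: v w map_fib)
    qed
    show "bij_betw (direct_limit_map h) (carrier ?L) (carrier H)"
      unfolding carrier_L by (rule bij_betwI[where g=fib]) (auto simp: map_fib)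
  qed
qed

lemma measurable_count_space_subset:
  assumes "B \<subseteq> A" and A: "countable A"
  shows "f \<in> measurable M (count_space B) \<longleftrightarrow> f \<in> measurable M (count_space A) \<and> f \<in> space M \<rightarrow> B"
proof
  assume f: "f \<in> measurable M (count_space B)"
  have "(\<lambda>x. x) \<in> measurable (count_space B) (count_space A)" using \<open>B \<subseteq> A\<close> by auto
  from measurable_compose[OF f this]
  show "f \<in> measurable M (count_space A) \<and> f \<in> space M \<rightarrow> B"
    using measurable_space[OF f] by auto
next
  assume f: "f \<in> measurable M (count_space A) \<and> f \<in> space M \<rightarrow> B"
  show "f \<in> measurable M (count_space B)"
  proof (rule measurableI)
    show "f -` X \<inter> space M \<in> sets M" if "X \<in> sets (count_space B)" for X
      using f that \<open>B \<subseteq> A\<close> by (auto intro: measurable_sets[of f M "count_space A"])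
  qed (use f in auto)
qed

context haar_module
begin

text \<open>
  Hence everything proved for \<open>A\<close> is also available for each submodule.
\<close>

lemma haar_module_stable:
  assumes B: "stable B"
  shows "haar_module \<mu> T B \<nu>"
proof
  note sub = stableD(1)[OF B]
  show "countable B" using countable_subset[OF sub countable_A] .
  show "(\<lambda>g. T g a) \<in> measurable \<mu> (count_space B)" if "a \<in> B" for a
    using that sub T_measurable stableD(5)[OF B]
    by (auto simp: measurable_count_space_subset[OF sub countable_A])
  show "T g (a + b) = T g a + T g b" if "a \<in> B" "b \<in> B" for g a b
    using that sub by (intro T_add) auto
  show "T 0 a = a" if "a \<in> B" for a
    using that sub by (intro T_zero) auto
  show "T (g + h) a = T g (T h a)" if "a \<in> B" for g h a
    using that sub by (intro T_T) auto
qed (use stableD[OF B] sets_power AE_power in simp_all)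

lemma stable_maps:
  assumes "stable B"
  shows "\<phi> \<in> measurable (mu_power p) (count_space B) \<longleftrightarrow> \<phi> \<in> maps p \<and> \<phi> \<in> space (mu_power p) \<rightarrow> B"
  by (rule measurable_count_space_subset[OF stableD(1)[OF assms] countable_A])

lemma stable_mapsD: "stable B \<Longrightarrow> \<phi> \<in> measurable (mu_power p) (count_space B) \<Longrightarrow> \<phi> \<in> maps p"
  by (simp only: stable_maps)

lemma stable_cocycle_maps:
  assumes B: "stable B"
  shows "\<phi> \<in> haar_module.cocycle_maps \<mu> T B p \<longleftrightarrow>
    \<phi> \<in> cocycle_maps p \<and> \<phi> \<in> measurable (mu_power p) (count_space B)"
  by (auto simp: haar_module.cocycle_maps_def[OF haar_module_stable[OF B]] cocycle_maps_def stable_maps[OF B])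

lemma stable_bounding:
  assumes B: "stable B" and b: "haar_module.bounding \<mu> T B p \<phi>"
  shows "bounding p \<phi>"
proof -
  interpret B: haar_module \<mu> T B \<nu> by (rule haar_module_stable[OF B])
  show ?thesis using b stable_maps[OF B] by (cases p) auto
qed

lemma cochain_inclusion_class:
  assumes B: "stable B" and \<phi>: "\<phi> \<in> measurable (mu_power p) (count_space B)"
  shows "cochain_inclusion \<nu> Y p (haar_module.cochain_class B \<nu> p \<phi>) = cochain_class p \<phi>"
proof -
  interpret B: haar_module \<mu> T B \<nu> by (rule haar_module_stable[OF B])
  show ?thesis
    unfolding cochain_inclusion_def B.cochain_class_def cochain_class_def
  proof (rule induced_map_coset)
    have "(\<lambda>_. 0) \<in> B.N p" by (simp add: B.null_maps_iff B.zero_map)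
    then show "B.N p \<noteq> {}" by (metis empty_iff)
    fix \<theta> assume "\<theta> \<in> B.N p"
    then have \<theta>: "\<theta> \<in> B.maps p" "AE x in mu_power p. \<theta> x = 0" by (simp_all add: B.null_maps_iff)
    have "\<theta> \<in> maps p" "\<phi> \<in> maps p"
      by (rule stable_mapsD[OF B \<theta>(1)], rule stable_mapsD[OF B \<phi>])
    moreover have "AE x in mu_power p. \<theta> x + \<phi> x = \<phi> x" using \<theta>(2) by eventually_elim simp
    ultimately have "cochain_class p (\<lambda>x. \<theta> x + \<phi> x) = cochain_class p \<phi>" by (subst cochain_class_eq_iff) (simp_all add: measurable_add_A)
    then show "N p #>\<^bsub>C p\<^esub> (\<theta> \<otimes>\<^bsub>B.C p\<^esub> \<phi>) = N p #>\<^bsub>C p\<^esub> \<phi>"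
      by (simp only: cochain_class_def B.mult_borel_maps)
  qed
qed

lemma cohomology_inclusion_class:
  assumes B: "stable B" and \<phi>: "\<phi> \<in> measurable (mu_power p) (count_space B)"
  shows "cohomology_inclusion \<nu> T Y p (haar_module.cohomology_class T B \<nu> p \<phi>) = cohomology_class p \<phi>"
proof -
  interpret B: haar_module \<mu> T B \<nu> by (rule haar_module_stable[OF B])
  have \<phi>': "\<phi> \<in> maps p" by (rule stable_mapsD[OF B \<phi>])
  have "induced_map (cochains \<nu> Y p) (coboundaries \<nu> T Y p) (cochain_inclusion \<nu> Y p)
      (coboundaries \<nu> T B.Y p #>\<^bsub>cochains \<nu> B.Y p\<^esub> B.cochain_class p \<phi>) =
    coboundaries \<nu> T Y p #>\<^bsub>cochains \<nu> Y p\<^esub> cochain_inclusion \<nu> Y p (B.cochain_class p \<phi>)"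
  proof (rule induced_map_coset)
    show "coboundaries \<nu> T B.Y p \<noteq> {}"
      using subgroup.one_closed[OF B.subgroup_coboundaries[of p]] by (metis empty_iff)
    fix X assume "X \<in> coboundaries \<nu> T B.Y p"
    then obtain \<beta> where \<beta>: "\<beta> \<in> B.maps p" "X = B.cochain_class p \<beta>" "B.bounding p \<beta>" by (rule B.coboundaries_cochain_class)
    have \<beta>': "\<beta> \<in> maps p" by (rule stable_mapsD[OF B \<beta>(1)])
    have "X \<otimes>\<^bsub>cochains \<nu> B.Y p\<^esub> B.cochain_class p \<phi> = B.cochain_class p (\<lambda>x. \<beta> x + \<phi> x)"
      unfolding \<beta>(2) by (rule B.cochain_class_mult[OF \<beta>(1) \<phi>])
    then have 1: "cochain_inclusion \<nu> Y p (X \<otimes>\<^bsub>cochains \<nu> B.Y p\<^esub> B.cochain_class p \<phi>) = cochain_class p (\<lambda>x. \<beta> x + \<phi> x)"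
      using cochain_inclusion_class[OF B B.measurable_add_A[OF \<beta>(1) \<phi>]] by (simp only:)
    have "bounding p (\<lambda>x. (\<beta> x + \<phi> x) - \<phi> x)"
      using stable_bounding[OF B \<beta>(3)] by simp
    then have "cohomology_class p (\<lambda>x. \<beta> x + \<phi> x) = cohomology_class p \<phi>"
      by (subst cohomology_class_eq_iff) (simp_all only: measurable_add_A \<beta>' \<phi>')
    then show "coboundaries \<nu> T Y p #>\<^bsub>cochains \<nu> Y p\<^esub> cochain_inclusion \<nu> Y p (X \<otimes>\<^bsub>cochains \<nu> B.Y p\<^esub> B.cochain_class p \<phi>)
      = coboundaries \<nu> T Y p #>\<^bsub>cochains \<nu> Y p\<^esub> cochain_inclusion \<nu> Y p (B.cochain_class p \<phi>)"
      unfolding 1 cochain_inclusion_class[OF B \<phi>] by (simp only: cohomology_class_def)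
  qed
  then show ?thesis
    by (simp only: cohomology_inclusion_def B.cohomology_class_def cohomology_class_def cochain_inclusion_class[OF B \<phi>])
qed

lemma D_zero: "AE x in mu_power (Suc p). D p (\<lambda>_. 0) x = 0"
  using D_diff[OF zero_map zero_map, of p] by simp

lemma bounding_cocycle:
  assumes \<theta>: "\<theta> \<in> maps p" and b: "bounding p \<theta>"
  shows "\<theta> \<in> cocycle_maps p"
proof -
  have "AE x in mu_power (Suc p). D p \<theta> x = 0"
  proof (cases p)
    case 0
    have "AE x in mu_power p. \<theta> x = 0" using b unfolding 0 by simp
    from D_cong[OF \<theta> zero_map this] D_zero show ?thesis by eventually_elim simp
  next
    case (Suc q)
    have "bounding (Suc q) \<theta>" using b unfolding Suc .
    then obtain \<psi> where \<psi>: "\<psi> \<in> maps q" "AE x in mu_power p. \<theta> x = D q \<psi> x"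
      unfolding bounding.simps Suc by (elim bexE)
    have "D q \<psi> \<in> maps p" unfolding Suc by (rule D_map[OF \<psi>(1)])
    from D_cong[OF \<theta> this \<psi>(2)] D_D[OF \<psi>(1), folded Suc] show ?thesis by eventually_elim simp
  qed
  then show ?thesis using \<theta> by (simp add: cocycle_maps_def)
qed

text \<open>
  Countability of \<open>A\<close> enters here: the events that \<open>\<phi>\<close> avoids the first \<open>k\<close>
  elements of an enumeration of \<open>A\<close> decrease to the empty set.
\<close>

lemma emeasure_outside_finite:
  assumes \<phi>: "\<phi> \<in> maps p" and e: "e > 0"
  shows "\<exists>F. finite F \<and> F \<subseteq> A \<and> emeasure (mu_power p) {x \<in> space (mu_power p). \<phi> x \<notin> F} \<le> e"
proof -
  interpret pw: prob_space "mu_power p" by (rule prob_space_PiM) (rule prob)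
  let ?a = "from_nat_into A"
  have A: "range ?a = A" using range_from_nat_into[OF _ countable_A] zero_closed by auto
  define E where "E k = {x \<in> space (mu_power p). \<phi> x \<notin> ?a ` {..k}}" for k
  have sub: "?a ` {..k} \<subseteq> A" for k using A by blast
  have "E k \<in> sets (mu_power p)" for k unfolding E_def by (rule sets_not_in[OF \<phi> sub])
  moreover have "decseq E" by (auto simp: decseq_def E_def)
  ultimately have "(\<lambda>k. emeasure (mu_power p) (E k)) \<longlonglongrightarrow> emeasure (mu_power p) (\<Inter>k. E k)"
    by (intro Lim_emeasure_decseq) auto
  also have "(\<Inter>k. E k) = {}"
  proof (rule ccontr)
    assume "(\<Inter>k. E k) \<noteq> {}"
    then obtain x where x: "\<And>k. x \<in> E k" by blast
    then have "\<phi> x \<in> range ?a" using measurable_space[OF \<phi>, of x] A by (auto simp: E_def)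
    then obtain k where "\<phi> x = ?a k" by blast
    with x[of k] show False by (simp add: E_def)
  qed
  finally have "(\<lambda>k. emeasure (mu_power p) (E k)) \<longlonglongrightarrow> 0" by simp
  then have "\<forall>\<^sub>F k in sequentially. emeasure (mu_power p) (E k) < e"
    using e by (rule order_tendstoD(2))
  from eventually_happens'[OF sequentially_bot this]
  obtain k where "emeasure (mu_power p) (E k) < e" by (elim exE)
  then show ?thesis
    using sub[of k] by (intro exI[of _ "?a ` {..k}"]) (simp add: E_def less_imp_le)
qed

end

locale exhausted_module = haar_module \<mu> T A \<nu>
  for \<mu> :: "'g::{topological_group_add, second_countable_topology} measure"
    and T :: "'g \<Rightarrow> 'a::ab_group_add \<Rightarrow> 'a" and A :: "'a set" and \<nu> :: "'g measure" +
  fixes I :: "'i set" and Am :: "'i \<Rightarrow> 'a set"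
  assumes stable_Am: "m \<in> I \<Longrightarrow> stable (Am m)"
    and directed: "m \<in> I \<Longrightarrow> n \<in> I \<Longrightarrow> \<exists>k\<in>I. Am m \<subseteq> Am k \<and> Am n \<subseteq> Am k"
    and exhaust: "(\<Union>m\<in>I. Am m) = A"
begin

lemma finite_subset_Am:
  assumes "finite F" "F \<subseteq> A" "m \<in> I"
  shows "\<exists>n\<in>I. Am m \<subseteq> Am n \<and> F \<subseteq> Am n"
  using assms(1,2)
proof (induction F)
  case empty
  show ?case using \<open>m \<in> I\<close> by (intro bexI[of _ m]) simp_all
next
  case (insert a F)
  then have "F \<subseteq> A" by simp
  from insert.IH[OF this] obtain n where n: "n \<in> I" "Am m \<subseteq> Am n" "F \<subseteq> Am n" by (elim bexE conjE)
  obtain j where j: "j \<in> I" "a \<in> Am j" using insert.prems unfolding exhaust[symmetric] by auto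
  from directed[OF n(1) j(1)] obtain k where k: "k \<in> I" "Am n \<subseteq> Am k" "Am j \<subseteq> Am k" by (elim bexE conjE)
  show ?case using n j k by (intro bexI[OF _ k(1)]) auto
qed

text \<open>
  The rigidity statement is applied to \<open>B = A\<^sub>n\<close>, where \<open>n\<close> is so large that \<open>A\<^sub>n\<close> contains \<open>A\<^sub>m\<close> and
  a finite set in which \<open>\<phi>\<close> has its values up to the tolerated measure. In degree 0 there is a single
  value.
\<close>

lemma relative_cochain:
  assumes m: "m \<in> I" and \<phi>: "\<phi> \<in> maps p" and rel: "AE x in mu_power (Suc p). D p \<phi> x \<in> Am m"
  shows "\<exists>n\<in>I. Am m \<subseteq> Am n \<and> (\<exists>\<phi>'\<in>measurable (mu_power p) (count_space (Am n)). bounding p (\<lambda>x. \<phi> x - \<phi>' x))"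
proof (cases p)
  case 0
  let ?u = "\<lambda>_. undefined"
  have space: "space (mu_power p) = {?u}" using 0 by (simp add: space_PiM)
  then have "{\<phi> ?u} \<subseteq> A" using measurable_space[OF \<phi>, of ?u] by simp
  from finite_subset_Am[OF finite.insertI[OF finite.emptyI] this m] obtain n where n: "n \<in> I" "Am m \<subseteq> Am n" "{\<phi> ?u} \<subseteq> Am n"
    by (elim bexE conjE)
  have "\<phi> \<in> space (mu_power p) \<rightarrow> Am n" using n(3) space by simp
  then have \<phi>': "\<phi> \<in> measurable (mu_power p) (count_space (Am n))"
    using \<phi> by (simp only: stable_maps[OF stable_Am[OF n(1)]])
  have "bounding p (\<lambda>x. \<phi> x - \<phi> x)" unfolding 0 by simp
  then show ?thesis by (intro bexI[OF _ n(1)] conjI n(2) bexI[OF _ \<phi>'])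
next
  case (Suc q)
  obtain e where "e > 0" and e: "\<forall>B f. stable B \<longrightarrow> f \<in> homogeneous_cochains (Suc q) \<longrightarrow>
    (AE \<omega> in S. homogeneous_coboundary (Suc q) f \<omega> \<in> B) \<longrightarrow> emeasure S {\<omega>. f \<omega> \<notin> B} \<le> e \<longrightarrow>
    (\<exists>\<kappa>\<in>homogeneous_cochains q. AE \<omega> in S. f \<omega> - homogeneous_coboundary q \<kappa> \<omega> \<in> B)"
    using almost_stable_cocycle[of q] by (elim exE conjE)
  obtain F where F: "finite F" "F \<subseteq> A" "emeasure (mu_power p) {x \<in> space (mu_power p). \<phi> x \<notin> F} \<le> e"
    using emeasure_outside_finite[OF \<phi> \<open>e > 0\<close>] by (elim exE conjE)
  obtain n where n: "n \<in> I" "Am m \<subseteq> Am n" "F \<subseteq> Am n" using finite_subset_Am[OF F(1,2) m] by (elim bexE conjE)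
  have B: "stable (Am n)" by (rule stable_Am[OF n(1)])
  let ?f = "homogenize p \<phi>"
  have f: "?f \<in> homogeneous_cochains (Suc q)" using homogenize_cochain[OF \<phi>] Suc by simp
  have "AE x in mu_power (Suc p). D p \<phi> x \<in> Am n"
    using rel by eventually_elim (use n in blast)
  then have "AE \<omega> in S. homogenize (Suc p) (D p \<phi>) \<omega> \<in> Am n"
    by (simp only: AE_homogenize[OF B D_map[OF \<phi>]])
  then have "AE \<omega> in S. homogeneous_coboundary p ?f \<omega> \<in> Am n"
    by (simp only: homogenize_coboundary[OF \<phi>])
  then have cocycle: "AE \<omega> in S. homogeneous_coboundary (Suc q) ?f \<omega> \<in> Am n"
    by (simp only: Suc)
  have "emeasure S {\<omega>. ?f \<omega> \<notin> Am n} = emeasure (mu_power p) {x \<in> space (mu_power p). \<phi> x \<notin> Am n}"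
    by (rule emeasure_homogenize[OF B \<phi>])
  also have "\<dots> \<le> emeasure (mu_power p) {x \<in> space (mu_power p). \<phi> x \<notin> F}"
    by (rule emeasure_mono) (use n sets_not_in[OF \<phi> F(2)] in auto)
  also note F(3)
  finally have "emeasure S {\<omega>. ?f \<omega> \<notin> Am n} \<le> e" .
  from e[rule_format, OF B f cocycle this] obtain \<kappa> where \<kappa>: "\<kappa> \<in> homogeneous_cochains q"
    and close: "AE \<omega> in S. ?f \<omega> - homogeneous_coboundary q \<kappa> \<omega> \<in> Am n"
    by (elim bexE)
  define \<psi> where "\<psi> x = \<kappa> (path q x)" for x
  have \<psi>: "\<psi> \<in> maps q" and hom_\<psi>: "homogenize q \<psi> = \<kappa>"
    unfolding \<psi>_def by (rule dehomogenize[OF \<kappa>] ext)+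
  have d\<psi>: "D q \<psi> \<in> maps p" using D_map[OF \<psi>] Suc by simp
  have "homogenize p (D q \<psi>) \<omega> = homogeneous_coboundary q \<kappa> \<omega>" for \<omega>
    using homogenize_coboundary[OF \<psi>, of \<omega>] by (simp only: Suc hom_\<psi>)
  then have "AE \<omega> in S. homogenize p (\<lambda>x. \<phi> x - D q \<psi> x) \<omega> \<in> Am n"
    using close by (simp only: homogenize_diff[OF \<phi> d\<psi>])
  then have close': "AE x in mu_power p. \<phi> x - D q \<psi> x \<in> Am n"
    by (simp only: AE_homogenize[OF B diff_map[OF \<phi> d\<psi>]])
  \<comment> \<open>The corrected cochain has values in \<open>A\<^sub>n\<close> almost everywhere; \<open>r\<close> makes this hold everywhere.\<close>
  define r where "r a = (if a \<in> Am n then a else 0)" for a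
  define \<phi>' where "\<phi>' x = r (\<phi> x - D q \<psi> x)" for x
  have "r \<in> measurable (count_space A) (count_space (Am n))"
    using stableD(2)[OF B] by (simp add: r_def)
  from measurable_compose[OF diff_map[OF \<phi> d\<psi>] this]
  have \<phi>': "\<phi>' \<in> measurable (mu_power p) (count_space (Am n))" by (simp add: \<phi>'_def[abs_def])
  have "AE x in mu_power p. \<phi> x - \<phi>' x = D q \<psi> x"
    using close' by eventually_elim (simp add: \<phi>'_def r_def)
  then have "bounding p (\<lambda>x. \<phi> x - \<phi>' x)"
    unfolding Suc bounding.simps by (rule bexI[OF _ \<psi>])
  then show ?thesis by (intro bexI[OF _ n(1)] conjI n(2) bexI[OF _ \<phi>'])
qed

text \<open>
  If \<open>\<theta> = d\<kappa>\<close> over \<open>A\<close>, then \<open>\<kappa>\<close> is a cochain with \<open>A\<^sub>m\<close>-valued coboundary, and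
  \<open>relative_cochain\<close> replaces it by an \<open>A\<^sub>n\<close>-valued one without changing the coboundary.
\<close>

lemma relative_bounding:
  assumes m: "m \<in> I" and \<theta>: "\<theta> \<in> measurable (mu_power p) (count_space (Am m))" and b: "bounding p \<theta>"
  shows "\<exists>n\<in>I. Am m \<subseteq> Am n \<and> haar_module.bounding \<mu> T (Am n) p \<theta>"
proof (cases p)
  case 0
  interpret M: haar_module \<mu> T "Am m" \<nu> by (rule haar_module_stable[OF stable_Am[OF m]])
  have "M.bounding p \<theta>" using b 0 by simp
  then show ?thesis using m by blast
next
  case (Suc q)
  have "bounding (Suc q) \<theta>" using b unfolding Suc .
  then obtain \<kappa> where \<kappa>: "\<kappa> \<in> maps q" and eq: "AE x in mu_power (Suc q). \<theta> x = D q \<kappa> x"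
    unfolding bounding.simps by (elim bexE)
  have "AE x in mu_power (Suc q). \<theta> x \<in> Am m"
    using measurable_space[OF \<theta>] Suc by (intro AE_I2) simp
  with eq have "AE x in mu_power (Suc q). D q \<kappa> x \<in> Am m" by eventually_elim simp
  from relative_cochain[OF m \<kappa> this] obtain n \<kappa>' where n: "n \<in> I" "Am m \<subseteq> Am n"
    and \<kappa>': "\<kappa>' \<in> measurable (mu_power q) (count_space (Am n))" and b': "bounding q (\<lambda>x. \<kappa> x - \<kappa>' x)" by blast
  interpret M: haar_module \<mu> T "Am n" \<nu> by (rule haar_module_stable[OF stable_Am[OF n(1)]])
  have \<kappa>'_map: "\<kappa>' \<in> maps q" by (rule stable_mapsD[OF stable_Am[OF n(1)] \<kappa>'])
  have "(\<lambda>x. \<kappa> x - \<kappa>' x) \<in> cocycle_maps q" by (rule bounding_cocycle[OF diff_map[OF \<kappa> \<kappa>'_map] b'])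
  then have "AE x in mu_power (Suc q). D q (\<lambda>x. \<kappa> x - \<kappa>' x) x = 0" by (simp add: cocycle_maps_def)
  with D_diff[OF \<kappa> \<kappa>'_map] eq have "AE x in mu_power (Suc q). \<theta> x = D q \<kappa>' x" by eventually_elim simp
  then have "M.bounding p \<theta>"
    unfolding Suc M.bounding.simps by (rule bexI[OF _ \<kappa>'])
  then show ?thesis by (intro bexI[OF _ n(1)] conjI n(2))
qed

lemma stable_Am_Am:
  assumes "m \<in> I" "n \<in> I" "Am m \<subseteq> Am n"
  shows "discrete_action.stable T (Am n) (Am m)"
proof -
  interpret M: haar_module \<mu> T "Am n" \<nu> by (rule haar_module_stable[OF stable_Am[OF assms(2)]])
  show ?thesis using stableD[OF stable_Am[OF assms(1)]] assms(3) by (auto simp: M.stable_def)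
qed

text \<open>
  Surjectivity is \<open>relative_cochain\<close> for cocycles. Injectivity, in the form required for direct limits, is
  \<open>relative_bounding\<close> for the difference of two cocycles.
\<close>

theorem direct_limit_cohomology:
  "direct_limit_map (\<lambda>m. cohomology_inclusion \<nu> T (discrete_topology A) p)
     \<in> iso
        (direct_limit I (\<lambda>m n. Am m \<subseteq> Am n)
          (\<lambda>m. cohomology \<nu> T (discrete_topology (Am m)) p)
          (\<lambda>m n. cohomology_inclusion \<nu> T (discrete_topology (Am n)) p))
        (cohomology \<nu> T (discrete_topology A) p)"
proof (rule direct_limit_map_iso)
  let ?H = "\<lambda>m. cohomology \<nu> T (discrete_topology (Am m)) p"
  let ?c = "\<lambda>m. haar_module.cohomology_class T (Am m) \<nu> p" and ?Z = "\<lambda>m. haar_module.cocycle_maps \<mu> T (Am m) p"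
  let ?M = "\<lambda>m. measurable (mu_power p) (count_space (Am m))"
  note module = haar_module_stable[OF stable_Am]
  have carrier: "carrier (?H m) = ?c m ` ?Z m" if "m \<in> I" for m
    by (rule haar_module.carrier_cohomology[OF module[OF that]])
  have Z_maps: "\<phi> \<in> ?Z m \<Longrightarrow> \<phi> \<in> ?M m" "\<phi> \<in> ?Z m \<Longrightarrow> \<phi> \<in> cocycle_maps p" if "m \<in> I" for m \<phi>
    by (simp_all add: stable_cocycle_maps[OF stable_Am[OF that]])
  have h_class: "cohomology_inclusion \<nu> T Y p (?c m \<phi>) = cohomology_class p \<phi>" if "m \<in> I" "\<phi> \<in> ?Z m" for m \<phi>
    by (rule cohomology_inclusion_class[OF stable_Am[OF that(1)] Z_maps(1)[OF that]])
  have f_class: "cohomology_inclusion \<nu> T (discrete_topology (Am n)) p (?c m \<phi>) = ?c n \<phi>"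
    if "m \<in> I" "n \<in> I" "Am m \<subseteq> Am n" "\<phi> \<in> ?Z m" for m n \<phi>
    by (rule haar_module.cohomology_inclusion_class[OF module[OF that(2)] stable_Am_Am[OF that(1-3)] Z_maps(1)[OF that(1,4)]])
  have Z_mono: "\<phi> \<in> ?Z n" if "m \<in> I" "n \<in> I" "Am m \<subseteq> Am n" "\<phi> \<in> ?Z m" for m n \<phi>
    using haar_module.stable_cocycle_maps[OF module[OF that(2)] stable_Am_Am[OF that(1-3)], of \<phi> p] that(4) by simp
  have m_class: "?c m \<phi> \<otimes>\<^bsub>?H m\<^esub> ?c m \<psi> = ?c m (\<lambda>x. \<phi> x + \<psi> x)" "(\<lambda>x. \<phi> x + \<psi> x) \<in> ?Z m"
    if "m \<in> I" "\<phi> \<in> ?Z m" "\<psi> \<in> ?Z m" for m \<phi> \<psi>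
    using that Z_maps(1)[OF that(1)]
    by (simp_all add: haar_module.cohomology_class_mult[OF module[OF that(1)]] haar_module.cocycle_maps_add[OF module[OF that(1)]])
  show "\<exists>k\<in>I. Am m \<subseteq> Am k \<and> Am n \<subseteq> Am k" if "m \<in> I" "n \<in> I" for m n
    by (rule directed[OF that])
  show "cohomology_inclusion \<nu> T (discrete_topology (Am n)) p x \<in> carrier (?H n)"
    if "m \<in> I" "n \<in> I" "Am m \<subseteq> Am n" "x \<in> carrier (?H m)" for m n x
    using that f_class[OF that(1-3)] Z_mono[OF that(1-3)] by (auto simp: carrier)
  show "x \<otimes>\<^bsub>?H m\<^esub> y \<in> carrier (?H m)" if "m \<in> I" "x \<in> carrier (?H m)" "y \<in> carrier (?H m)" for m x y
    using that m_class[OF that(1)] by (auto simp: carrier)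
  show "cohomology_inclusion \<nu> T Y p (cohomology_inclusion \<nu> T (discrete_topology (Am n)) p x) =
      cohomology_inclusion \<nu> T Y p x"
    if "m \<in> I" "n \<in> I" "Am m \<subseteq> Am n" "x \<in> carrier (?H m)" for m n x
    using that f_class[OF that(1-3)] Z_mono[OF that(1-3)] h_class by (auto simp: carrier)
  show "cohomology_inclusion \<nu> T Y p (x \<otimes>\<^bsub>?H m\<^esub> y) =
      cohomology_inclusion \<nu> T Y p x \<otimes>\<^bsub>cohomology \<nu> T Y p\<^esub> cohomology_inclusion \<nu> T Y p y"
    if m: "m \<in> I" and xy: "x \<in> carrier (?H m)" "y \<in> carrier (?H m)" for m x y
  proof -
    obtain \<phi> \<psi> where \<phi>: "\<phi> \<in> ?Z m" "x = ?c m \<phi>" and \<psi>: "\<psi> \<in> ?Z m" "y = ?c m \<psi>"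
      using xy by (auto simp: carrier[OF m])
    have "\<phi> \<in> maps p" "\<psi> \<in> maps p"
      using Z_maps(2)[OF m \<phi>(1)] Z_maps(2)[OF m \<psi>(1)] by (simp_all add: cocycle_maps_def)
    then show ?thesis
      using m_class[OF m \<phi>(1) \<psi>(1)] by (simp add: \<phi> \<psi> h_class[OF m] cohomology_class_mult)
  qed
  show "\<exists>k\<in>I. Am m \<subseteq> Am k \<and> Am n \<subseteq> Am k \<and>
      cohomology_inclusion \<nu> T (discrete_topology (Am k)) p x = cohomology_inclusion \<nu> T (discrete_topology (Am k)) p y"
    if mn: "m \<in> I" "n \<in> I" and x: "x \<in> carrier (?H m)" and y: "y \<in> carrier (?H n)"
      and eq: "cohomology_inclusion \<nu> T Y p x = cohomology_inclusion \<nu> T Y p y" for m n x y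
  proof -
    obtain \<phi> \<psi> where \<phi>: "\<phi> \<in> ?Z m" "x = ?c m \<phi>" and \<psi>: "\<psi> \<in> ?Z n" "y = ?c n \<psi>"
      using x y by (auto simp: carrier[OF mn(1)] carrier[OF mn(2)])
    have maps: "\<phi> \<in> maps p" "\<psi> \<in> maps p"
      using Z_maps(2)[OF mn(1) \<phi>(1)] Z_maps(2)[OF mn(2) \<psi>(1)] by (simp_all add: cocycle_maps_def)
    have "cohomology_class p \<phi> = cohomology_class p \<psi>" using eq by (simp add: \<phi> \<psi> h_class[OF mn(1)] h_class[OF mn(2)])
    then have b: "bounding p (\<lambda>x. \<phi> x - \<psi> x)" by (simp add: cohomology_class_eq_iff[OF maps])
    obtain k where k: "k \<in> I" "Am m \<subseteq> Am k" "Am n \<subseteq> Am k" using directed[OF mn] by blast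
    have "(\<lambda>x. \<phi> x - \<psi> x) \<in> ?M k"
      by (rule haar_module.diff_map[OF module[OF k(1)]
            Z_maps(1)[OF k(1) Z_mono[OF mn(1) k(1,2) \<phi>(1)]] Z_maps(1)[OF k(1) Z_mono[OF mn(2) k(1,3) \<psi>(1)]]])
    from relative_bounding[OF k(1) this b] obtain l where l: "l \<in> I" "Am k \<subseteq> Am l"
      and b': "haar_module.bounding \<mu> T (Am l) p (\<lambda>x. \<phi> x - \<psi> x)" by blast
    have ml: "Am m \<subseteq> Am l" "Am n \<subseteq> Am l" using k l by auto
    have "\<phi> \<in> ?M l" "\<psi> \<in> ?M l"
      using Z_maps(1)[OF l(1) Z_mono[OF mn(1) l(1) ml(1) \<phi>(1)]] Z_maps(1)[OF l(1) Z_mono[OF mn(2) l(1) ml(2) \<psi>(1)]] .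
    then have "?c l \<phi> = ?c l \<psi>" using b' by (simp add: haar_module.cohomology_class_eq_iff[OF module[OF l(1)]])
    then show ?thesis
      using l ml f_class[OF mn(1) l(1) ml(1) \<phi>(1)] f_class[OF mn(2) l(1) ml(2) \<psi>(1)]
      by (intro bexI[OF _ l(1)]) (simp add: \<phi> \<psi>)
  qed
  show "carrier (cohomology \<nu> T Y p) = (\<Union>m\<in>I. cohomology_inclusion \<nu> T Y p ` carrier (?H m))"
  proof
    show "(\<Union>m\<in>I. cohomology_inclusion \<nu> T Y p ` carrier (?H m)) \<subseteq> carrier (cohomology \<nu> T Y p)"
      using h_class Z_maps(2) by (auto simp: carrier carrier_cohomology)
    show "carrier (cohomology \<nu> T Y p) \<subseteq> (\<Union>m\<in>I. cohomology_inclusion \<nu> T Y p ` carrier (?H m))"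
    proof
      fix v assume "v \<in> carrier (cohomology \<nu> T Y p)"
      then obtain \<phi> where \<phi>: "\<phi> \<in> cocycle_maps p" "v = cohomology_class p \<phi>" by (auto simp: carrier_cohomology)
      then have map: "\<phi> \<in> maps p" and "AE x in mu_power (Suc p). D p \<phi> x = 0" by (simp_all add: cocycle_maps_def)
      \<comment> \<open>The index set is not empty, since \<open>A\<close> contains 0.\<close>
      obtain m where m: "m \<in> I" using zero_closed exhaust by auto
      have "AE x in mu_power (Suc p). D p \<phi> x \<in> Am m"
        using \<open>AE x in mu_power (Suc p). D p \<phi> x = 0\<close> by eventually_elim (simp add: stableD(2)[OF stable_Am[OF m]])
      from relative_cochain[OF m map this] obtain n \<phi>' where n: "n \<in> I"
        and \<phi>': "\<phi>' \<in> ?M n" and b: "bounding p (\<lambda>x. \<phi> x - \<phi>' x)" by blast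
      have map': "\<phi>' \<in> maps p" by (rule stable_mapsD[OF stable_Am[OF n] \<phi>'])
      have "(\<lambda>x. \<phi> x - (\<phi> x - \<phi>' x)) \<in> cocycle_maps p"
        by (rule cocycle_maps_diff[OF \<phi>(1) bounding_cocycle[OF diff_map[OF map map'] b]])
      then have Z: "\<phi>' \<in> ?Z n" using \<phi>' by (simp add: stable_cocycle_maps[OF stable_Am[OF n]])
      have "v = cohomology_inclusion \<nu> T Y p (?c n \<phi>')"
        using b by (simp add: \<phi>(2) h_class[OF n Z] cohomology_class_eq_iff[OF map map'])
      then show "v \<in> (\<Union>m\<in>I. cohomology_inclusion \<nu> T Y p ` carrier (?H m))"
        using n Z by (auto simp: carrier)
    qed
  qed
qed

end


section \<open>Normalization of the Haar measure and the theorem\<close>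

lemma AE_scale_measure:
  assumes "r \<noteq> 0"
  shows "(AE x in scale_measure r M. P x) \<longleftrightarrow> (AE x in M. P x)"
proof -
  have "null_sets (scale_measure r M) = null_sets M"
    using assms by (auto simp: null_sets_def)
  then show ?thesis by (simp add: eventually_ae_filter space_scale_measure)
qed

lemma PiM_scale_measure:
  assumes M: "finite_measure M" and "prob_space (scale_measure r M)" and "finite J"
  shows "(\<Pi>\<^sub>M i\<in>J. scale_measure r M) = scale_measure (r ^ card J) (\<Pi>\<^sub>M i\<in>J. M)"
proof -
  interpret M: finite_measure M by (rule M)
  interpret N: prob_space "scale_measure r M" by fact
  interpret P: product_sigma_finite "\<lambda>_. M" by unfold_locales
  interpret Q: product_sigma_finite "\<lambda>_. scale_measure r M" by unfold_locales
  have "scale_measure (r ^ card J) (\<Pi>\<^sub>M i\<in>J. M) = (\<Pi>\<^sub>M i\<in>J. scale_measure r M)"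
  proof (rule Q.PiM_eqI[OF \<open>finite J\<close>])
    show "sets (scale_measure (r ^ card J) (\<Pi>\<^sub>M i\<in>J. M)) = sets (\<Pi>\<^sub>M i\<in>J. scale_measure r M)"
      by (simp cong: sets_PiM_cong)
    fix E assume E: "\<And>i. i \<in> J \<Longrightarrow> E i \<in> sets (scale_measure r M)"
    then have "emeasure (\<Pi>\<^sub>M i\<in>J. M) (Pi\<^sub>E J E) = (\<Prod>i\<in>J. emeasure M (E i))"
      using \<open>finite J\<close> by (intro P.emeasure_PiM) auto
    then show "emeasure (scale_measure (r ^ card J) (\<Pi>\<^sub>M i\<in>J. M)) (Pi\<^sub>E J E) =
        (\<Prod>i\<in>J. emeasure (scale_measure r M) (E i))"
      by (simp add: prod.distrib)
  qed
  then show ?thesis by simp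
qed

lemma discrete_polish_moduleD:
  fixes T :: "'g::topological_group_add \<Rightarrow> 'a::ab_group_add \<Rightarrow> 'a"
  assumes "polish_module T (discrete_topology B)"
  shows "countable B" "0 \<in> B"
    "\<And>a b. a \<in> B \<Longrightarrow> b \<in> B \<Longrightarrow> a + b \<in> B" "\<And>a. a \<in> B \<Longrightarrow> - a \<in> B"
    "\<And>g a. a \<in> B \<Longrightarrow> T g a \<in> B"
    "\<And>g a b. a \<in> B \<Longrightarrow> b \<in> B \<Longrightarrow> T g (a + b) = T g a + T g b"
    "\<And>a. a \<in> B \<Longrightarrow> T 0 a = a" "\<And>g h a. a \<in> B \<Longrightarrow> T (g + h) a = T g (T h a)"
    "\<And>a. a \<in> B \<Longrightarrow> (\<lambda>g. T g a) \<in> measurable borel (count_space B)"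
proof -
  let ?Y = "discrete_topology B"
  have add: "continuous_map (prod_topology ?Y ?Y) ?Y (\<lambda>(a, b). a + b)"
    and minus: "continuous_map ?Y ?Y (\<lambda>a. - a)"
    and act: "continuous_map (prod_topology euclidean ?Y) ?Y (\<lambda>(g, a). T g a)"
    and "second_countable ?Y"
    using assms by (auto simp: polish_module_def)
  then show "countable B" by (simp add: second_countable_discrete_topology)
  show "0 \<in> B" "\<And>g a b. a \<in> B \<Longrightarrow> b \<in> B \<Longrightarrow> T g (a + b) = T g a + T g b"
    "\<And>a. a \<in> B \<Longrightarrow> T 0 a = a" "\<And>g h a. a \<in> B \<Longrightarrow> T (g + h) a = T g (T h a)"
    using assms by (auto simp: polish_module_def)
  show "a + b \<in> B" if "a \<in> B" "b \<in> B" for a b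
    using continuous_map_image_subset_topspace[OF add] that by auto
  show "- a \<in> B" if "a \<in> B" for a
    using continuous_map_image_subset_topspace[OF minus] that by auto
  show T: "T g a \<in> B" if "a \<in> B" for g a
    using continuous_map_image_subset_topspace[OF act] that by auto
  show "(\<lambda>g. T g a) \<in> measurable borel (count_space B)" if a: "a \<in> B" for a
  proof (rule measurableI)
    fix X assume "X \<in> sets (count_space B)"
    then have "X \<subseteq> B" by simp
    have "continuous_map euclidean (prod_topology euclidean ?Y) (\<lambda>g. (g, a))"
      using a by (simp add: continuous_map_pairedI)
    from continuous_map_compose[OF this act]
    have "continuous_map euclidean ?Y (\<lambda>g. T g a)" by (simp add: o_def)
    from openin_continuous_map_preimage[OF this, of X]
    have "open {g. T g a \<in> X}" using \<open>X \<subseteq> B\<close> by simp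
    then show "(\<lambda>g. T g a) -` X \<inter> space borel \<in> sets borel" by (simp add: vimage_def)
  qed (use T a in auto)
qed

definition normalize_measure :: "'g measure \<Rightarrow> 'g measure" where
  "normalize_measure \<nu> = scale_measure (1 / emeasure \<nu> (space \<nu>)) \<nu>"

text \<open>
  Compactness makes the total mass finite, so that scaling yields an invariant probability measure. The powers are
  scaled by powers of the same constant and keep their null sets.
\<close>

lemma haar_prob_normalize:
  fixes \<nu> :: "'g::{topological_group_add, second_countable_topology} measure"
  assumes haar: "haar_measure \<nu>" and compact: "compact (UNIV :: 'g set)"
  shows "haar_prob (normalize_measure \<nu>)"
    and "sets (haar_power \<nu> p) = sets (\<Pi>\<^sub>M i\<in>{1..p}. normalize_measure \<nu>)"
    and "(AE x in haar_power \<nu> p. P x) \<longleftrightarrow> (AE x in (\<Pi>\<^sub>M i\<in>{1..p}. normalize_measure \<nu>). P x)"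
proof -
  let ?c = "emeasure \<nu> (space \<nu>)"
  have sets: "sets \<nu> = sets borel" using haar by (simp add: haar_measure_def)
  then have space: "space \<nu> = UNIV" using sets_eq_imp_space_eq by fastforce
  have c: "?c \<noteq> 0" "?c < \<infinity>"
    using haar compact by (auto simp: haar_measure_def space)
  have fin: "finite_measure \<nu>" by (rule finite_measureI) (use c in simp)
  have r: "1 / ?c \<noteq> 0" using c by (simp add: ennreal_divide_eq_0_iff less_top)
  have "1 / ?c * ?c = 1"
    using c by (simp add: ennreal_divide_times less_top[symmetric])
  then have prob: "prob_space (normalize_measure \<nu>)"
    by (intro prob_spaceI) (simp add: normalize_measure_def space_scale_measure)
  have invariant: "emeasure \<nu> ((\<lambda>x. g + x) -` X) = emeasure \<nu> X" if X: "X \<in> sets borel" for g X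
  proof -
    have "(\<lambda>x. g + x) -` X = (\<lambda>x. - g + x) ` X"
    proof
      show "(\<lambda>x. g + x) -` X \<subseteq> (\<lambda>x. - g + x) ` X"
        by (rule subsetI, rule image_eqI[where x="g + _"]) (auto simp: add.assoc[symmetric])
    qed (auto simp: add.assoc[symmetric])
    then show ?thesis using haar X by (simp add: haar_measure_def)
  qed
  show "haar_prob (normalize_measure \<nu>)"
  proof (rule haar_prob.intro)
    show sets': "sets (normalize_measure \<nu>) = sets borel" by (simp add: normalize_measure_def sets)
    have plus: "(\<lambda>x. g + x) \<in> measurable (normalize_measure \<nu>) (normalize_measure \<nu>)" for g
      using measurable_cong_sets[OF sets' sets'] by simp
    show "distr (normalize_measure \<nu>) (normalize_measure \<nu>) (\<lambda>x. g + x) = normalize_measure \<nu>" for g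
    proof (rule measure_eqI)
      fix X assume "X \<in> sets (distr (normalize_measure \<nu>) (normalize_measure \<nu>) (\<lambda>x. g + x))"
      then have X: "X \<in> sets (normalize_measure \<nu>)" "X \<in> sets borel" by (simp_all add: sets')
      have "space (normalize_measure \<nu>) = UNIV" by (simp add: normalize_measure_def space_scale_measure space)
      then have "emeasure (distr (normalize_measure \<nu>) (normalize_measure \<nu>) (\<lambda>x. g + x)) X =
          emeasure (normalize_measure \<nu>) ((\<lambda>x. g + x) -` X)"
        by (simp add: emeasure_distr[OF plus X(1)])
      also have "\<dots> = emeasure (normalize_measure \<nu>) X"
        using invariant[OF X(2), of g] by (simp add: normalize_measure_def)
      finally show "emeasure (distr (normalize_measure \<nu>) (normalize_measure \<nu>) (\<lambda>x. g + x)) X =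
          emeasure (normalize_measure \<nu>) X" .
    qed simp
  qed (rule prob)
  have power: "(\<Pi>\<^sub>M i\<in>{1..p}. normalize_measure \<nu>) = scale_measure ((1 / ?c) ^ card {1..p}) (haar_power \<nu> p)"
    using PiM_scale_measure[OF fin prob[unfolded normalize_measure_def] finite_atLeastAtMost]
    by (simp only: normalize_measure_def haar_power_def)
  show "sets (haar_power \<nu> p) = sets (\<Pi>\<^sub>M i\<in>{1..p}. normalize_measure \<nu>)"
    unfolding power by simp
  show "(AE x in haar_power \<nu> p. P x) \<longleftrightarrow> (AE x in (\<Pi>\<^sub>M i\<in>{1..p}. normalize_measure \<nu>). P x)"
    unfolding power by (rule AE_scale_measure[symmetric]) (rule power_not_zero[OF r])
qed

text \<open>
  The transition maps have to agree for every source index, since the group operation is defined on arbitrary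
  sets of pairs.
\<close>

lemma direct_limit_cong:
  assumes G: "\<And>i. i \<in> I \<Longrightarrow> G i = G' i" and f: "\<And>i j. j \<in> I \<Longrightarrow> f i j = f' i j"
  shows "direct_limit I leq G f = direct_limit I leq G' f'"
proof -
  have rel: "direct_limit_rel I leq G f = direct_limit_rel I leq G' f'"
    unfolding direct_limit_rel_def using G f by (auto; metis)
  show ?thesis
    unfolding direct_limit_def rel using G f by (auto intro!: ext SUP_cong Sigma_cong arg_cong2[where f="(//)"])
qed

theorem theoremC:
  fixes \<mu> :: "'g::{topological_group_add, t2_space, second_countable_topology} measure"
    and T :: "'g \<Rightarrow> 'a::ab_group_add \<Rightarrow> 'a"
    and A :: "'a set"
    and I :: "'i set"
    and Am :: "'i \<Rightarrow> 'a set"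
    and p :: nat
  assumes "compact (UNIV :: 'g set)"
    and "haar_measure \<mu>"
    and "polish_module T (discrete_topology A)"
    and "\<And>m. m \<in> I \<Longrightarrow> submodule T (discrete_topology A) (Am m)"
    and "\<And>m n. m \<in> I \<Longrightarrow> n \<in> I \<Longrightarrow> \<exists>k\<in>I. Am m \<subseteq> Am k \<and> Am n \<subseteq> Am k"
    and "(\<Union>m\<in>I. Am m) = A"
  shows "direct_limit_map (\<lambda>m. cohomology_inclusion \<mu> T (discrete_topology A) p)
     \<in> iso
        (direct_limit I (\<lambda>m n. Am m \<subseteq> Am n)
          (\<lambda>m. cohomology \<mu> T (subtopology (discrete_topology A) (Am m)) p)
          (\<lambda>m n. cohomology_inclusion \<mu> T (subtopology (discrete_topology A) (Am n)) p))
        (cohomology \<mu> T (discrete_topology A) p)"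
proof -
  note A = discrete_polish_moduleD[OF assms(3)]
  note normalize = haar_prob_normalize[OF assms(2,1)]
  interpret haar_prob "normalize_measure \<mu>" by (rule normalize(1))
  interpret haar_module "normalize_measure \<mu>" T A \<mu>
  proof
    show "(\<lambda>g. T g a) \<in> measurable (normalize_measure \<mu>) (count_space A)" if "a \<in> A" for a
      using A(9)[OF that] measurable_cong_sets[OF sets_mu refl] by simp
  qed (use A(1-8) normalize(2,3) in simp_all)
  have Am: "A \<inter> Am m = Am m" "stable (Am m)" if "m \<in> I" for m
  proof -
    have sub: "Am m \<subseteq> A" "polish_module T (discrete_topology (A \<inter> Am m))"
      using assms(4)[OF that] by (auto simp: submodule_def)
    then show eq: "A \<inter> Am m = Am m" by blast
    have "polish_module T (discrete_topology (Am m))" using sub(2) by (simp only: eq)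
    from discrete_polish_moduleD[OF this] sub(1) show "stable (Am m)" by (simp add: stable_def)
  qed
  interpret exhausted_module "normalize_measure \<mu>" T A \<mu> I Am
    by unfold_locales (rule Am(2) assms(5,6); assumption?)+
  \<comment> \<open>For indices outside \<open>I\<close>, the set \<open>Am m\<close> need not lie in \<open>A\<close>; only indices in \<open>I\<close> matter.\<close>
  show ?thesis
    using direct_limit_cohomology[of p]
    by (subst direct_limit_cong[where G'="\<lambda>m. cohomology \<mu> T (discrete_topology (Am m)) p"
        and f'="\<lambda>m n. cohomology_inclusion \<mu> T (discrete_topology (Am n)) p"]) (simp_all add: Am)
qed

end
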